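(* Let $G=(\mathbb{R}^+\times SO(n))\ltimes\mathbb{R}^n$ be the similitude group and $\pi$ its representation on $L^2(\mathbb{R}^n)$ given by $\pi(a,r_\theta,t)f(x)=a^{-n/2}f\left(r_\theta^{-1}\left(\frac{x-t}{a}\right)\right)$. Let $(\psi_1,\psi_2)$ be an admissible pair in $L^2(\mathbb{R}^n)$ and let $f\in L^2(\mathbb{R}^n)$ with $\widehat f\in L^1(\mathbb{R}^n)$. Then for any $\epsilon,p>0$ there exist $A_2>A_1>0$ such that for every $(a,r_\theta,t)\in G$ with $0<p\le a$, and all $0<A_1'\le A_1$ and $A_2'\ge A_2$, $$\left\|\pi(a,r_\theta,t)f(x)-C_{\psi_1\psi_2}^{-1}\int_{A_1'a}^{A_2'a}\int_{SO(n)}\int_{\mathbb{R}^n}\langle\pi(a,r_\theta,t)f,\pi(a_1,r_{\theta_1},t_1)\psi_1\rangle\,\pi(a_1,r_{\theta_1},t_1)\psi_2(x)\,\frac{dt_1\,d\theta_1\,da_1}{a_1^{n+1}}\right\|_\infty\le\epsilon,$$ where $\|\cdot\|_\infty$ is the $L^\infty(\mathbb{R}^n)$ norm in the variable $x$.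
   Context: The similitude group $G=(\mathbb{R}^+\times SO(n))\ltimes\mathbb{R}^n$ has group law $(a,r_\theta,t)(a_1,r_{\theta_1},t_1)=(aa_1,r_\theta r_{\theta_1},t+ar_\theta t_1)$ and left Haar measure $\frac{da\,d\theta\,dt}{a^{n+1}}$, where $d\theta$ is normalized Haar measure on $SO(n)$. Standing assumption: $n$ is such that $\pi$ is a square integrable irreducible representation of $G$ (this is the case for $n\ge2$). The Fourier transform is $\widehat f(\omega)=\int_{\mathbb{R}^n}f(x)e^{-2\pi i x\cdot\omega}dx$, extended to $L^2$. A function $\psi\in L^2(\mathbb{R}^n)$ is admissible if $0<C_\psi<\infty$, where $C_\psi=\int_{\mathbb{R}^+}\int_{SO(n)}\frac{|\widehat\psi(ar_\theta^{-1}(\omega))|^2}{a}\,da\,d\theta$, which is the same constant for almost every $\omega\in\mathbb{R}^n$. A pair $(\psi_1,\psi_2)$ of admissible functions is an admissible pair if $\langle\psi_1,\psi_2\rangle\ne0$ and $$C_{\psi_1\psi_2}=\frac{1}{\langle\psi_1,\psi_2\rangle}\int_G\langle\psi_1,\pi(g)\psi_1\rangle\,\overline{\langle\psi_2,\pi(g)\psi_2\rangle}\,dg$$ is a non-zero scalar; equivalently, for almost every $\omega$, $C_{\psi_1\psi_2}=\int_{\mathbb{R}^+}\int_{SO(n)}\frac{\overline{\widehat{\psi_1}(ar_\theta^{-1}(\omega))}\,\widehat{\psi_2}(ar_\theta^{-1}(\omega))}{a}\,da\,d\theta$, independent of $\omega$ up to a null set. *)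

theory Defs
  imports "HOL-Probability.Probability"
begin

section \<open>Square integrable functions and the Fourier transform\<close>

text \<open>Elements of \<open>L\<^sup>2(\<real>\<^sup>n)\<close> are handled through Borel measurable representatives; every class
  of Lebesgue measurable functions contains one.\<close>

definition L2_space :: "(real ^ 'n \<Rightarrow> complex) set" where
  "L2_space = {f \<in> borel_measurable lborel. integrable lborel (\<lambda>x. (cmod (f x))\<^sup>2)}"

definition L2_inner :: "(real ^ 'n \<Rightarrow> complex) \<Rightarrow> (real ^ 'n \<Rightarrow> complex) \<Rightarrow> complex" where
  "L2_inner f g = (LINT x|lborel. f x * cnj (g x))"

text \<open>The squared \<open>L\<^sup>2\<close> distance takes values in the extended nonnegative reals, so that it is
  infinite (and not the default value 0) when the difference is not square integrable.\<close>

definition L2_dist_sq :: "(real ^ 'n \<Rightarrow> complex) \<Rightarrow> (real ^ 'n \<Rightarrow> complex) \<Rightarrow> ennreal" where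
  "L2_dist_sq f g = (\<integral>\<^sup>+x. ennreal ((cmod (f x - g x))\<^sup>2) \<partial>lborel)"

definition fourier_L1 :: "(real ^ 'n \<Rightarrow> complex) \<Rightarrow> real ^ 'n \<Rightarrow> complex" where
  "fourier_L1 f \<omega> = (LINT x|lborel. f x * exp (- (2 * of_real pi * \<i> * of_real (x \<bullet> \<omega>))))"

text \<open>Extension by continuity from the dense subspace \<open>L\<^sup>1 \<inter> L\<^sup>2\<close>; by Plancherel's theorem such an
  \<open>F\<close> exists for every \<open>f\<close> in \<open>L\<^sup>2\<close> and is unique up to a null set.\<close>

definition has_fourier_L2 :: "(real ^ 'n \<Rightarrow> complex) \<Rightarrow> (real ^ 'n \<Rightarrow> complex) \<Rightarrow> bool" where
  "has_fourier_L2 f F \<longleftrightarrow> F \<in> L2_space \<and>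
     (\<exists>g :: nat \<Rightarrow> real ^ 'n \<Rightarrow> complex.
        (\<forall>k. g k \<in> L2_space \<and> integrable lborel (g k)) \<and>
        (\<lambda>k. L2_dist_sq (g k) f) \<longlonglongrightarrow> 0 \<and>
        (\<lambda>k. L2_dist_sq (fourier_L1 (g k)) F) \<longlonglongrightarrow> 0)"

definition fourier_L2 :: "(real ^ 'n \<Rightarrow> complex) \<Rightarrow> real ^ 'n \<Rightarrow> complex" where
  "fourier_L2 f = (SOME F. has_fourier_L2 f F)"

definition Linf_norm :: "(real ^ 'n \<Rightarrow> complex) \<Rightarrow> ereal" where
  "Linf_norm f = esssup lborel (\<lambda>x. ereal (cmod (f x)))"


section \<open>The similitude group and its representation\<close>

definition SO_group :: "(real ^ 'n ^ 'n) set" where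
  "SO_group = {r. rotation_matrix r}"

definition normalized_haar_SO :: "(real ^ 'n ^ 'n) measure \<Rightarrow> bool" where
  "normalized_haar_SO \<mu> \<longleftrightarrow>
     sets \<mu> = sets (restrict_space borel SO_group) \<and> prob_space \<mu> \<and>
     (\<forall>r\<in>SO_group. \<forall>B\<in>sets \<mu>. emeasure \<mu> ((\<lambda>s. r ** s) ` B) = emeasure \<mu> B)"

type_synonym 'n similitude = "real \<times> (real ^ 'n ^ 'n) \<times> (real ^ 'n)"

definition similitude_group :: "'n::finite similitude set" where
  "similitude_group = {(a, r, t). 0 < a \<and> r \<in> SO_group}"

fun similitude_mult :: "'n::finite similitude \<Rightarrow> 'n similitude \<Rightarrow> 'n similitude" where
  "similitude_mult (a, r, t) (a1, r1, t1) = (a * a1, r ** r1, t + a *\<^sub>R (r *v t1))"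

text \<open>The left Haar measure \<open>da d\<theta> dt / a\<^bsup>n+1\<^esup>\<close>, given the normalized Haar measure \<open>\<mu>\<close> of the
  rotation group.\<close>

definition similitude_haar :: "(real ^ 'n ^ 'n) measure \<Rightarrow> 'n::finite similitude measure" where
  "similitude_haar \<mu> =
     density (restrict_space lborel {0<..} \<Otimes>\<^sub>M (\<mu> \<Otimes>\<^sub>M lborel))
       (\<lambda>(a, r, t). ennreal (1 / a ^ (CARD('n) + 1)))"

fun sim_rep :: "'n::finite similitude \<Rightarrow> (real ^ 'n \<Rightarrow> complex) \<Rightarrow> real ^ 'n \<Rightarrow> complex" where
  "sim_rep (a, r, t) f x =
     of_real (a powr (- (real CARD('n) / 2))) * f (matrix_inv r *v ((x - t) /\<^sub>R a))"

lemma sim_rep_mult: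
  fixes g h :: "'n::finite similitude"
  assumes "g \<in> similitude_group" "h \<in> similitude_group"
  shows "sim_rep (similitude_mult g h) f = sim_rep g (sim_rep h f)"
proof -
  obtain a r t where g: "g = (a, r, t)" by (cases g) auto
  obtain b s u where h: "h = (b, s, u)" by (cases h) auto
  from assms g h have pos: "a > 0" "b > 0" and orth: "orthogonal_matrix r" "orthogonal_matrix s"
    by (auto simp: similitude_group_def SO_group_def rotation_matrix_def)
  have inv: "matrix_inv q = transpose q" if "orthogonal_matrix q" for q :: "real ^ 'n ^ 'n"
  proof -
    have "q ** matrix_inv q = mat 1"
      using that unfolding orthogonal_matrix_def matrix_inv_def by (metis (mono_tags, lifting) someI_ex)
    then have "transpose q ** (q ** matrix_inv q) = transpose q"
      by simp
    with that show ?thesis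
      by (simp add: matrix_mul_assoc orthogonal_matrix_def)
  qed
  have rs: "matrix_inv (r ** s) = matrix_inv s ** matrix_inv r"
    using orth by (simp add: inv orthogonal_matrix_mul matrix_transpose_mul)
  have cancel: "matrix_inv r *v (r *v v) = v" for v
    using orth by (simp add: inv matrix_vector_mul_assoc orthogonal_matrix)
  have "matrix_inv (r ** s) *v ((x - (t + a *\<^sub>R (r *v u))) /\<^sub>R (a * b)) =
        matrix_inv s *v ((matrix_inv r *v ((x - t) /\<^sub>R a) - u) /\<^sub>R b)" for x
  proof -
    have "(x - (t + a *\<^sub>R (r *v u))) /\<^sub>R (a * b) = ((x - t) /\<^sub>R a - r *v u) /\<^sub>R b"
      using pos by (simp add: algebra_simps)
    then show ?thesis
      by (simp add: rs cancel matrix_vector_mul_assoc [symmetric] matrix_vector_mult_diff_distrib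
          matrix_vector_mult_scaleR)
  qed
  then show ?thesis
    using pos by (simp add: g h fun_eq_iff powr_mult)
qed


section \<open>Admissibility\<close>

definition C_adm :: "(real ^ 'n ^ 'n) measure \<Rightarrow> (real ^ 'n \<Rightarrow> complex) \<Rightarrow> real ^ 'n \<Rightarrow> ennreal" where
  "C_adm \<mu> \<psi> \<omega> =
     (\<integral>\<^sup>+a\<in>{0<..}. (\<integral>\<^sup>+r. ennreal ((cmod (fourier_L2 \<psi> (a *\<^sub>R (matrix_inv r *v \<omega>))))\<^sup>2 / a) \<partial>\<mu>) \<partial>lborel)"

definition admissible :: "(real ^ 'n ^ 'n) measure \<Rightarrow> (real ^ 'n \<Rightarrow> complex) \<Rightarrow> bool" where
  "admissible \<mu> \<psi> \<longleftrightarrow> \<psi> \<in> L2_space \<and>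
     (\<exists>C. 0 < C \<and> C < \<infinity> \<and> (AE \<omega> in lborel. C_adm \<mu> \<psi> \<omega> = C))"

definition C_pair ::
  "(real ^ 'n ^ 'n) measure \<Rightarrow> (real ^ 'n \<Rightarrow> complex) \<Rightarrow> (real ^ 'n \<Rightarrow> complex) \<Rightarrow> complex" where
  "C_pair \<mu> \<psi>1 \<psi>2 =
     1 / L2_inner \<psi>1 \<psi>2 *
     (LINT g|similitude_haar \<mu>. L2_inner \<psi>1 (sim_rep g \<psi>1) * cnj (L2_inner \<psi>2 (sim_rep g \<psi>2)))"

definition admissible_pair ::
  "(real ^ 'n ^ 'n) measure \<Rightarrow> (real ^ 'n \<Rightarrow> complex) \<Rightarrow> (real ^ 'n \<Rightarrow> complex) \<Rightarrow> bool" where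
  "admissible_pair \<mu> \<psi>1 \<psi>2 \<longleftrightarrow>
     admissible \<mu> \<psi>1 \<and> admissible \<mu> \<psi>2 \<and> L2_inner \<psi>1 \<psi>2 \<noteq> 0 \<and> C_pair \<mu> \<psi>1 \<psi>2 \<noteq> 0"

end

theory Submission
  imports Defs
begin

text \<open>
  On the Fourier side the representation is diagonal up to a change of variables: a similitude
  \<open>(a, r, t)\<close> turns \<open>F\<close> into \<open>a\<^bsup>n/2\<^esup> e\<^bsup>-2\<pi>i t\<cdot>\<xi>\<^esup> F(a r\<^sup>-\<^sup>1\<xi>)\<close>. Hence for fixed \<open>(a, r)\<close> the
  wavelet coefficients, as a function of \<open>t\<close>, are the inverse Fourier transform of
  \<open>H(\<xi>) a\<^bsup>n/2\<^esup> cnj \<Psi>1(a r\<^sup>-\<^sup>1\<xi>)\<close>, where \<open>H\<close> and \<open>\<Psi>1\<close> are the transforms of the analysed function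
  \<open>h\<close> and of the analysing wavelet. Parseval's identity evaluates the integral over \<open>t\<close>, and the
  truncated integral becomes the inverse transform of \<open>H \<cdot> C_part {u..v}\<close>, where \<open>C_part S \<xi>\<close> is
  the integral of \<open>cnj \<Psi>1 \<Psi>2\<close> at \<open>a r\<^sup>-\<^sup>1\<xi>\<close> against \<open>da d\<theta> / a\<close> over \<open>a \<in> S\<close>
  (\<open>truncated_reconstruction\<close>).

  Over all \<open>a > 0\<close> that integral does not depend on \<open>\<xi>\<close>, since the measure is invariant and
  dilations and rotations act transitively off the origin (\<open>cross_integral_const\<close>). Its value is the
  constant of the pair, by Parseval again (\<open>C_pair_eq\<close>).

  The error at a point is therefore at most \<open>1 / |C|\<close> times the integral of \<open>|H|\<close> times the missing
  tail of the admissibility integral. For \<open>h = \<pi>(a, r, t) f\<close> and the window from \<open>u a\<close> to \<open>v a\<close>, the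
  substitution \<open>\<xi> \<rightarrow> a r\<^sup>-\<^sup>1\<xi>\<close> removes \<open>(a, r, t)\<close> except for a factor \<open>a\<^bsup>-n/2\<^esup>\<close>, which is bounded
  because \<open>a\<close> stays away from 0 (\<open>truncation_error\<close>). What is left depends only on \<open>u\<close> and \<open>v\<close> and
  tends to 0 as the window exhausts the scales, by dominated convergence (\<open>C_tail_limit\<close>), since the
  transform of \<open>f\<close> is integrable.

  The first half of the file develops the \<open>L\<^sup>2\<close> theory of the Fourier transform. Plancherel's
  theorem is obtained from the autocorrelation of \<open>g\<close>: its transform is the square of the modulus of
  the transform of \<open>g\<close>, its value at 0 is the energy of \<open>g\<close>, and Gaussian summation compares the two.
\<close>

section \<open>Invariance of Lebesgue measure under similitudes\<close>

lemma nn_integral_lborel_translate: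
  fixes f :: "'a::euclidean_space \<Rightarrow> ennreal"
  assumes [measurable]: "f \<in> borel_measurable borel"
  shows "(\<integral>\<^sup>+x. f (x + t) \<partial>lborel) = (\<integral>\<^sup>+x. f x \<partial>lborel)"
proof -
  have "(\<integral>\<^sup>+x. f x \<partial>lborel) = (\<integral>\<^sup>+x. f x \<partial>distr lborel borel ((+) t))"
    by (simp only: lborel_distr_plus)
  also have "\<dots> = (\<integral>\<^sup>+x. f (t + x) \<partial>lborel)"
    by (subst nn_integral_distr) auto
  finally show ?thesis by (simp add: add.commute)
qed

text \<open>A translation invariant measure is a multiple of Lebesgue measure, and the factor is 1 because an
  orthogonal map preserves the unit ball. The uniqueness argument is Fubini's theorem for the
  product of the indicators of \<open>B\<close> and of the ball, translated against each other.\<close>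

lemma distr_orthogonal_lborel:
  fixes R :: "'a::euclidean_space \<Rightarrow> 'a"
  assumes R: "orthogonal_transformation R"
  shows "distr lborel borel R = lborel"
proof (rule measure_eqI)
  fix B assume "B \<in> sets (distr lborel borel R)"
  then have [measurable]: "B \<in> sets borel" by simp
  have cont: "continuous_on UNIV R"
    using R by (simp add: orthogonal_transformation_linear linear_continuous_on linear_linear)
  have [measurable]: "R \<in> borel_measurable borel"
    by (rule borel_measurable_continuous_onI[OF cont])
  define U where "U = ball (0::'a) 1"
  have [measurable]: "U \<in> sets borel" by (simp add: U_def)
  have dR: "R (x + y) = R x + R y" for x y
    using R by (simp add: orthogonal_transformation_linear linear_add)
  have nR: "norm (R x) = norm x" for x
    using R by (simp add: orthogonal_transformation_norm)
  obtain S where S: "\<And>x. R (S x) = x"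
    using orthogonal_transformation_surj[OF R] by (metis surjD)
  have fin: "emeasure lborel U \<noteq> \<infinity>" "emeasure lborel U \<noteq> 0"
    using emeasure_lborel_ball_finite[of 0 1] content_ball_pos[of 1 "0::'a"]
    by (auto simp: U_def measure_def less_top)
  \<comment> \<open>\<open>U\<close> is the unit ball and \<open>S\<close> a right inverse of \<open>R\<close>, so that translating by \<open>S x\<close> before \<open>R\<close> is translating by \<open>x\<close> after it.\<close>
  have "emeasure lborel U * emeasure (distr lborel borel R) B =
      (\<integral>\<^sup>+x. indicator U x * (\<integral>\<^sup>+y. indicator B (R y) \<partial>lborel) \<partial>lborel)"
  proof -
    have "(\<integral>\<^sup>+y. indicator B (R y) \<partial>lborel) = (\<integral>\<^sup>+y. indicator B y \<partial>distr lborel borel R)"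
      by (subst nn_integral_distr) auto
    then show ?thesis by (simp add: nn_integral_multc)
  qed
  also have "\<dots> = (\<integral>\<^sup>+x. indicator U x * (\<integral>\<^sup>+y. indicator B (R (y + S x)) \<partial>lborel) \<partial>lborel)"
    by (subst nn_integral_lborel_translate[of "\<lambda>y. indicator B (R y)"]) auto
  also have "\<dots> = (\<integral>\<^sup>+x. (\<integral>\<^sup>+y. indicator U x * indicator B (R y + x) \<partial>lborel) \<partial>lborel)"
    by (subst nn_integral_cmult) (auto simp: dR S)
  also have "\<dots> = (\<integral>\<^sup>+y. (\<integral>\<^sup>+x. indicator U x * indicator B (R y + x) \<partial>lborel) \<partial>lborel)"
    by (rule lborel_pair.Fubini') measurable
  also have "\<dots> = (\<integral>\<^sup>+y. (\<integral>\<^sup>+x. indicator U (x + - R y) * indicator B (R y + (x + - R y)) \<partial>lborel) \<partial>lborel)"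
    by (subst nn_integral_lborel_translate[where t="- R _", of "\<lambda>x. indicator U x * indicator B (R _ + x)"]) auto
  also have "\<dots> = (\<integral>\<^sup>+y. (\<integral>\<^sup>+x. indicator U (x - R y) * indicator B x \<partial>lborel) \<partial>lborel)"
    by simp
  also have "\<dots> = (\<integral>\<^sup>+x. (\<integral>\<^sup>+y. indicator U (x - R y) * indicator B x \<partial>lborel) \<partial>lborel)"
    by (rule lborel_pair.Fubini') measurable
  also have "\<dots> = (\<integral>\<^sup>+x. (\<integral>\<^sup>+y. indicator U (y + - S x) \<partial>lborel) * indicator B x \<partial>lborel)"
  proof (intro nn_integral_cong)
    fix x
    have "norm (x - R y) = norm (y - S x)" for y
    proof -
      have "R (y + - S x) + x = R y" using dR[of "y - S x" "S x"] S by simp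
      then have "x - R y = - R (y - S x)" by (simp add: algebra_simps)
      then show ?thesis by (simp add: nR)
    qed
    then have "indicator U (x - R y) = (indicator U (y + - S x) :: ennreal)" for y
      by (simp add: U_def indicator_def)
    then show "(\<integral>\<^sup>+y. indicator U (x - R y) * indicator B x \<partial>lborel) =
        (\<integral>\<^sup>+y. indicator U (y + - S x) \<partial>lborel) * indicator B x"
      by (simp add: nn_integral_multc)
  qed
  also have "\<dots> = emeasure lborel U * emeasure lborel B"
    by (subst nn_integral_lborel_translate) (auto simp: nn_integral_cmult)
  finally show "emeasure (distr lborel borel R) B = emeasure lborel B"
    using fin by (simp add: ennreal_mult_cancel_left)
qed simp

lemma matrix_inv_SO:
  assumes "r \<in> SO_group" shows "matrix_inv r = transpose r"
proof -
  have o: "orthogonal_matrix r" using assms by (simp add: SO_group_def rotation_matrix_def)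
  then have "r ** matrix_inv r = mat 1"
    unfolding orthogonal_matrix_def matrix_inv_def by (metis (mono_tags, lifting) someI_ex)
  then have "transpose r ** (r ** matrix_inv r) = transpose r" by simp
  with o show ?thesis by (simp add: matrix_mul_assoc orthogonal_matrix_def)
qed

lemma SO_group_inv: "r \<in> SO_group \<Longrightarrow> matrix_inv r \<in> SO_group"
  by (simp add: matrix_inv_SO) (simp add: SO_group_def rotation_matrix_def orthogonal_matrix_transpose det_transpose)

lemma SO_group_mult: "r \<in> SO_group \<Longrightarrow> s \<in> SO_group \<Longrightarrow> r ** s \<in> SO_group"
  by (simp add: SO_group_def rotation_matrix_def orthogonal_matrix_mul det_mul)

lemma SO_group_cancel:
  assumes "r \<in> SO_group"
  shows "matrix_inv r ** r = mat 1" "r ** matrix_inv r = mat 1"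
    "matrix_inv r *v (r *v x) = x" "r *v (matrix_inv r *v x) = x"
proof -
  show 1: "matrix_inv r ** r = mat 1" "r ** matrix_inv r = mat 1"
    using assms by (auto simp: matrix_inv_SO SO_group_def rotation_matrix_def orthogonal_matrix_def)
  show "matrix_inv r *v (r *v x) = x" "r *v (matrix_inv r *v x) = x"
    by (simp_all add: matrix_vector_mul_assoc 1)
qed

lemma SO_group_inner: "r \<in> SO_group \<Longrightarrow> (matrix_inv r *v x) \<bullet> y = x \<bullet> (r *v y)"
  by (simp add: matrix_inv_SO dot_lmul_matrix flip: vector_transpose_matrix)

lemma SO_group_orthogonal: "r \<in> SO_group \<Longrightarrow> orthogonal_transformation ((*v) r)"
  by (simp add: SO_group_def rotation_matrix_def orthogonal_transformation_matrix)

abbreviation sim_inv :: "real \<Rightarrow> real ^ 'n ^ 'n \<Rightarrow> real ^ 'n \<Rightarrow> real ^ 'n \<Rightarrow> real ^ 'n" where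
  "sim_inv a r t x \<equiv> matrix_inv r *v ((x - t) /\<^sub>R a)"

text \<open>The map is the one inside \<open>sim_rep\<close>. With \<open>t = 0\<close> and \<open>1 / a\<close> in place of \<open>a\<close> it is also the
  action on frequencies, so every substitution below is an instance.\<close>

lemma distr_similitude_lborel:
  fixes r :: "real ^ 'n ^ 'n"
  assumes "0 < a" "r \<in> SO_group"
  shows "distr lborel borel (sim_inv a r t) =
    density lborel (\<lambda>_. ennreal (a ^ CARD('n)))"
proof -
  let ?M = "\<lambda>R :: real ^ 'n \<Rightarrow> real ^ 'n. distr (density (distr lborel borel (\<lambda>x. t + a *\<^sub>R x)) (\<lambda>_. ennreal (a^CARD('n)))) borel
    (\<lambda>x. R ((x - t) /\<^sub>R a))"
  let ?D = "density (lborel :: (real ^ 'n) measure) (\<lambda>_. ennreal (a ^ CARD('n)))"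
  have affine: "lborel = density (distr lborel borel (\<lambda>x. t + a *\<^sub>R x)) (\<lambda>_. \<bar>a\<bar>^DIM(real^'n))"
    using assms by (intro lborel_affine) auto
  define R :: "real ^ 'n \<Rightarrow> real ^ 'n" where "R = (*v) (matrix_inv r)"
  have oR: "orthogonal_transformation R"
    unfolding R_def using assms by (intro SO_group_orthogonal SO_group_inv)
  then have [measurable]: "R \<in> borel_measurable borel"
    by (intro borel_measurable_continuous_onI)
       (simp add: orthogonal_transformation_linear linear_continuous_on linear_linear)
  have "distr lborel borel (\<lambda>x. R ((x - t) /\<^sub>R a)) =
      ?M R"
    using affine assms by simp
  also have "\<dots> = ?D"
  proof (rule measure_eqI)
    fix B assume "B \<in> sets (?M R)"
    then have [measurable]: "B \<in> sets borel" by simp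
    have "emeasure (?M R) B
      = ennreal (a^CARD('n)) * (\<integral>\<^sup>+x. indicator B (R x) \<partial>lborel)"
      using assms
      by (simp add: nn_integral_distr nn_integral_density nn_integral_cmult flip: nn_integral_indicator)
    also have "(\<integral>\<^sup>+x. indicator B (R x) \<partial>lborel) = (\<integral>\<^sup>+x. indicator B x \<partial>distr lborel borel R)"
      by (subst nn_integral_distr) auto
    also have "\<dots> = emeasure lborel B"
      by (simp add: distr_orthogonal_lborel[OF oR])
    finally show "emeasure (?M R) B =
       emeasure (?D) B"
      by (simp add: emeasure_density nn_integral_cmult)
  qed simp
  finally show ?thesis by (simp add: R_def)
qed

lemma similitude_measurable[measurable]:
  fixes r :: "real ^ 'n ^ 'n"
  shows "(sim_inv a r t) \<in> borel_measurable borel"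
  by (intro borel_measurable_continuous_onI bounded_linear.continuous_on[OF matrix_vector_mul_bounded_linear] continuous_intros)

lemma nn_integral_similitude:
  fixes r :: "real ^ 'n ^ 'n"
  assumes "0 < a" "r \<in> SO_group" and [measurable]: "f \<in> borel_measurable borel"
  shows "(\<integral>\<^sup>+x. f (sim_inv a r t x) \<partial>lborel) = ennreal (a ^ CARD('n)) * (\<integral>\<^sup>+x. f x \<partial>lborel)"
proof -
  have "(\<integral>\<^sup>+x. f (sim_inv a r t x) \<partial>lborel) =
      (\<integral>\<^sup>+x. f x \<partial>distr lborel borel (sim_inv a r t))"
    by (simp add: nn_integral_distr)
  then show ?thesis by (simp add: distr_similitude_lborel assms nn_integral_density nn_integral_cmult)
qed

lemma integrable_similitude:
  fixes r :: "real ^ 'n ^ 'n" and f :: "_ \<Rightarrow> 'b :: {banach, second_countable_topology}"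
  assumes "0 < a" "r \<in> SO_group" "integrable lborel f"
  shows "integrable lborel (\<lambda>x. f (sim_inv a r t x))"
proof -
  have [measurable]: "f \<in> borel_measurable borel" using assms(3) by auto
  have "integrable (distr lborel borel (sim_inv a r t)) f"
    using assms by (simp add: distr_similitude_lborel integrable_density)
  then show ?thesis by (subst (asm) integrable_distr_eq) auto
qed

lemma integral_similitude:
  fixes r :: "real ^ 'n ^ 'n" and f :: "_ \<Rightarrow> 'b :: {banach, second_countable_topology}"
  assumes "0 < a" "r \<in> SO_group" and [measurable]: "f \<in> borel_measurable borel"
  shows "(LINT x|lborel. f (sim_inv a r t x)) = (a ^ CARD('n)) *\<^sub>R (LINT x|lborel. f x)"
proof -
  have "(LINT x|lborel. f (sim_inv a r t x)) =
      (LINT x|distr lborel borel (sim_inv a r t). f x)"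
    by (simp add: integral_distr)
  then show ?thesis
    by (simp add: distr_similitude_lborel assms) (subst integral_density, use assms in auto)
qed

section \<open>Square integrable functions\<close>

lemma L2_space_measurable[measurable_dest]: "f \<in> L2_space \<Longrightarrow> f \<in> borel_measurable borel"
  by (simp add: L2_space_def)

lemma L2_space_integrable: "f \<in> L2_space \<Longrightarrow> integrable lborel (\<lambda>x. (cmod (f x))\<^sup>2)"
  by (simp add: L2_space_def)

lemma L2_space_iff_nn:
  "f \<in> L2_space \<longleftrightarrow> f \<in> borel_measurable borel \<and> (\<integral>\<^sup>+x. ennreal ((cmod (f x))\<^sup>2) \<partial>lborel) < \<infinity>"
  by (auto simp: L2_space_def integrable_iff_bounded)

lemma L2_nn: "f \<in> L2_space \<Longrightarrow>
    (\<integral>\<^sup>+x. ennreal ((cmod (f x))\<^sup>2) \<partial>lborel) = ennreal (LINT x|lborel. (cmod (f x))\<^sup>2)"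
  by (rule nn_integral_eq_integral) (auto simp: L2_space_def)

lemma sq_norm_add_le: "(cmod (a + b))\<^sup>2 \<le> 2 * (cmod a)\<^sup>2 + 2 * (cmod b)\<^sup>2"
proof -
  have "(cmod (a + b))\<^sup>2 \<le> (cmod a + cmod b)\<^sup>2"
    by (intro power_mono norm_triangle_ineq) auto
  also have "\<dots> \<le> 2 * (cmod a)\<^sup>2 + 2 * (cmod b)\<^sup>2"
    using sum_squares_ge_zero[of "cmod a - cmod b" 0] by (simp add: power2_eq_square algebra_simps)
  finally show ?thesis .
qed

lemma prod_norm_le: "cmod (a * b) \<le> ((cmod a)\<^sup>2 + (cmod b)\<^sup>2) / 2"
  using sum_squares_ge_zero[of "cmod a - cmod b" 0] by (simp add: power2_eq_square algebra_simps norm_mult)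

lemma L2_space_add:
  assumes "f \<in> L2_space" "g \<in> L2_space" shows "(\<lambda>x. f x + g x) \<in> L2_space"
proof -
  have [measurable]: "f \<in> borel_measurable borel" "g \<in> borel_measurable borel"
    using assms by (auto simp: L2_space_def)
  have "integrable lborel (\<lambda>x. (cmod (f x + g x))\<^sup>2)"
    by (rule Bochner_Integration.integrable_bound[where f="\<lambda>x. 2 * (cmod (f x))\<^sup>2 + 2 * (cmod (g x))\<^sup>2"])
       (use assms sq_norm_add_le in \<open>auto simp: L2_space_def\<close>)
  then show ?thesis by (simp add: L2_space_def)
qed

lemma L2_space_cmult:
  assumes "f \<in> L2_space" shows "(\<lambda>x. c * f x) \<in> L2_space"
  using assms by (auto simp: L2_space_def norm_mult power_mult_distrib)

lemma L2_space_diff: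
  assumes "f \<in> L2_space" "g \<in> L2_space" shows "(\<lambda>x. f x - g x) \<in> L2_space"
  using L2_space_add[OF assms(1) L2_space_cmult[OF assms(2), of "-1"]] by simp

lemma borel_measurable_cnj[measurable]: "f \<in> borel_measurable M \<Longrightarrow> (\<lambda>x. cnj (f x)) \<in> borel_measurable M"
  by (rule measurable_compose[of f M borel]) (auto intro!: borel_measurable_continuous_onI continuous_intros)

lemma L2_space_cnj: "f \<in> L2_space \<Longrightarrow> (\<lambda>x. cnj (f x)) \<in> L2_space"
  by (auto simp: L2_space_def)

lemma L2_mult_integrable:
  assumes "f \<in> L2_space" "g \<in> L2_space" shows "integrable lborel (\<lambda>x. f x * g x)"
proof -
  have [measurable]: "f \<in> borel_measurable borel" "g \<in> borel_measurable borel"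
    using assms by (auto simp: L2_space_def)
  show ?thesis
    by (rule Bochner_Integration.integrable_bound[where f="\<lambda>x. ((cmod (f x))\<^sup>2 + (cmod (g x))\<^sup>2) / 2"])
       (use assms prod_norm_le in \<open>auto simp: L2_space_def\<close>)
qed

lemma L2_inner_integrable:
  "f \<in> L2_space \<Longrightarrow> g \<in> L2_space \<Longrightarrow> integrable lborel (\<lambda>x. f x * cnj (g x))"
  by (intro L2_mult_integrable L2_space_cnj)

lemma L2_inner_self: "L2_inner f f = complex_of_real (LINT x|lborel. (cmod (f x))\<^sup>2)"
  by (simp add: L2_inner_def complex_norm_square[symmetric] flip: integral_complex_of_real)

lemma L2_dist_sq_finite:
  "f \<in> L2_space \<Longrightarrow> g \<in> L2_space \<Longrightarrow> L2_dist_sq f g = ennreal (LINT x|lborel. (cmod (f x - g x))\<^sup>2)"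
  unfolding L2_dist_sq_def by (rule L2_nn) (rule L2_space_diff)

lemma L2_Cauchy_Schwarz:
  assumes "f \<in> L2_space" "g \<in> L2_space"
  shows "(cmod (L2_inner f g))\<^sup>2 \<le> (LINT x|lborel. (cmod (f x))\<^sup>2) * (LINT x|lborel. (cmod (g x))\<^sup>2)"
proof -
  have [measurable]: "f \<in> borel_measurable borel" "g \<in> borel_measurable borel"
    using assms by (auto simp: L2_space_def)
  have "ennreal (cmod (L2_inner f g)) \<le> (\<integral>\<^sup>+x. ennreal (cmod (f x)) * ennreal (cmod (g x)) \<partial>lborel)"
    unfolding L2_inner_def
    using integral_norm_bound_ennreal[OF L2_inner_integrable[OF assms]]
    by (simp add: norm_mult ennreal_mult)
  then have "(ennreal (cmod (L2_inner f g)))\<^sup>2 \<le> (\<integral>\<^sup>+x. ennreal (cmod (f x)) * ennreal (cmod (g x)) \<partial>lborel)\<^sup>2"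
    by (rule power_mono) simp
  also have "\<dots> \<le> (\<integral>\<^sup>+x. ennreal (cmod (f x))^2 \<partial>lborel) * (\<integral>\<^sup>+x. ennreal (cmod (g x))^2 \<partial>lborel)"
    by (rule Cauchy_Schwarz_nn_integral) auto
  also have "\<dots> = ennreal ((LINT x|lborel. (cmod (f x))\<^sup>2) * (LINT x|lborel. (cmod (g x))\<^sup>2))"
    by (simp add: ennreal_power L2_nn assms ennreal_mult integral_nonneg_AE)
  finally show ?thesis
    by (simp add: ennreal_power integral_nonneg_AE ennreal_le_iff)
qed

lemma L2_inner_cnj: "L2_inner g f = cnj (L2_inner f g)"
  proof -
  have "cnj (L2_inner f g) = (LINT x|lborel. cnj (f x * cnj (g x)))"
    unfolding L2_inner_def by (rule Bochner_Integration.integral_cnj[symmetric])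
  then show ?thesis by (simp add: L2_inner_def mult.commute)
qed

lemma L2_dist_sq_sym: "L2_dist_sq f g = L2_dist_sq g f"
  by (simp add: L2_dist_sq_def norm_minus_commute)

abbreviation L2_lim :: "(nat \<Rightarrow> real ^ 'n \<Rightarrow> complex) \<Rightarrow> (real ^ 'n \<Rightarrow> complex) \<Rightarrow> bool" where
  "L2_lim h f \<equiv> (\<lambda>k. L2_dist_sq (h k) f) \<longlonglongrightarrow> 0"

text \<open>Convergence in one slot is enough later on: identities between inner products are extended
  from a dense class by letting the two arguments converge one after the other.\<close>

lemma L2_inner_tendsto:
  assumes g: "\<And>k. g k \<in> L2_space" "f \<in> L2_space" "h \<in> L2_space"
    and lim: "L2_lim g f"
  shows "(\<lambda>k. L2_inner (g k) h) \<longlonglongrightarrow> L2_inner f h"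
proof -
  define d where "d k = (LINT x|lborel. (cmod (g k x - f x))\<^sup>2)" for k
  define H where "H = (LINT x|lborel. (cmod (h x))\<^sup>2)"
  have d0: "d \<longlonglongrightarrow> 0"
  proof -
    have nn: "0 \<le> d k" for k by (simp add: d_def integral_nonneg_AE)
    have "(\<lambda>k. ennreal (d k)) \<longlonglongrightarrow> ennreal 0"
      using lim unfolding d_def by (simp add: L2_dist_sq_finite g)
    then show ?thesis by (subst (asm) tendsto_ennreal_iff) (auto simp: nn)
  qed
  have lim0: "(\<lambda>k. sqrt (d k * H)) \<longlonglongrightarrow> 0"
    using tendsto_real_sqrt[OF tendsto_mult_right[OF d0, of H]] by simp
  have le: "dist (L2_inner (g k) h) (L2_inner f h) \<le> sqrt (d k * H)" for k
  proof -
    have "L2_inner (g k) h - L2_inner f h = L2_inner (\<lambda>x. g k x - f x) h"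
      unfolding L2_inner_def
      by (subst Bochner_Integration.integral_diff[symmetric])
         (simp_all only: left_diff_distrib L2_inner_integrable g)
    then show ?thesis
      using L2_Cauchy_Schwarz[OF L2_space_diff[OF g(1)[of k] g(2)] g(3)]
      by (simp add: dist_norm d_def H_def real_le_rsqrt)
  qed
  show ?thesis
    by (subst tendsto_dist_iff, rule tendsto_sandwich[OF _ _ tendsto_const lim0]) (auto simp: le)
qed

section \<open>The Fourier integral\<close>

lemma fourier_L1_cis: "fourier_L1 f \<xi> = (LINT x|lborel. f x * cis (- (2 * pi * (x \<bullet> \<xi>))))"
  by (simp add: fourier_L1_def cis_conv_exp mult_ac)

lemma cis_measurable[measurable]: "f \<in> borel_measurable M \<Longrightarrow> (\<lambda>x. cis (f x)) \<in> borel_measurable M"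
  by (rule measurable_compose[of f M borel]) (auto intro!: borel_measurable_continuous_onI continuous_intros)

lemma integrable_cis_mult:
  assumes "integrable M f" "g \<in> borel_measurable M"
  shows "integrable M (\<lambda>x. f x * cis (g x))"
  using Bochner_Integration.integrable_bound[OF assms(1), of "\<lambda>x. f x * cis (g x)"] assms
  by (auto simp: norm_mult)

lemma fourier_L1_measurable[measurable]:
  fixes f :: "real ^ 'n \<Rightarrow> complex"
  assumes [measurable]: "f \<in> borel_measurable borel"
  shows "fourier_L1 f \<in> borel_measurable borel"
  unfolding fourier_L1_cis[abs_def] by measurable

lemma integrable_pair_mult:
  fixes f g :: "_ \<Rightarrow> complex"
  assumes f: "integrable lborel f" and g: "integrable lborel g"
    and [measurable]: "h \<in> borel_measurable (lborel \<Otimes>\<^sub>M lborel)"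
    and h: "\<And>z. cmod (h z) \<le> 1"
  shows "integrable (lborel \<Otimes>\<^sub>M lborel) (\<lambda>(x, y). f x * g y * h (x, y))"
proof (rule lborel_pair.Fubini_integrable)
  have [measurable]: "f \<in> borel_measurable borel" "g \<in> borel_measurable borel"
    using f g by auto
  show "(\<lambda>(x, y). f x * g y * h (x, y)) \<in> borel_measurable (lborel \<Otimes>\<^sub>M lborel)"
    by measurable
  have *: "integrable lborel (\<lambda>y. f x * g y * h (x, y))" for x
    by (rule Bochner_Integration.integrable_bound[where f="\<lambda>y. f x * g y"])
      (use g h in \<open>auto simp: norm_mult mult_left_le\<close>)
  then show "AE x in lborel. integrable lborel (\<lambda>y. case (x, y) of (x, y) \<Rightarrow> f x * g y * h (x, y))"
    by simp
  show "integrable lborel (\<lambda>x. LINT y|lborel. norm (case (x, y) of (x, y) \<Rightarrow> f x * g y * h (x, y)))"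
  proof (rule Bochner_Integration.integrable_bound[where f="\<lambda>x. norm (f x) * (LINT y|lborel. norm (g y))"])
    show "AE x in lborel. norm (LINT y|lborel. norm (case (x, y) of (x, y) \<Rightarrow> f x * g y * h (x, y)))
       \<le> norm (norm (f x) * (LINT y|lborel. norm (g y)))"
    proof (rule AE_I2)
      fix x
      have "(LINT y|lborel. norm (f x * g y * h (x, y))) \<le> (LINT y|lborel. norm (f x) * norm (g y))"
        using integrable_norm[OF *] g h by (intro integral_mono) (auto simp: norm_mult mult_left_le)
      then show "norm (LINT y|lborel. norm (case (x, y) of (x, y) \<Rightarrow> f x * g y * h (x, y)))
         \<le> norm (norm (f x) * (LINT y|lborel. norm (g y)))"
        by (simp add: integral_nonneg_AE abs_mult)
    qed
  qed (use f g in auto)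
qed

text \<open>Both sides are the double integral of \<open>f(x) g(y) e\<^bsup>-2\<pi>i x\<cdot>y\<^esup>\<close>. This transposition rule serves
  twice: for Gaussian summation and for inversion.\<close>

lemma fourier_mult_formula:
  fixes f g :: "real ^ 'n \<Rightarrow> complex"
  assumes f: "integrable lborel f" and g: "integrable lborel g"
  shows "(LINT x|lborel. fourier_L1 f x * g x) = (LINT x|lborel. f x * fourier_L1 g x)"
proof -
  have int: "integrable (lborel \<Otimes>\<^sub>M lborel) (\<lambda>(x, y). f x * g y * cis (- (2 * pi * (x \<bullet> y))))"
    using integrable_pair_mult[OF f g, of "\<lambda>z. cis (- (2 * pi * (fst z \<bullet> snd z)))"] by simp
  have "(LINT y|lborel. fourier_L1 f y * g y) =
    (LINT y|lborel. LINT x|lborel. f x * g y * cis (- (2 * pi * (x \<bullet> y))))"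
    by (simp add: fourier_L1_cis mult_ac flip: integral_mult_left_zero integral_mult_right_zero)
  also have "\<dots> = (LINT x|lborel. LINT y|lborel. f x * g y * cis (- (2 * pi * (x \<bullet> y))))"
    by (rule lborel_pair.Fubini_integral[OF int])
  also have "\<dots> = (LINT x|lborel. f x * fourier_L1 g x)"
    by (simp add: fourier_L1_cis mult_ac inner_commute flip: integral_mult_left_zero integral_mult_right_zero)
  finally show ?thesis .
qed

section \<open>Gaussians\<close>

text \<open>The standard normal density, written as a product so that its transform reduces to the
  characteristic function of the one-dimensional normal distribution.\<close>

definition gauss :: "'a::euclidean_space \<Rightarrow> real" where
  "gauss z = (\<Prod>b\<in>Basis. std_normal_density (z \<bullet> b))"

lemma gauss_eq: "gauss (z::'a::euclidean_space) = (1 / sqrt (2 * pi)) ^ DIM('a) * exp (- (norm z)\<^sup>2 / 2)"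
proof -
  have "gauss z = (\<Prod>b\<in>(Basis::'a set). 1 / sqrt (2 * pi)) * (\<Prod>b\<in>Basis. exp (- (z \<bullet> b)\<^sup>2 / 2))"
    unfolding gauss_def prod.distrib[symmetric] by (simp add: std_normal_density_def)
  also have "(\<Prod>b\<in>(Basis::'a set). exp (- (z \<bullet> b)\<^sup>2 / 2)) = exp (- (norm z)\<^sup>2 / 2)"
    unfolding exp_sum[OF finite_Basis, symmetric] power2_norm_eq_inner euclidean_inner[of z z]
    by (simp add: power2_eq_square sum_negf sum_divide_distrib)
  finally show ?thesis by simp
qed

lemma gauss_nonneg: "0 \<le> gauss z"
  by (simp add: gauss_eq)

lemma gauss_measurable[measurable]: "gauss \<in> borel_measurable borel"
  unfolding gauss_def[abs_def] by measurable

lemma cis_sum: "finite I \<Longrightarrow> cis (\<Sum>i\<in>I. f i) = (\<Prod>i\<in>I. cis (f i))"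
  by (induction rule: finite_induct) (auto simp: cis_mult[symmetric])

lemma std_normal_cis:
  "integrable lborel (\<lambda>x. complex_of_real (std_normal_density x) * cis (t * x))"
  "(LINT x|lborel. complex_of_real (std_normal_density x) * cis (t * x)) = complex_of_real (exp (- t\<^sup>2 / 2))"
proof -
  have i: "integrable lborel (\<lambda>x. complex_of_real (std_normal_density x))"
    by (simp add: integrable_normal_density)
  show "integrable lborel (\<lambda>x. complex_of_real (std_normal_density x) * cis (t * x))"
    by (rule integrable_cis_mult[OF i]) simp
  have "complex_of_real (exp (- t\<^sup>2 / 2)) = char std_normal_distribution t"
    by (simp add: char_std_normal_distribution)
  also have "\<dots> = (LINT x|lborel. complex_of_real (std_normal_density x) * cis (t * x))"
    unfolding char_def by (subst integral_density) (auto simp: cis_conv_exp scaleR_conv_of_real)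
  finally show "(LINT x|lborel. complex_of_real (std_normal_density x) * cis (t * x)) = complex_of_real (exp (- t\<^sup>2 / 2))" ..
qed

lemma gauss_cis:
  fixes y :: "'a::euclidean_space"
  shows "integrable lborel (\<lambda>z. complex_of_real (gauss z) * cis (z \<bullet> y))" (is ?I)
    and "(LINT z|lborel. complex_of_real (gauss z) * cis (z \<bullet> y)) = complex_of_real (exp (- (norm y)\<^sup>2 / 2))" (is ?E)
proof -
  interpret product_sigma_finite "\<lambda>_::'a. lborel::real measure" ..
  define \<phi> where "\<phi> b x = complex_of_real (std_normal_density x) * cis ((y \<bullet> b) * x)" for b :: 'a and x
  let ?P = "\<Pi>\<^sub>M b\<in>(Basis::'a set). (lborel::real measure)"
  let ?T = "\<lambda>f. \<Sum>b\<in>(Basis::'a set). f b *\<^sub>R b"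
  let ?g = "\<lambda>z. complex_of_real (gauss z) * cis (z \<bullet> y)"
  have eq: "?g (?T f) = (\<Prod>b\<in>Basis. \<phi> b (f b))" for f
  proof -
    have "?g (?T f) = (\<Prod>b\<in>Basis. complex_of_real (std_normal_density (f b))) * cis (\<Sum>b\<in>Basis. (y \<bullet> b) * f b)"
      by (simp add: gauss_def euclidean_inner[of _ y] mult.commute)
    then show ?thesis
      by (simp add: \<phi>_def cis_sum prod.distrib)
  qed
  have T[measurable]: "?T \<in> ?P \<rightarrow>\<^sub>M borel" by measurable
  have "integrable ?P (\<lambda>f. \<Prod>b\<in>Basis. \<phi> b (f b))"
    by (rule product_integrable_prod) (auto simp: \<phi>_def std_normal_cis)
  then show ?I
    unfolding lborel_eq[where 'a='a] by (subst integrable_distr_eq[OF T]) (auto simp only: eq, measurable)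
  have "(LINT z|lborel. ?g z) = (LINT f|?P. (\<Prod>b\<in>Basis. \<phi> b (f b)))"
    unfolding lborel_eq[where 'a='a] by (subst integral_distr[OF T]) (auto simp only: eq, measurable)
  also have "\<dots> = (\<Prod>b\<in>Basis. LINT x|lborel. \<phi> b x)"
    by (rule product_integral_prod) (auto simp: \<phi>_def std_normal_cis)
  also have "\<dots> = (\<Prod>b\<in>Basis. complex_of_real (exp (- (y \<bullet> b)\<^sup>2 / 2)))"
    by (simp add: \<phi>_def std_normal_cis)
  also have "\<dots> = complex_of_real (exp (- (norm y)\<^sup>2 / 2))"
    unfolding of_real_prod[symmetric] exp_sum[OF finite_Basis, symmetric] power2_norm_eq_inner euclidean_inner[of y y]
    by (simp add: power2_eq_square sum_negf sum_divide_distrib)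
  finally show ?E .
qed

lemma gauss_integrable: "integrable lborel (gauss :: 'a::euclidean_space \<Rightarrow> real)"
  and gauss_integral: "(LINT z|lborel. gauss (z::'a)) = 1"
proof -
  have i: "integrable lborel (\<lambda>z. complex_of_real (gauss (z::'a)))"
    using gauss_cis(1)[of 0] by simp
  then show "integrable lborel (gauss :: 'a::euclidean_space \<Rightarrow> real)"
    using integrable_norm[OF i] by (simp only: norm_of_real abs_of_nonneg[OF gauss_nonneg])
  show "(LINT z|lborel. gauss (z::'a)) = 1"
    using gauss_cis(2)[of "0::'a"] by simp
qed

lemma SO_group_one: "mat 1 \<in> SO_group"
  by (simp add: SO_group_def rotation_matrix_def orthogonal_matrix_id)

lemma matrix_inv_one: "matrix_inv (mat 1 :: real^'n^'n) = mat 1"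
  by (simp add: matrix_inv_SO[OF SO_group_one])

lemma integral_scale:
  fixes f :: "real ^ 'n \<Rightarrow> 'b :: {banach, second_countable_topology}"
  assumes "0 < a" "f \<in> borel_measurable borel"
  shows "(LINT x|lborel. f (x /\<^sub>R a)) = (a ^ CARD('n)) *\<^sub>R (LINT x|lborel. f x)"
  using integral_similitude[OF assms(1) SO_group_one assms(2), of 0] by (simp add: matrix_inv_one)

lemma integrable_scale:
  fixes f :: "real ^ 'n \<Rightarrow> 'b :: {banach, second_countable_topology}"
  assumes "0 < a" "integrable lborel f"
  shows "integrable lborel (\<lambda>x. f (x /\<^sub>R a))"
  using integrable_similitude[OF assms(1) SO_group_one assms(2), of 0] by (simp add: matrix_inv_one)

text \<open>A summation weight that tends to 1 as \<open>s\<close> tends to 0, while its transform concentrates at the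
  origin.\<close>

definition gauss_weight :: "real \<Rightarrow> real ^ 'n \<Rightarrow> real" where
  "gauss_weight s \<xi> = exp (- (norm (s *\<^sub>R \<xi>))\<^sup>2 / 2)"

lemma gauss_weight_gauss:
  "gauss_weight s (\<xi> :: real ^ 'n) = sqrt (2 * pi) ^ CARD('n) * gauss (s *\<^sub>R \<xi>)"
  by (simp add: gauss_weight_def gauss_eq power_divide)

lemma gauss_weight_integrable:
  assumes "0 < s"
  shows "integrable lborel (gauss_weight s :: real ^ 'n \<Rightarrow> real)"
  using integrable_scale[of "1/s" "gauss :: real ^ 'n \<Rightarrow> real"] assms gauss_integrable[where 'a="real^'n"]
  by (simp add: gauss_weight_gauss[abs_def])

lemma fourier_gauss_weight:
  fixes u :: "real ^ 'n"
  assumes "0 < s"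
  shows "fourier_L1 (\<lambda>\<xi>. complex_of_real (gauss_weight s \<xi>)) u
     = complex_of_real ((2 * pi / s) ^ CARD('n) * gauss ((2 * pi / s) *\<^sub>R u))"
proof -
  let ?c = "sqrt (2 * pi) ^ CARD('n)"
  let ?f = "\<lambda>z. complex_of_real (?c * gauss z) * cis (z \<bullet> (- (2 * pi / s) *\<^sub>R u))"
  have "fourier_L1 (\<lambda>\<xi>. complex_of_real (gauss_weight s \<xi>)) u = (LINT \<xi>|lborel. ?f (\<xi> /\<^sub>R (1 / s)))"
    unfolding fourier_L1_cis
  proof (rule Bochner_Integration.integral_cong[OF refl])
    fix x :: "real ^ 'n"
    have 1: "x /\<^sub>R (1 / s) = s *\<^sub>R x" by simp
    have 2: "(s *\<^sub>R x) \<bullet> (- (2 * pi / s) *\<^sub>R u) = - (2 * pi * (x \<bullet> u))" using assms by simp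
    show "complex_of_real (gauss_weight s x) * cis (- (2 * pi * (x \<bullet> u))) = ?f (x /\<^sub>R (1 / s))"
      unfolding 1 2 gauss_weight_gauss ..
  qed
  also have "\<dots> = (1/s) ^ CARD('n) *\<^sub>R (LINT z|lborel. ?f z)"
    by (rule integral_scale) (use assms in auto)
  also have "(LINT z|lborel. ?f z) = complex_of_real (?c * exp (- (norm (- (2 * pi / s) *\<^sub>R u))\<^sup>2 / 2))"
    unfolding of_real_mult mult.assoc integral_mult_right_zero gauss_cis(2) ..
  also have "?c * exp (- (norm (- (2 * pi / s) *\<^sub>R u))\<^sup>2 / 2) = ?c * ?c * gauss ((2 * pi / s) *\<^sub>R u)"
    by (simp add: gauss_eq power_divide)
  also have "?c * ?c = (2 * pi) ^ CARD('n)"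
    unfolding power_mult_distrib[symmetric] by simp
  also have "(1 / s) ^ CARD('n) *\<^sub>R complex_of_real ((2 * pi) ^ CARD('n) * gauss ((2 * pi / s) *\<^sub>R u)) =
      complex_of_real ((2 * pi / s) ^ CARD('n) * gauss ((2 * pi / s) *\<^sub>R u))"
    by (simp only: scaleR_conv_of_real of_real_mult[symmetric] mult.assoc[symmetric] power_mult_distrib[symmetric]) simp
  finally show ?thesis .
qed

section \<open>Autocorrelation\<close>

lemma distr_reflect_lborel: "distr lborel borel (\<lambda>u. x - u) = (lborel :: 'a::euclidean_space measure)"
  using lborel_affine[of "-1" x] by (simp add: density_1)

lemma integral_measure_preserving:
  fixes f :: "'a::euclidean_space \<Rightarrow> 'b :: {banach, second_countable_topology}"
  assumes [measurable]: "T \<in> borel_measurable borel" and T: "distr lborel borel T = (lborel :: 'a measure)"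
  shows "f \<in> borel_measurable borel \<Longrightarrow> (LINT x|lborel. f (T x)) = (LINT x|lborel. f x)"
    and "integrable lborel f \<Longrightarrow> integrable lborel (\<lambda>x. f (T x))"
  using integral_distr[of T lborel borel f] integrable_distr[of T lborel borel f] by (simp_all add: T)

lemma
  fixes f :: "'a::euclidean_space \<Rightarrow> 'b :: {banach, second_countable_topology}"
  shows integral_reflect: "f \<in> borel_measurable borel \<Longrightarrow> (LINT u|lborel. f (x - u)) = (LINT u|lborel. f u)"
    and integrable_reflect: "integrable lborel f \<Longrightarrow> integrable lborel (\<lambda>u. f (x - u))"
  by (rule integral_measure_preserving[OF _ distr_reflect_lborel]; simp)+

lemma
  fixes f :: "'a::euclidean_space \<Rightarrow> 'b :: {banach, second_countable_topology}"
  shows integral_translate: "f \<in> borel_measurable borel \<Longrightarrow> (LINT x|lborel. f (x - u)) = (LINT x|lborel. f x)"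
    and integrable_translate: "integrable lborel f \<Longrightarrow> integrable lborel (\<lambda>x. f (x - u))"
  using integral_measure_preserving[of "(+) (- u)" f] by (simp_all add: lborel_distr_plus)

text \<open>The convolution of \<open>g\<close> with its conjugate reflection. Plancherel's theorem for \<open>g\<close> is Fourier
  inversion for this function at the single point 0.\<close>

definition autocorr :: "(real ^ 'n \<Rightarrow> complex) \<Rightarrow> real ^ 'n \<Rightarrow> complex" where
  "autocorr g u = (LINT x|lborel. g x * cnj (g (x - u)))"

lemma autocorr_zero: "autocorr g 0 = L2_inner g g"
  by (simp add: autocorr_def L2_inner_def)

lemma L2_space_translate: "g \<in> L2_space \<Longrightarrow> (\<lambda>x. g (x - u)) \<in> L2_space"
  using integrable_translate[of "\<lambda>x. (cmod (g x))\<^sup>2" u] by (auto simp: L2_space_def)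

lemma autocorr_bound:
  assumes "g \<in> L2_space"
  shows "cmod (autocorr g u) \<le> (LINT x|lborel. (cmod (g x))\<^sup>2)"
proof -
  have [measurable]: "g \<in> borel_measurable borel" using assms by auto
  have "(cmod (L2_inner g (\<lambda>x. g (x - u))))\<^sup>2 \<le>
     (LINT x|lborel. (cmod (g x))\<^sup>2) * (LINT x|lborel. (cmod (g (x - u)))\<^sup>2)"
    by (intro L2_Cauchy_Schwarz L2_space_translate assms)
  also have "(LINT x|lborel. (cmod (g (x - u)))\<^sup>2) = (LINT x|lborel. (cmod (g x))\<^sup>2)"
    by (rule integral_translate) measurable
  finally show ?thesis
    unfolding L2_inner_def autocorr_def power2_eq_square[of "LINT x|lborel. (cmod (g x))\<^sup>2", symmetric]
    by (rule power2_le_imp_le) (simp add: integral_nonneg_AE)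
qed

text \<open>Fubini's theorem and the substitution \<open>v = x - u\<close> split the double integral into the transform of
  \<open>g\<close> times its conjugate.\<close>

lemma autocorr_fourier:
  fixes g :: "real ^ 'n \<Rightarrow> complex"
  assumes g: "integrable lborel g"
  shows "integrable lborel (autocorr g)"
    and "fourier_L1 (autocorr g) \<xi> = complex_of_real ((cmod (fourier_L1 g \<xi>))\<^sup>2)"
proof -
  have [measurable]: "g \<in> borel_measurable borel" using g by auto
  have int: "integrable (lborel \<Otimes>\<^sub>M lborel) (\<lambda>(x, u). g x * cnj (g (x - u)))"
  proof (rule lborel_pair.Fubini_integrable)
    show "AE x in lborel. integrable lborel (\<lambda>u. case (x, u) of (x, u) \<Rightarrow> g x * cnj (g (x - u)))"
      by (simp add: integrable_reflect g)
    have "(LINT u|lborel. cmod (g x * cnj (g (x - u)))) = cmod (g x) * (LINT u|lborel. cmod (g u))" for x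
      using integral_reflect[of "\<lambda>v. cmod (g v)" x] by (simp add: norm_mult)
    then show "integrable lborel (\<lambda>x. LINT u|lborel. norm (case (x, u) of (x, u) \<Rightarrow> g x * cnj (g (x - u))))"
      using g by simp
  qed measurable
  show "integrable lborel (autocorr g)"
    unfolding autocorr_def[abs_def] by (rule lborel_pair.integrable_snd[OF int])
  have int2: "integrable (lborel \<Otimes>\<^sub>M lborel) (\<lambda>(x, u). g x * cnj (g (x - u)) * cis (- (2 * pi * (u \<bullet> \<xi>))))"
    using integrable_cis_mult[OF int, of "\<lambda>z. - (2 * pi * (snd z \<bullet> \<xi>))"] by (simp add: case_prod_unfold)
  have "fourier_L1 (autocorr g) \<xi> = (LINT u|lborel. LINT x|lborel. g x * cnj (g (x - u)) * cis (- (2 * pi * (u \<bullet> \<xi>))))"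
    by (simp add: fourier_L1_cis autocorr_def)
  also have "\<dots> = (LINT x|lborel. LINT u|lborel. g x * cnj (g (x - u)) * cis (- (2 * pi * (u \<bullet> \<xi>))))"
    by (rule lborel_pair.Fubini_integral[OF int2])
  also have "\<dots> = (LINT x|lborel. g x * cis (- (2 * pi * (x \<bullet> \<xi>))) * cnj (fourier_L1 g \<xi>))"
  proof (rule Bochner_Integration.integral_cong[OF refl])
    fix x
    let ?h = "\<lambda>v. g x * cnj (g v) * cis (- (2 * pi * ((x - v) \<bullet> \<xi>)))"
    have "(LINT u|lborel. g x * cnj (g (x - u)) * cis (- (2 * pi * (u \<bullet> \<xi>)))) = (LINT u|lborel. ?h (x - u))"
      by simp
    also have "\<dots> = (LINT v|lborel. ?h v)"
      by (rule integral_reflect) measurable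
    also have "\<dots> = (LINT v|lborel. (g x * cis (- (2 * pi * (x \<bullet> \<xi>)))) * cnj (g v * cis (- (2 * pi * (v \<bullet> \<xi>)))))"
      by (simp add: cis_cnj cis_mult inner_diff_left right_diff_distrib mult_ac)
    also have "\<dots> = g x * cis (- (2 * pi * (x \<bullet> \<xi>))) * cnj (fourier_L1 g \<xi>)"
      unfolding fourier_L1_cis Bochner_Integration.integral_cnj[symmetric] by (rule integral_mult_right_zero)
    finally show "(LINT u|lborel. g x * cnj (g (x - u)) * cis (- (2 * pi * (u \<bullet> \<xi>)))) =
        g x * cis (- (2 * pi * (x \<bullet> \<xi>))) * cnj (fourier_L1 g \<xi>)" .
  qed
  also have "\<dots> = fourier_L1 g \<xi> * cnj (fourier_L1 g \<xi>)"
    unfolding fourier_L1_cis by (rule integral_mult_left_zero)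
  finally show "fourier_L1 (autocorr g) \<xi> = complex_of_real ((cmod (fourier_L1 g \<xi>))\<^sup>2)"
    by (simp only: complex_norm_square)
qed

text \<open>The transposition rule moves the transform from the autocorrelation to the weight, where it is a
  Gaussian of total mass 1 and width proportional to \<open>s\<close>. As \<open>s\<close> tends to 0 the left side tends to
  the energy of the transform and the right side to the autocorrelation at 0.\<close>

lemma gauss_energy:
  fixes g :: "real ^ 'n \<Rightarrow> complex"
  assumes g: "integrable lborel g" and s: "0 < s"
  shows "complex_of_real (LINT \<xi>|lborel. (cmod (fourier_L1 g \<xi>))\<^sup>2 * gauss_weight s \<xi>) =
    (LINT z|lborel. autocorr g ((s / (2 * pi)) *\<^sub>R z) * complex_of_real (gauss z))"
proof -
  let ?w = "\<lambda>\<xi>. complex_of_real (gauss_weight s \<xi>)"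
  let ?b = "2 * pi / s"
  have A: "integrable lborel (autocorr g)" by (rule autocorr_fourier(1)[OF g])
  have [measurable]: "autocorr g \<in> borel_measurable borel" using A by auto
  have "complex_of_real (LINT \<xi>|lborel. (cmod (fourier_L1 g \<xi>))\<^sup>2 * gauss_weight s \<xi>) =
     (LINT \<xi>|lborel. fourier_L1 (autocorr g) \<xi> * ?w \<xi>)"
    unfolding autocorr_fourier(2)[OF g] of_real_mult[symmetric] by (rule integral_complex_of_real[symmetric])
  also have "\<dots> = (LINT u|lborel. autocorr g u * fourier_L1 ?w u)"
    by (rule fourier_mult_formula[OF A]) (simp add: gauss_weight_integrable[OF s] integrable_of_real)
  also have "\<dots> = ?b ^ CARD('n) *\<^sub>R (LINT u|lborel. autocorr g u * complex_of_real (gauss (?b *\<^sub>R u)))"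
    unfolding fourier_gauss_weight[OF s]
    by (subst integral_scaleR_right[symmetric]) (simp add: scaleR_conv_of_real mult_ac)
  also have "\<dots> = (LINT z|lborel. autocorr g (z /\<^sub>R ?b) * complex_of_real (gauss (?b *\<^sub>R (z /\<^sub>R ?b))))"
    by (rule integral_scale[symmetric, of ?b "\<lambda>u. autocorr g u * complex_of_real (gauss (?b *\<^sub>R u))"]) (use s in auto)
  also have "\<dots> = (LINT z|lborel. autocorr g ((s / (2 * pi)) *\<^sub>R z) * complex_of_real (gauss z))"
    using s by (simp add: field_simps)
  finally show ?thesis .
qed

section \<open>Plancherel's theorem\<close>

lemma gauss_weight_tendsto: "(\<lambda>k. gauss_weight (1 / real (Suc k)) \<xi>) \<longlonglongrightarrow> 1"
proof -
  have "(\<lambda>k. gauss_weight (1 / real (Suc k)) \<xi>) \<longlonglongrightarrow> gauss_weight 0 \<xi>"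
    unfolding gauss_weight_def
    by (intro tendsto_intros LIMSEQ_Suc[OF lim_1_over_n]) simp
  then show ?thesis by (simp add: gauss_weight_def)
qed

lemma gauss_weight_bounds: "0 \<le> gauss_weight s \<xi>" "gauss_weight s \<xi> \<le> 1"
  by (auto simp: gauss_weight_def)

lemma gauss_weight_measurable[measurable]: "gauss_weight s \<in> borel_measurable borel"
  unfolding gauss_weight_def[abs_def] by measurable

lemma fourier_L1_bound: "cmod (fourier_L1 f \<xi>) \<le> (LINT x|lborel. cmod (f x))"
  unfolding fourier_L1_cis
  by (rule order_trans[OF integral_norm_bound]) (simp add: norm_mult)

text \<open>The autocorrelation never exceeds the energy of \<open>g\<close>, by Cauchy--Schwarz, so neither do its
  Gaussian averages; Fatou's lemma removes the weight. No regularity of \<open>g\<close> is involved, which makes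
  this inequality the tool for passing to limits of transforms.\<close>

lemma fourier_L1_contraction:
  fixes g :: "real ^ 'n \<Rightarrow> complex"
  assumes g: "integrable lborel g" and g2: "g \<in> L2_space"
  shows "(\<integral>\<^sup>+\<xi>. ennreal ((cmod (fourier_L1 g \<xi>))\<^sup>2) \<partial>lborel) \<le> ennreal (LINT x|lborel. (cmod (g x))\<^sup>2)"
proof -
  let ?e = "\<lambda>\<xi>. (cmod (fourier_L1 g \<xi>))\<^sup>2"
  let ?A = "\<lambda>s z. autocorr g ((s / (2 * pi)) *\<^sub>R z) * complex_of_real (gauss z)"
  define N where "N = (LINT x|lborel. (cmod (g x))\<^sup>2)"
  define w :: "nat \<Rightarrow> real ^ 'n \<Rightarrow> real" where "w k = gauss_weight (1 / real (Suc k))" for k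
  let ?I = "\<lambda>k. LINT \<xi>|lborel. ?e \<xi> * w k \<xi>"
  have [measurable]: "g \<in> borel_measurable borel" using g by auto
  have [measurable]: "autocorr g \<in> borel_measurable borel" using autocorr_fourier(1)[OF g] by auto
  have [measurable]: "w k \<in> borel_measurable borel" for k by (simp add: w_def)
  have le: "(\<integral>\<^sup>+\<xi>. ennreal (?e \<xi> * w k \<xi>) \<partial>lborel) \<le> ennreal N" for k
  proof -
    let ?s = "1 / real (Suc k)"
    have int: "integrable lborel (\<lambda>\<xi>. ?e \<xi> * w k \<xi>)"
    proof (rule Bochner_Integration.integrable_bound[where f="\<lambda>\<xi>. (LINT x|lborel. cmod (g x))\<^sup>2 * w k \<xi>"])
      show "integrable lborel (\<lambda>\<xi>. (LINT x|lborel. cmod (g x))\<^sup>2 * w k \<xi>)"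
        unfolding w_def by (intro integrable_mult_right gauss_weight_integrable) simp
    qed (auto simp: w_def gauss_weight_bounds abs_mult intro!: mult_right_mono power_mono fourier_L1_bound)
    have "(\<integral>\<^sup>+\<xi>. ennreal (?e \<xi> * w k \<xi>) \<partial>lborel) =
       ennreal (?I k)"
      by (rule nn_integral_eq_integral[OF int]) (simp add: w_def gauss_weight_bounds)
    also have "(?I k) \<le>
      cmod (complex_of_real (?I k))"
      by simp
    also have "\<dots> = cmod (LINT z|lborel. ?A ?s z)"
      unfolding w_def by (subst gauss_energy[OF g]) auto
    also have "\<dots> \<le> (LINT z|lborel. cmod (?A ?s z))"
      by (rule integral_norm_bound)
    also have "\<dots> \<le> (LINT z|lborel. N * gauss (z :: real ^ 'n))"
    proof (rule integral_mono')
      show "integrable lborel (\<lambda>z. N * gauss (z :: real ^ 'n))"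
        by (intro integrable_mult_right gauss_integrable)
      show "cmod (?A ?s z) \<le> N * gauss z" for z
        using autocorr_bound[OF g2] by (auto simp: norm_mult gauss_nonneg N_def intro!: mult_right_mono)
      show "0 \<le> N * gauss z" for z :: "real ^ 'n"
        by (simp add: gauss_nonneg N_def integral_nonneg_AE)
    qed
    also have "\<dots> = N" by (simp add: gauss_integral)
    finally show ?thesis by (simp add: ennreal_leI)
  qed
  have lim: "(\<lambda>k. ennreal (?e \<xi> * w k \<xi>)) \<longlonglongrightarrow> ennreal (?e \<xi>)" for \<xi>
    using tendsto_mult_left[OF gauss_weight_tendsto[of \<xi>], of "?e \<xi>"] by (simp add: w_def)
  have "(\<integral>\<^sup>+\<xi>. ennreal (?e \<xi>) \<partial>lborel) =
     (\<integral>\<^sup>+\<xi>. liminf (\<lambda>k. ennreal (?e \<xi> * w k \<xi>)) \<partial>lborel)"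
    by (intro nn_integral_cong) (simp add: lim_imp_Liminf[OF _ lim])
  also have "\<dots> \<le> liminf (\<lambda>k. \<integral>\<^sup>+\<xi>. ennreal (?e \<xi> * w k \<xi>) \<partial>lborel)"
    by (rule nn_integral_liminf) measurable
  also have "\<dots> \<le> ennreal N"
    by (rule Liminf_le) (simp_all add: le)
  finally show ?thesis by (simp add: N_def)
qed

lemma fourier_L1_L2:
  assumes g: "integrable lborel g" and g2: "g \<in> L2_space"
  shows "fourier_L1 g \<in> L2_space"
proof -
  have [measurable]: "g \<in> borel_measurable borel" using g by auto
  show ?thesis
    using fourier_L1_contraction[OF assms]
    by (auto simp: L2_space_iff_nn intro: le_less_trans)
qed

text \<open>A class that is dense in \<open>L\<^sup>2\<close> and on which continuity of translations is a matter of dominated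
  convergence.\<close>

definition bounded_support :: "(real ^ 'n \<Rightarrow> complex) \<Rightarrow> bool" where
  "bounded_support g \<longleftrightarrow> g \<in> borel_measurable borel \<and>
     (\<exists>M R. \<forall>x. cmod (g x) \<le> M \<and> (R < norm x \<longrightarrow> g x = 0))"

lemma bounded_support_integrable:
  fixes g :: "real ^ 'n \<Rightarrow> complex"
  assumes "bounded_support g"
  shows "integrable lborel g" and "g \<in> L2_space"
proof -
  from assms obtain M R where [measurable]: "g \<in> borel_measurable borel"
    and M: "\<And>x. cmod (g x) \<le> M" and R: "\<And>x. R < norm x \<Longrightarrow> g x = 0"
    by (auto simp: bounded_support_def)
  have M0: "0 \<le> M" using M[of 0] norm_ge_zero order_trans by blast
  have fin: "integrable lborel (indicator (cball 0 R) :: real ^ 'n \<Rightarrow> real)"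
    using emeasure_lborel_cball_finite[of "0::real^'n" R] by (intro integrable_real_indicator) (auto simp: less_top)
  show "integrable lborel g"
  proof (rule Bochner_Integration.integrable_bound[where f="\<lambda>x. M * indicator (cball 0 R) x"])
    show "AE x in lborel. norm (g x) \<le> norm (M * indicator (cball 0 R) x)"
      using M R M0 by (auto simp: indicator_def not_le)
  qed (use fin in auto)
  have "integrable lborel (\<lambda>x. (cmod (g x))\<^sup>2)"
  proof (rule Bochner_Integration.integrable_bound[where f="\<lambda>x. M\<^sup>2 * indicator (cball 0 R) x"])
    show "AE x in lborel. norm ((cmod (g x))\<^sup>2) \<le> norm (M\<^sup>2 * indicator (cball 0 R) x)"
      using M R M0 by (auto simp: indicator_def not_le intro!: power_mono)
  qed (use fin in auto)
  then show "g \<in> L2_space" by (simp add: L2_space_def)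
qed

text \<open>The approximating continuous functions are projected onto the disc of radius \<open>M\<close>. This preserves
  continuity and the limit and supplies the uniform bound.\<close>

lemma borel_approx_continuous:
  fixes g :: "real ^ 'n \<Rightarrow> complex"
  assumes [measurable]: "g \<in> borel_measurable borel" and M: "\<And>x. cmod (g x) \<le> M"
  obtains h where "\<And>n::nat. continuous_on UNIV (h n)" "\<And>n x. cmod (h n x) \<le> M"
    "AE x in lborel. (\<lambda>n. h n x) \<longlonglongrightarrow> g x"
proof -
  have "g measurable_on UNIV"
    by (rule lebesgue_measurable_imp_measurable_on) (auto intro: measurable_completion)
  then obtain N h where N: "negligible N" and h: "\<And>n. continuous_on UNIV (h n)"
    and lim: "\<And>x. x \<notin> N \<Longrightarrow> (\<lambda>n. h n x) \<longlonglongrightarrow> g x"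
    by (auto simp: measurable_on_def)
  let ?K = "cball (0::complex) M"
  have ne: "?K \<noteq> {}" using order_trans[OF norm_ge_zero M[of 0]] by simp
  have cp: "continuous_on UNIV (closest_point ?K)"
    by (rule continuous_on_closest_point) (use ne in auto)
  show thesis
  proof
    show "continuous_on UNIV (\<lambda>x. closest_point ?K (h n x))" for n
      by (rule continuous_on_compose2[OF cp h]) auto
    show "cmod (closest_point ?K (h n x)) \<le> M" for n x
      using closest_point_in_set[OF closed_cball ne, of "h n x"] by auto
    have "N \<in> null_sets lebesgue" using N by (simp add: negligible_iff_null_sets)
    then have "AE x in lebesgue. x \<notin> N" by (rule AE_not_in)
    then have "AE x in lborel. x \<notin> N" by (simp add: AE_completion_iff)
    then show "AE x in lborel. (\<lambda>n. closest_point ?K (h n x)) \<longlonglongrightarrow> g x"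
    proof eventually_elim
      case (elim x)
      have "(\<lambda>n. closest_point ?K (h n x)) \<longlonglongrightarrow> closest_point ?K (g x)"
        by (rule continuous_on_tendsto_compose[OF cp lim[OF elim]]) auto
      then show ?case using M[of x] by (simp add: closest_point_self)
    qed
  qed
qed

text \<open>Up to the factor \<open>M\<close> the increment is bounded by the integral of \<open>|g(x - u) - g(x)|\<close> over the support.
  Replacing \<open>g\<close> by a continuous \<open>h\<close> costs twice the distance of \<open>g\<close> and \<open>h\<close> in the mean, on a ball
  enlarged by 1 to make room for the translation; the increment of \<open>h\<close> tends to 0.\<close>

lemma autocorr_continuous_at_0:
  fixes g :: "real ^ 'n \<Rightarrow> complex"
  assumes g: "bounded_support g" and u: "u \<longlonglongrightarrow> 0"
  shows "(\<lambda>k. autocorr g (u k)) \<longlonglongrightarrow> autocorr g 0"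
proof -
  from g obtain M R where [measurable]: "g \<in> borel_measurable borel"
    and M: "\<And>x. cmod (g x) \<le> M" and R: "\<And>x. R < norm x \<Longrightarrow> g x = 0"
    by (auto simp: bounded_support_def)
  have M0: "0 \<le> M" using M[of 0] norm_ge_zero order_trans by blast
  obtain h where h: "\<And>n::nat. continuous_on UNIV (h n)" "\<And>n x. cmod (h n x) \<le> M"
    and lim: "AE x in lborel. (\<lambda>n. h n x) \<longlonglongrightarrow> g x"
    using borel_approx_continuous[of g M] M by auto
  have [measurable]: "h n \<in> borel_measurable borel" for n
    by (rule borel_measurable_continuous_onI[OF h(1)])
  define J :: "real \<Rightarrow> (real ^ 'n \<Rightarrow> complex) \<Rightarrow> ennreal" where
    "J r f = (\<integral>\<^sup>+x. indicator (cball 0 r) x * ennreal (cmod (f x)) \<partial>lborel)" for r f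
  have [measurable]: "cball 0 r \<in> sets (borel :: (real ^ 'n) measure)" for r by simp
  have J_add: "J r (\<lambda>x. f x + v x) \<le> J r f + J r v"
    if [measurable]: "f \<in> borel_measurable borel" "v \<in> borel_measurable borel" for r f v
  proof -
    have "J r (\<lambda>x. f x + v x) \<le> (\<integral>\<^sup>+x. indicator (cball 0 r) x * ennreal (cmod (f x)) +
        indicator (cball 0 r) x * ennreal (cmod (v x)) \<partial>lborel)"
      unfolding J_def
      by (intro nn_integral_mono)
         (auto simp: indicator_def norm_triangle_ineq ennreal_leI simp flip: ennreal_plus)
    also have "\<dots> = J r f + J r v" unfolding J_def by (rule nn_integral_add) measurable
    finally show ?thesis .
  qed
  have J_lim: "(\<lambda>k. J r (\<lambda>x. f k x - v x)) \<longlonglongrightarrow> 0"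
    if [measurable]: "\<And>k. f k \<in> borel_measurable borel" "v \<in> borel_measurable borel"
      and f: "\<And>k x. cmod (f k x) \<le> M" "\<And>x. cmod (v x) \<le> M"
      and l: "AE x in lborel. (\<lambda>k. f k x) \<longlonglongrightarrow> v x" for r f v
  proof -
    let ?I = "\<lambda>x. indicator (cball (0 :: real ^ 'n) r) x :: ennreal"
    have "(\<lambda>k. J r (\<lambda>x. f k x - v x)) \<longlonglongrightarrow> (\<integral>\<^sup>+x. 0 \<partial>(lborel :: (real ^ 'n) measure))"
      unfolding J_def
    proof (rule nn_integral_dominated_convergence[where w="\<lambda>x. ennreal (2 * M) * ?I x"])
      have "cmod (f k x - v x) \<le> 2 * M" for k x
        using norm_triangle_ineq4[of "f k x" "v x"] f(1)[of k x] f(2)[of x] by linarith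
      then show "AE x in lborel. ?I x * ennreal (cmod (f k x - v x)) \<le> ennreal (2 * M) * ?I x" for k
        by (auto simp: indicator_def intro: ennreal_leI)
      show "(\<integral>\<^sup>+x. ennreal (2 * M) * ?I x \<partial>lborel) < \<infinity>"
        using emeasure_lborel_cball_finite[of "0 :: real ^ 'n" r]
        by (subst nn_integral_cmult_indicator) (simp_all add: ennreal_mult_less_top)
      show "AE x in lborel. (\<lambda>k. ?I x * ennreal (cmod (f k x - v x))) \<longlonglongrightarrow> 0"
        using l
      proof eventually_elim
        case (elim x)
        have "(\<lambda>k. ennreal (cmod (f k x - v x))) \<longlonglongrightarrow> ennreal 0"
          by (rule tendsto_ennrealI[OF tendsto_norm_zero[OF LIM_zero[OF elim]]])
        then show ?case by (cases "x \<in> cball 0 r") auto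
      qed
    qed measurable
    then show ?thesis by simp
  qed
  define \<alpha> where "\<alpha> n = J (R + 1) (\<lambda>x. h n x - g x)" for n
  define \<beta> where "\<beta> n k = J R (\<lambda>x. h n (x - u k) - h n x)" for n k
  have \<alpha>: "\<alpha> \<longlonglongrightarrow> 0"
    unfolding \<alpha>_def by (rule J_lim) (use h M lim in auto)
  have \<beta>: "\<beta> n \<longlonglongrightarrow> 0" for n
    unfolding \<beta>_def
  proof (rule J_lim)
    have "(\<lambda>k. h n (x - u k)) \<longlonglongrightarrow> h n (x - 0)" for x
      by (rule continuous_on_tendsto_compose[OF h(1) tendsto_diff[OF tendsto_const u]]) auto
    then show "AE x in lborel. (\<lambda>k. h n (x - u k)) \<longlonglongrightarrow> h n x" by simp
  qed (use h in auto)
  have est: "ennreal (cmod (autocorr g (u k) - autocorr g 0)) \<le> ennreal M * (\<alpha> n + \<beta> n k + \<alpha> n)"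
    if uk: "norm (u k) \<le> 1" for n k
  proof -
    let ?d = "\<lambda>x. h n x - g x"
    have gi: "integrable lborel (\<lambda>x. g x * cnj (g (x - v)))" for v
      using L2_inner_integrable[OF _ L2_space_translate] bounded_support_integrable(2)[OF g] by auto
    have "autocorr g (u k) - autocorr g 0 = (LINT x|lborel. g x * cnj (g (x - u k)) - g x * cnj (g (x - 0)))"
      unfolding autocorr_def by (rule Bochner_Integration.integral_diff[symmetric]) (rule gi)+
    then have "ennreal (cmod (autocorr g (u k) - autocorr g 0)) \<le>
       (\<integral>\<^sup>+x. ennreal (cmod (g x * cnj (g (x - u k)) - g x * cnj (g (x - 0)))) \<partial>lborel)"
      by (simp only: integral_norm_bound_ennreal[OF Bochner_Integration.integrable_diff[OF gi gi]])
    also have "\<dots> \<le> (\<integral>\<^sup>+x. ennreal M * (indicator (cball 0 R) x * ennreal (cmod (g (x - u k) - g x))) \<partial>lborel)"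
    proof (rule nn_integral_mono)
      fix x
      have "cmod (g x * cnj (g (x - u k)) - g x * cnj (g (x - 0))) = cmod (g x) * cmod (g (x - u k) - g x)"
        by (simp add: right_diff_distrib[symmetric] norm_mult complex_cnj_diff[symmetric] del: complex_cnj_diff)
      then show "ennreal (cmod (g x * cnj (g (x - u k)) - g x * cnj (g (x - 0)))) \<le>
          ennreal M * (indicator (cball 0 R) x * ennreal (cmod (g (x - u k) - g x)))"
        using M[of x] R[of x] M0
        by (cases "norm x \<le> R") (auto simp: ennreal_mult'[symmetric] intro!: ennreal_leI mult_right_mono)
    qed
    also have "\<dots> = ennreal M * J R (\<lambda>x. - ?d (x - u k) + (h n (x - u k) - h n x) + ?d x)"
      unfolding J_def by (subst nn_integral_cmult) auto
    also have "\<dots> \<le> ennreal M * (J R (\<lambda>x. - ?d (x - u k)) + J R (\<lambda>x. h n (x - u k) - h n x) + J R ?d)"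
      by (intro mult_left_mono order_trans[OF J_add] add_right_mono J_add) auto
    also have "\<dots> \<le> ennreal M * (\<alpha> n + \<beta> n k + \<alpha> n)"
    proof (intro mult_left_mono add_mono)
      have "J R (\<lambda>x. - ?d (x - u k)) \<le>
          (\<integral>\<^sup>+x. indicator (cball 0 (R + 1)) (x + - u k) * ennreal (cmod (?d (x + - u k))) \<partial>lborel)"
        unfolding J_def norm_minus_cancel
      proof (rule nn_integral_mono)
        fix x
        have "indicator (cball 0 R) x \<le> (indicator (cball 0 (R + 1)) (x - u k) :: ennreal)"
          using norm_triangle_ineq4[of x "u k"] uk by (auto simp: indicator_def)
        then show "indicator (cball 0 R) x * ennreal (cmod (?d (x - u k))) \<le>
            indicator (cball 0 (R + 1)) (x + - u k) * ennreal (cmod (?d (x + - u k)))"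
          by (simp add: mult_right_mono)
      qed
      also have "\<dots> = \<alpha> n"
        unfolding \<alpha>_def J_def by (rule nn_integral_lborel_translate) measurable
      finally show "J R (\<lambda>x. - ?d (x - u k)) \<le> \<alpha> n" .
      show "J R ?d \<le> \<alpha> n"
        unfolding \<alpha>_def J_def by (intro nn_integral_mono mult_right_mono) (auto simp: indicator_def)
    qed (simp_all add: \<beta>_def)
    finally show ?thesis .
  qed
  show ?thesis
  proof (rule LIMSEQ_I)
    fix e :: real assume "0 < e"
    \<comment> \<open>The bound of \<open>est\<close> is \<open>M\<close> times three quantities below \<open>d\<close>; \<open>M + 1\<close> avoids a division by 0.\<close>
    define d where "d = e / (3 * (M + 1))"
    have d: "0 < d" using \<open>0 < e\<close> M0 by (simp add: d_def)
    then have d': "0 < ennreal d" by (simp only: ennreal_less_zero_iff)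
    obtain n where n: "\<alpha> n < ennreal d"
      using order_tendstoD(2)[OF \<alpha> d'] eventually_happens'[OF sequentially_bot] by blast
    have "\<forall>\<^sub>F k in sequentially. norm (u k) < 1"
      using tendsto_norm[OF u] by (intro order_tendstoD) auto
    with order_tendstoD(2)[OF \<beta> d', of n]
    have "\<forall>\<^sub>F k in sequentially. norm (autocorr g (u k) - autocorr g 0) < e"
    proof eventually_elim
      case (elim k)
      have "ennreal M * (\<alpha> n + \<beta> n k + \<alpha> n) \<le> ennreal M * (ennreal d + ennreal d + ennreal d)"
        using n elim by (intro mult_left_mono add_mono) auto
      also have "\<dots> = ennreal (M * (d + d + d))"
        using M0 d by (subst ennreal_mult) (simp_all only: ennreal_plus add_nonneg_nonneg less_imp_le)
      finally have le: "ennreal M * (\<alpha> n + \<beta> n k + \<alpha> n) \<le> ennreal (M * (d + d + d))" .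
      have "0 \<le> M * (d + d + d)" using M0 d by simp
      with order_trans[OF est[OF less_imp_le[OF elim(2)]] le]
      have "cmod (autocorr g (u k) - autocorr g 0) \<le> M * (d + d + d)"
        by (simp only: ennreal_le_iff)
      also have "\<dots> < (M + 1) * (3 * d)" using d by (simp add: algebra_simps)
      also have "\<dots> = e" using M0 by (simp add: d_def field_simps)
      finally show ?case .
    qed
    then show "\<exists>no. \<forall>n\<ge>no. norm (autocorr g (u n) - autocorr g 0) < e"
      by (simp add: eventually_sequentially)
  qed
qed

lemma Plancherel_bounded_support:
  fixes g :: "real ^ 'n \<Rightarrow> complex"
  assumes g: "bounded_support g"
  shows "L2_inner (fourier_L1 g) (fourier_L1 g) = L2_inner g g"
proof -
  let ?A = "\<lambda>s z. autocorr g ((s / (2 * pi)) *\<^sub>R z) * complex_of_real (gauss z)"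
  let ?e = "\<lambda>\<xi>. (cmod (fourier_L1 g \<xi>))\<^sup>2"
  note gi = bounded_support_integrable[OF g]
  define N where "N = (LINT x|lborel. (cmod (g x))\<^sup>2)"
  have [measurable]: "g \<in> borel_measurable borel" using gi by auto
  have [measurable]: "autocorr g \<in> borel_measurable borel" using autocorr_fourier(1)[OF gi(1)] by auto
  define s where "s k = 1 / real (Suc k)" for k :: nat
  have s0: "0 < s k" for k by (simp add: s_def)
  let ?F = "fourier_L1 g"
  have F2: "?F \<in> L2_space" by (rule fourier_L1_L2[OF gi])
  have "(\<lambda>k. LINT \<xi>|lborel. ?e \<xi> * gauss_weight (s k) \<xi>) \<longlonglongrightarrow> (LINT \<xi>|lborel. ?e \<xi>)"
  proof (rule integral_dominated_convergence[where w="\<lambda>\<xi>. ?e \<xi>"])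
    show "AE \<xi> in lborel. (\<lambda>k. ?e \<xi> * gauss_weight (s k) \<xi>) \<longlonglongrightarrow> ?e \<xi>"
      using tendsto_mult_left[OF gauss_weight_tendsto] by (fastforce simp: s_def)
    show "AE \<xi> in lborel. norm (?e \<xi> * gauss_weight (s k) \<xi>) \<le> ?e \<xi>" for k
      by (simp add: gauss_weight_bounds abs_mult mult_left_le)
  qed (use L2_space_integrable[OF F2] in auto)
  then have 1: "(\<lambda>k. complex_of_real (LINT \<xi>|lborel. ?e \<xi> * gauss_weight (s k) \<xi>)) \<longlonglongrightarrow> L2_inner ?F ?F"
    unfolding L2_inner_self by (rule tendsto_of_real)
  have "(\<lambda>k. LINT z|lborel. ?A (s k) z) \<longlonglongrightarrow>
      (LINT z|lborel. autocorr g 0 * complex_of_real (gauss (z :: real ^ 'n)))"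
  proof (rule integral_dominated_convergence[where w="\<lambda>z. N * gauss z"])
    show "AE z in lborel. (\<lambda>k. ?A (s k) z)
        \<longlonglongrightarrow> autocorr g 0 * complex_of_real (gauss z)"
    proof (rule AE_I2)
      fix z :: "real ^ 'n"
      have "(\<lambda>k. (s k / (2 * pi)) *\<^sub>R z) \<longlonglongrightarrow> (0 / (2 * pi)) *\<^sub>R z"
        unfolding s_def by (intro tendsto_intros LIMSEQ_Suc[OF lim_1_over_n]) auto
      then show "(\<lambda>k. ?A (s k) z)
        \<longlonglongrightarrow> autocorr g 0 * complex_of_real (gauss z)"
        by (intro tendsto_intros autocorr_continuous_at_0[OF g]) simp
    qed
    show "AE z in lborel. norm (?A (s k) z) \<le> N * gauss z" for k
      using autocorr_bound[OF gi(2)] by (auto simp: norm_mult gauss_nonneg N_def intro!: mult_right_mono)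
    show "integrable lborel (\<lambda>z. N * gauss (z :: real ^ 'n))"
      by (intro integrable_mult_right gauss_integrable)
  qed measurable
  also have "(LINT z|lborel. autocorr g 0 * complex_of_real (gauss (z :: real ^ 'n))) = autocorr g 0"
    using gauss_cis(2)[of "0 :: real ^ 'n"] by simp
  finally have "(\<lambda>k. complex_of_real (LINT \<xi>|lborel. ?e \<xi> * gauss_weight (s k) \<xi>)) \<longlonglongrightarrow> autocorr g 0"
    unfolding gauss_energy[OF gi(1) s0] .
  with 1 have "L2_inner ?F ?F = autocorr g 0" by (rule LIMSEQ_unique)
  then show ?thesis by (simp add: autocorr_zero)
qed

section \<open>Parseval's identity\<close>

lemma fourier_L1_lincomb:
  assumes f: "integrable lborel f" and g: "integrable lborel g"
  shows "fourier_L1 (\<lambda>x. f x + c * g x) \<xi> = fourier_L1 f \<xi> + c * fourier_L1 g \<xi>"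
proof -
  have int_h: "integrable lborel (\<lambda>x. h x * cis (- (2 * pi * (x \<bullet> \<xi>))))" if "integrable lborel h" for h
    by (rule integrable_cis_mult[OF that]) simp
  have "fourier_L1 (\<lambda>x. f x + c * g x) \<xi> =
     (LINT x|lborel. f x * cis (- (2 * pi * (x \<bullet> \<xi>))) + c * (g x * cis (- (2 * pi * (x \<bullet> \<xi>)))))"
    unfolding fourier_L1_cis by (simp add: algebra_simps)
  also have "\<dots> = fourier_L1 f \<xi> + c * fourier_L1 g \<xi>"
    unfolding fourier_L1_cis by (subst Bochner_Integration.integral_add) (auto intro!: int_h f g)
  finally show ?thesis .
qed

lemma bounded_support_lincomb:
  assumes "bounded_support f" "bounded_support g"
  shows "bounded_support (\<lambda>x. f x + c * g x)"
proof -
  from assms obtain M R N S where [measurable]: "f \<in> borel_measurable borel" "g \<in> borel_measurable borel"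
    and f: "\<And>x. cmod (f x) \<le> M \<and> (R < norm x \<longrightarrow> f x = 0)"
    and g: "\<And>x. cmod (g x) \<le> N \<and> (S < norm x \<longrightarrow> g x = 0)"
    unfolding bounded_support_def by blast
  have "cmod (f x + c * g x) \<le> M + cmod c * N \<and> (max R S < norm x \<longrightarrow> f x + c * g x = 0)" for x
  proof (intro conjI)
    have "cmod (f x + c * g x) \<le> cmod (f x) + cmod c * cmod (g x)"
      using norm_triangle_ineq[of "f x" "c * g x"] by (simp add: norm_mult)
    also have "\<dots> \<le> M + cmod c * N"
      using f g by (intro add_mono mult_left_mono) auto
    finally show "cmod (f x + c * g x) \<le> M + cmod c * N" .
  qed (use f g in auto)
  then show ?thesis
    unfolding bounded_support_def by (intro conjI exI[of _ "M + cmod c * N"] exI[of _ "max R S"]) auto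
qed

lemma L2_inner_lincomb:
  assumes "f \<in> L2_space" "g \<in> L2_space"
  shows "L2_inner (\<lambda>x. f x + c * g x) (\<lambda>x. f x + c * g x) =
    L2_inner f f + cnj c * L2_inner f g + c * L2_inner g f + c * cnj c * L2_inner g g"
proof -
  note i = L2_inner_integrable[OF assms(1) assms(1)] L2_inner_integrable[OF assms(1) assms(2)]
    L2_inner_integrable[OF assms(2) assms(1)] L2_inner_integrable[OF assms(2) assms(2)]
  have "(f x + c * g x) * cnj (f x + c * g x) = f x * cnj (f x) + cnj c * (f x * cnj (g x))
      + c * (g x * cnj (f x)) + c * cnj c * (g x * cnj (g x))" for x
    by (simp add: algebra_simps)
  then show ?thesis
    unfolding L2_inner_def
    by (simp only: i integrable_mult_right Bochner_Integration.integrable_add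
        Bochner_Integration.integral_add integral_mult_right_zero)
qed

text \<open>Equal norms on the combinations with \<open>c\<close> among the fourth roots of unity determine the inner
  product.\<close>

lemma L2_polarization:
  assumes L: "f \<in> L2_space" "g \<in> L2_space" "F \<in> L2_space" "G \<in> L2_space"
    and eq: "\<And>c. L2_inner (\<lambda>x. F x + c * G x) (\<lambda>x. F x + c * G x) = L2_inner (\<lambda>x. f x + c * g x) (\<lambda>x. f x + c * g x)"
  shows "L2_inner F G = L2_inner f g"
proof -
  define p q where "p = L2_inner F G - L2_inner f g" and "q = L2_inner G F - L2_inner g f"
  define d e where "d = L2_inner F F - L2_inner f f" and "e = L2_inner G G - L2_inner g g"
  have *: "d + cnj c * p + c * q + c * cnj c * e = 0" for c
    using eq[of c] unfolding L2_inner_lincomb[OF L(1,2)] L2_inner_lincomb[OF L(3,4)]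
    by (simp add: p_def q_def d_def e_def algebra_simps)
  have "(d + p + q + e) - (d - p - q + e) = 0" "(d - \<i> * p + \<i> * q + e) - (d + \<i> * p - \<i> * q + e) = 0"
    using *[of 1] *[of "-1"] *[of \<i>] *[of "-\<i>"] by simp_all
  then have "p + q = 0" "\<i> * (q - p) = 0" by (simp_all add: algebra_simps)
  then have "p = 0" by (simp add: algebra_simps)
  then show ?thesis by (simp add: p_def)
qed

lemma Parseval_bounded_support:
  assumes f: "bounded_support f" and g: "bounded_support g"
  shows "L2_inner (fourier_L1 f) (fourier_L1 g) = L2_inner f g"
proof (rule L2_polarization)
  note fi = bounded_support_integrable[OF f] and gi = bounded_support_integrable[OF g]
  show "f \<in> L2_space" "g \<in> L2_space" by (fact fi gi)+
  show "fourier_L1 f \<in> L2_space" "fourier_L1 g \<in> L2_space"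
    by (intro fourier_L1_L2 fi gi)+
  show "L2_inner (\<lambda>x. fourier_L1 f x + c * fourier_L1 g x) (\<lambda>x. fourier_L1 f x + c * fourier_L1 g x) =
         L2_inner (\<lambda>x. f x + c * g x) (\<lambda>x. f x + c * g x)" for c
    using Plancherel_bounded_support[OF bounded_support_lincomb[OF f g, of c]]
    by (simp only: fourier_L1_lincomb[OF fi(1) gi(1), abs_def])
qed

lemma bounded_support_dense:
  fixes f :: "real ^ 'n \<Rightarrow> complex"
  assumes f: "f \<in> L2_space"
  obtains h where "\<And>k::nat. bounded_support (h k)" "L2_lim h f"
    "\<And>k x. cmod (h k x) \<le> cmod (f x)"
proof -
  have [measurable]: "f \<in> borel_measurable borel" using f by auto
  \<comment> \<open>Cutting off both large values and large arguments.\<close>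
  define h where "h k x = (if cmod (f x) \<le> real k \<and> norm x \<le> real k then f x else 0)" for k x
  have [measurable]: "h k \<in> borel_measurable borel" for k
    unfolding h_def by measurable
  have bs: "bounded_support (h k)" for k
    unfolding bounded_support_def
    by (intro conjI exI[of _ "real k"]) (auto simp: h_def)
  have le: "cmod (h k x) \<le> cmod (f x)" for k x by (auto simp: h_def)
  have "(\<lambda>k. \<integral>\<^sup>+x. ennreal ((cmod (h k x - f x))\<^sup>2) \<partial>lborel) \<longlonglongrightarrow> (\<integral>\<^sup>+x. 0 \<partial>(lborel :: (real ^ 'n) measure))"
  proof (rule nn_integral_dominated_convergence[where w="\<lambda>x. ennreal ((cmod (f x))\<^sup>2)"])
    show "AE x in lborel. ennreal ((cmod (h k x - f x))\<^sup>2) \<le> ennreal ((cmod (f x))\<^sup>2)" for k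
      by (auto simp: h_def)
    show "(\<integral>\<^sup>+x. ennreal ((cmod (f x))\<^sup>2) \<partial>lborel) < \<infinity>"
      using f by (simp add: L2_space_iff_nn)
    show "AE x in lborel. (\<lambda>k. ennreal ((cmod (h k x - f x))\<^sup>2)) \<longlonglongrightarrow> 0"
    proof (rule AE_I2)
      fix x
      obtain N where N: "max (cmod (f x)) (norm x) \<le> real N" using real_arch_simple by blast
      have "\<forall>\<^sub>F k in sequentially. ennreal ((cmod (h k x - f x))\<^sup>2) = 0"
        unfolding eventually_sequentially using N by (intro exI[of _ N]) (auto simp: h_def)
      then show "(\<lambda>k. ennreal ((cmod (h k x - f x))\<^sup>2)) \<longlonglongrightarrow> 0"
        by (rule tendsto_eventually)
    qed
  qed measurable
  then have "L2_lim h f" by (simp add: L2_dist_sq_def)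
  with bs le show thesis using that by blast
qed

lemma fourier_L1_dist:
  assumes f: "integrable lborel f" "f \<in> L2_space" and g: "integrable lborel g" "g \<in> L2_space"
  shows "L2_dist_sq (fourier_L1 f) (fourier_L1 g) \<le> L2_dist_sq f g"
proof -
  have i: "integrable lborel (\<lambda>x. f x - g x)" using f g by auto
  have l: "(\<lambda>x. f x - g x) \<in> L2_space" by (rule L2_space_diff) (fact f g)+
  have "fourier_L1 (\<lambda>x. f x - g x) \<xi> = fourier_L1 f \<xi> - fourier_L1 g \<xi>" for \<xi>
    using fourier_L1_lincomb[OF f(1) g(1), of "-1"] by simp
  then show ?thesis
    using fourier_L1_contraction[OF i l] L2_nn[OF l] by (simp add: L2_dist_sq_def)
qed

lemma L2_inner_tendsto_right:
  assumes g: "\<And>k. g k \<in> L2_space" "f \<in> L2_space" "h \<in> L2_space"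
    and lim: "L2_lim g f"
  shows "(\<lambda>k. L2_inner h (g k)) \<longlonglongrightarrow> L2_inner h f"
  unfolding L2_inner_cnj[of h] using L2_inner_tendsto[OF assms] by (rule tendsto_cnj)

lemma L2_dist_fourier_tendsto:
  assumes "\<And>k. integrable lborel (g k)" "\<And>k. g k \<in> L2_space" "integrable lborel f" "f \<in> L2_space"
    and "L2_lim g f"
  shows "L2_lim (\<lambda>k. fourier_L1 (g k)) (fourier_L1 f)"
  by (rule tendsto_sandwich[OF _ _ tendsto_const assms(5)]) (auto intro!: always_eventually fourier_L1_dist assms)

lemma L2_inner_eq_limit:
  assumes f: "\<And>k. h k \<in> L2_space" "f \<in> L2_space" "L2_lim h f"
    and F: "\<And>k. H k \<in> L2_space" "F \<in> L2_space" "L2_lim H F"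
    and g: "\<And>k. w k \<in> L2_space" "g \<in> L2_space" "L2_lim w g"
    and G: "\<And>k. W k \<in> L2_space" "G \<in> L2_space" "L2_lim W G"
    and eq: "\<And>k m. L2_inner (H k) (W m) = L2_inner (h k) (w m)"
  shows "L2_inner F G = L2_inner f g"
proof -
  have 1: "L2_inner F (W m) = L2_inner f (w m)" for m
    using L2_inner_tendsto[OF F(1,2) G(1) F(3), of m] L2_inner_tendsto[OF f(1,2) g(1) f(3), of m]
    unfolding eq by (rule LIMSEQ_unique)
  show ?thesis
    using L2_inner_tendsto_right[OF G(1,2) F(2) G(3)] L2_inner_tendsto_right[OF g(1,2) f(2) g(3)]
    unfolding 1 by (rule LIMSEQ_unique)
qed

text \<open>One argument at a time is approximated by truncations; the contraction property carries the
  convergence over to the transforms.\<close>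

lemma Parseval_L1_L2:
  assumes f: "integrable lborel f" "f \<in> L2_space" and g: "integrable lborel g" "g \<in> L2_space"
  shows "L2_inner (fourier_L1 f) (fourier_L1 g) = L2_inner f g"
proof -
  obtain h where h: "\<And>k::nat. bounded_support (h k)" "L2_lim h f"
    using bounded_support_dense[OF f(2)] by metis
  obtain w where w: "\<And>k::nat. bounded_support (w k)" "L2_lim w g"
    using bounded_support_dense[OF g(2)] by metis
  note hi = bounded_support_integrable[OF h(1)] and wi = bounded_support_integrable[OF w(1)]
  show ?thesis
    by (rule L2_inner_eq_limit[OF hi(2) f(2) h(2) fourier_L1_L2[OF hi] fourier_L1_L2[OF f]
          L2_dist_fourier_tendsto[OF hi f h(2)] wi(2) g(2) w(2) fourier_L1_L2[OF wi] fourier_L1_L2[OF g]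
          L2_dist_fourier_tendsto[OF wi g w(2)] Parseval_bounded_support[OF h(1) w(1)]])
qed

lemma L2_dist_sq_triangle:
  assumes [measurable]: "f \<in> borel_measurable borel" "g \<in> borel_measurable borel" "h \<in> borel_measurable borel"
  shows "L2_dist_sq f h \<le> 2 * L2_dist_sq f g + 2 * L2_dist_sq g h"
proof -
  have "L2_dist_sq f h \<le> (\<integral>\<^sup>+x. 2 * ennreal ((cmod (f x - g x))\<^sup>2) + 2 * ennreal ((cmod (g x - h x))\<^sup>2) \<partial>lborel)"
    unfolding L2_dist_sq_def
  proof (rule nn_integral_mono)
    fix x
    have "ennreal ((cmod (f x - h x))\<^sup>2) \<le> ennreal (2 * (cmod (f x - g x))\<^sup>2 + 2 * (cmod (g x - h x))\<^sup>2)"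
      using sq_norm_add_le[of "f x - g x" "g x - h x"] by (intro ennreal_leI) simp
    also have "\<dots> = 2 * ennreal ((cmod (f x - g x))\<^sup>2) + 2 * ennreal ((cmod (g x - h x))\<^sup>2)"
      by (simp add: ennreal_mult)
    finally show "ennreal ((cmod (f x - h x))\<^sup>2) \<le> 2 * ennreal ((cmod (f x - g x))\<^sup>2) + 2 * ennreal ((cmod (g x - h x))\<^sup>2)" .
  qed
  also have "\<dots> = 2 * L2_dist_sq f g + 2 * L2_dist_sq g h"
    unfolding L2_dist_sq_def by (simp add: nn_integral_add nn_integral_cmult)
  finally show ?thesis .
qed

lemma ennreal_term_le_suminf: "b k \<le> (\<Sum>k. b k :: ennreal)"
  using sum_le_suminf[of b "{k}"] by simp

text \<open>The Riesz--Fischer theorem for a rapidly converging sequence. The weights \<open>2\<^sup>k\<close> keep the sum of the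
  squared increments integrable, so at almost every point that weighted sum is finite; the increments
  then decay geometrically and the sequence converges. Fatou's lemma gives the distance to the limit.\<close>

lemma L2_complete:
  fixes G :: "nat \<Rightarrow> real ^ 'n \<Rightarrow> complex"
  assumes G: "\<And>k. G k \<in> L2_space"
    and d: "\<And>j k. L2_dist_sq (G j) (G k) \<le> ennreal ((1/4) ^ j + (1/4) ^ k)"
  obtains F where "F \<in> L2_space" "L2_lim G F"
proof -
  have [measurable]: "G k \<in> borel_measurable borel" for k using G[of k] by auto
  define F where "F x = lim (\<lambda>k. G k x)" for x
  have [measurable]: "F \<in> borel_measurable borel"
    unfolding F_def[abs_def] by (rule borel_measurable_lim_metric) measurable
  let ?a = "\<lambda>k x. (cmod (G (Suc k) x - G k x))\<^sup>2"
  let ?d = "\<lambda>k x m. ennreal ((cmod (G k x - G m x))\<^sup>2)"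
  let ?b = "\<lambda>k x. ennreal (2 ^ k * ?a k x)"
  have "(\<integral>\<^sup>+x. (\<Sum>k. ?b k x) \<partial>lborel) = (\<Sum>k. \<integral>\<^sup>+x. ?b k x \<partial>lborel)"
    by (rule nn_integral_suminf) measurable
  also have "\<dots> \<le> (\<Sum>k. ennreal (2 * (1/2) ^ k))"
  proof (rule suminf_le)
    fix k
    have "(\<integral>\<^sup>+x. ?b k x \<partial>lborel) = ennreal (2 ^ k) * L2_dist_sq (G (Suc k)) (G k)"
      unfolding L2_dist_sq_def by (simp add: ennreal_mult nn_integral_cmult)
    also have "\<dots> \<le> ennreal (2 ^ k) * ennreal ((1/4) ^ Suc k + (1/4) ^ k)"
      by (intro mult_left_mono d) simp
    also have "\<dots> = ennreal (2 ^ k * ((1/4) ^ Suc k + (1/4) ^ k))"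
      by (rule ennreal_mult[symmetric]) auto
    also have "\<dots> \<le> ennreal (2 * (1/2) ^ k)"
    proof (rule ennreal_leI)
      have "(2::real) ^ k * ((1/4) ^ Suc k + (1/4) ^ k) = (5/4) * (2 ^ k * (1/4) ^ k)"
        by (simp add: algebra_simps)
      also have "(2::real) ^ k * (1/4) ^ k = (1/2) ^ k"
        unfolding power_mult_distrib[symmetric] by simp
      finally have e: "(2::real) ^ k * ((1/4) ^ Suc k + (1/4) ^ k) = (5/4) * (1/2) ^ k" .
      show "(2::real) ^ k * ((1/4) ^ Suc k + (1/4) ^ k) \<le> 2 * (1/2) ^ k" unfolding e by simp
    qed
    finally show "(\<integral>\<^sup>+x. ?b k x \<partial>lborel) \<le> ennreal (2 * (1/2) ^ k)" .
  qed auto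
  also have "\<dots> = ennreal (\<Sum>k. 2 * (1/2) ^ k)"
    by (rule suminf_ennreal2) (auto intro!: summable_mult summable_geometric)
  also have "\<dots> < \<infinity>" by simp
  finally have "(\<integral>\<^sup>+x. (\<Sum>k. ?b k x) \<partial>lborel) \<noteq> \<infinity>" by simp
  then have "AE x in lborel. (\<Sum>k. ?b k x) \<noteq> \<infinity>"
    by (rule nn_integral_PInf_AE[rotated]) measurable
  then have conv: "AE x in lborel. (\<lambda>k. G k x) \<longlonglongrightarrow> F x"
  proof eventually_elim
    case (elim x)
    define T where "T = enn2real (\<Sum>k. ?b k x)"
    have T: "ennreal T = (\<Sum>k. ?b k x)"
      unfolding T_def using elim by (simp add: ennreal_enn2real less_top)
    have T0: "0 \<le> T" by (simp add: T_def)
    have "cmod (G (Suc k) x - G k x) \<le> sqrt T * sqrt (1/2) ^ k" for k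
    proof -
      have "?b k x \<le> ennreal T"
        unfolding T by (rule ennreal_term_le_suminf)
      then have "2 ^ k * ?a k x \<le> T" by (simp only: ennreal_le_iff[OF T0])
      then have "?a k x * 2 ^ k \<le> T" by (simp only: mult.commute)
      then have "?a k x \<le> T / 2 ^ k"
        by (subst pos_le_divide_eq) simp_all
      also have "T / 2 ^ k = (sqrt T * sqrt (1/2) ^ k)\<^sup>2"
      proof -
        have "(sqrt (1/2) ^ k)\<^sup>2 = ((sqrt (1/2))\<^sup>2) ^ k"
          by (simp only: power_mult[symmetric] mult.commute)
        then have "(sqrt (1/2) ^ k)\<^sup>2 = (1/2) ^ k" by simp
        then show ?thesis
          unfolding power_mult_distrib real_sqrt_pow2[OF T0] by (simp add: power_divide)
      qed
      finally show ?thesis by (rule power2_le_imp_le) (simp add: T0)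
    qed
    moreover have "summable (\<lambda>k. sqrt T * sqrt (1/2) ^ k)"
    proof (rule summable_mult, rule summable_geometric)
      have "sqrt (1/2) < sqrt 1" by (rule real_sqrt_less_mono) simp
      then show "norm (sqrt (1/2)) < 1" by simp
    qed
    ultimately have "summable (\<lambda>k. G (Suc k) x - G k x)"
      by (rule summable_comparison_test'[rotated, where N=0])
    then have "convergent (\<lambda>n. \<Sum>k<n. G (Suc k) x - G k x)"
      by (simp only: summable_iff_convergent)
    then have "convergent (\<lambda>n. G n x - G 0 x)"
      by (simp only: sum_lessThan_telescope[of "\<lambda>n. G n x"])
    from convergent_add[OF this convergent_const[of "G 0 x"]]
    have "convergent (\<lambda>n. G n x)" by simp
    then show ?case by (simp add: F_def convergent_LIMSEQ_iff)
  qed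
  have dist: "L2_dist_sq (G k) F \<le> ennreal (2 * (1/4) ^ k)" for k
  proof -
    have "L2_dist_sq (G k) F = (\<integral>\<^sup>+x. liminf (\<lambda>m. ?d k x m) \<partial>lborel)"
      unfolding L2_dist_sq_def
    proof (rule nn_integral_cong_AE, use conv in eventually_elim)
      case (elim x)
      have "(\<lambda>m. ?d k x m) \<longlonglongrightarrow> ennreal ((cmod (G k x - F x))\<^sup>2)"
        by (rule tendsto_ennrealI[OF tendsto_power[OF tendsto_norm[OF tendsto_diff[OF tendsto_const elim]]]])
      from lim_imp_Liminf[OF trivial_limit_sequentially this] show ?case by (rule sym)
    qed
    also have "\<dots> \<le> liminf (\<lambda>m. L2_dist_sq (G k) (G m))"
      unfolding L2_dist_sq_def by (rule nn_integral_liminf) measurable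
    also have "\<dots> \<le> ennreal (2 * (1/4) ^ k)"
    proof (rule Liminf_le)
      show "\<forall>\<^sub>F m in sequentially. L2_dist_sq (G k) (G m) \<le> ennreal (2 * (1/4) ^ k)"
        unfolding eventually_sequentially
      proof (intro exI[of _ k] allI impI)
        fix m assume "k \<le> m"
        then have "(1/4::real) ^ m \<le> (1/4) ^ k" by (intro power_decreasing) auto
        then have "ennreal ((1/4) ^ k + (1/4) ^ m) \<le> ennreal (2 * (1/4) ^ k)"
          by (intro ennreal_leI) simp
        with d[of k m] show "L2_dist_sq (G k) (G m) \<le> ennreal (2 * (1/4) ^ k)" by (rule order_trans)
      qed
    qed simp
    finally show ?thesis .
  qed
  show thesis
  proof
    have "(\<lambda>x. G 0 x - F x) \<in> L2_space"
      using le_less_trans[OF dist[of 0], of \<infinity>] by (simp add: L2_space_iff_nn L2_dist_sq_def)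
    from L2_space_diff[OF G[of 0] this] show "F \<in> L2_space" by simp
    have "(\<lambda>k. (1/4::real) ^ k) \<longlonglongrightarrow> 0"
      by (rule LIMSEQ_realpow_zero) auto
    from tendsto_ennrealI[OF tendsto_mult_right_zero[OF this, of 2]]
    have e0: "(\<lambda>k. ennreal (2 * (1/4) ^ k)) \<longlonglongrightarrow> 0" by simp
    show "L2_lim G F"
      by (rule tendsto_sandwich[OF _ _ tendsto_const e0]) (simp_all add: dist)
  qed
qed

text \<open>A fast subsequence of the truncations of \<open>f\<close> has a fast Cauchy sequence of transforms.\<close>

lemma fourier_L2_exists:
  fixes f :: "real ^ 'n \<Rightarrow> complex"
  assumes f: "f \<in> L2_space"
  shows "\<exists>F. has_fourier_L2 f F"
proof -
  have [measurable]: "f \<in> borel_measurable borel" using f by auto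
  obtain h where h: "\<And>k::nat. bounded_support (h k)" "L2_lim h f"
    using bounded_support_dense[OF f] by metis
  have "\<forall>k. \<exists>j. L2_dist_sq (h j) f < ennreal ((1/4) ^ k / 2)"
  proof
    fix k :: nat
    have "0 < (1/4::real) ^ k / 2" by simp
    then have "0 < ennreal ((1/4) ^ k / 2)" by (simp only: ennreal_less_zero_iff)
    from order_tendstoD(2)[OF h(2) this]
    show "\<exists>j. L2_dist_sq (h j) f < ennreal ((1/4) ^ k / 2)"
      by (rule eventually_happens'[OF sequentially_bot])
  qed
  then obtain n where n: "\<forall>k. L2_dist_sq (h (n k)) f < ennreal ((1/4) ^ k / 2)"
    by (rule choice[THEN exE])
  define g where "g k = h (n k)" for k
  have gi: "integrable lborel (g k)" "g k \<in> L2_space" for k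
    using bounded_support_integrable[OF h(1)] by (auto simp: g_def)
  have gd: "L2_dist_sq (g k) f \<le> ennreal ((1/4) ^ k / 2)" for k
    unfolding g_def using n by (rule allE) (rule less_imp_le)
  have cauchy: "L2_dist_sq (fourier_L1 (g j)) (fourier_L1 (g k)) \<le> ennreal ((1/4) ^ j + (1/4) ^ k)" for j k
  proof -
    have "L2_dist_sq (fourier_L1 (g j)) (fourier_L1 (g k)) \<le> L2_dist_sq (g j) (g k)"
      by (intro fourier_L1_dist gi)
    also have "\<dots> \<le> 2 * L2_dist_sq (g j) f + 2 * L2_dist_sq f (g k)"
      using gi[of j] gi[of k] by (intro L2_dist_sq_triangle) auto
    also have "\<dots> \<le> 2 * ennreal ((1/4) ^ j / 2) + 2 * ennreal ((1/4) ^ k / 2)"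
      unfolding L2_dist_sq_sym[of f] by (intro add_mono mult_left_mono gd) auto
    also have "\<dots> = ennreal (2 * ((1/4) ^ j / 2) + 2 * ((1/4) ^ k / 2))"
    proof -
      have tw: "2 * ennreal c = ennreal (2 * c)" if "0 \<le> c" for c
        using that by (simp add: ennreal_mult)
      have nn: "0 \<le> (1/4::real) ^ i / 2" for i :: nat by simp
      have nn2: "0 \<le> 2 * ((1/4::real) ^ i / 2)" for i :: nat by simp
      show ?thesis unfolding tw[OF nn] ennreal_plus[OF nn2 nn2] ..
    qed
    finally show ?thesis by simp
  qed
  obtain F where F: "F \<in> L2_space" "L2_lim (\<lambda>k. fourier_L1 (g k)) F"
    by (rule L2_complete[of "\<lambda>k. fourier_L1 (g k)", OF fourier_L1_L2[OF gi] cauchy])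
  have "L2_lim g f"
  proof (rule tendsto_sandwich[OF _ _ tendsto_const])
    have "(\<lambda>k. (1/4::real) ^ k) \<longlonglongrightarrow> 0"
      by (rule LIMSEQ_realpow_zero) auto
    from tendsto_ennrealI[OF tendsto_divide_zero[OF this, of 2]]
    show "(\<lambda>k. ennreal ((1/4) ^ k / 2)) \<longlonglongrightarrow> 0" by simp
  qed (auto intro!: always_eventually gd)
  then have "has_fourier_L2 f F"
    unfolding has_fourier_L2_def using gi F by (intro conjI exI[of _ g] allI) auto
  then show ?thesis by (rule exI[of _ F])
qed

lemma has_fourier_fourier_L2: "f \<in> L2_space \<Longrightarrow> has_fourier_L2 f (fourier_L2 f)"
  unfolding fourier_L2_def by (rule someI_ex[OF fourier_L2_exists])

lemma has_fourier_L2_space: "has_fourier_L2 f F \<Longrightarrow> F \<in> L2_space"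
  by (simp add: has_fourier_L2_def)

lemma Parseval_L2:
  assumes f: "f \<in> L2_space" "has_fourier_L2 f F" and g: "g \<in> L2_space" "has_fourier_L2 g G"
  shows "L2_inner F G = L2_inner f g"
proof -
  from f(2) obtain h where F: "F \<in> L2_space" and h: "\<And>k::nat. h k \<in> L2_space" "\<And>k. integrable lborel (h k)"
      "L2_lim h f" "L2_lim (\<lambda>k. fourier_L1 (h k)) F"
    by (auto simp: has_fourier_L2_def)
  from g(2) obtain w where G: "G \<in> L2_space" and w: "\<And>k::nat. w k \<in> L2_space" "\<And>k. integrable lborel (w k)"
      "L2_lim w g" "L2_lim (\<lambda>k. fourier_L1 (w k)) G"
    by (auto simp: has_fourier_L2_def)
  show ?thesis
    by (rule L2_inner_eq_limit[OF h(1) f(1) h(3) fourier_L1_L2[OF h(2,1)] F h(4)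
          w(1) g(1) w(3) fourier_L1_L2[OF w(2,1)] G w(4) Parseval_L1_L2[OF h(2,1) w(2,1)]])
qed

section \<open>Fourier inversion\<close>

definition inv_fourier :: "(real ^ 'n \<Rightarrow> complex) \<Rightarrow> real ^ 'n \<Rightarrow> complex" where
  "inv_fourier U x = (LINT \<xi>|lborel. U \<xi> * cis (2 * pi * (x \<bullet> \<xi>)))"

lemma inv_fourier_eq: "inv_fourier U x = fourier_L1 U (- x)"
  by (simp add: inv_fourier_def fourier_L1_cis inner_commute)

lemma nn_integral_uminus:
  fixes f :: "'a::euclidean_space \<Rightarrow> ennreal"
  assumes [measurable]: "f \<in> borel_measurable borel"
  shows "(\<integral>\<^sup>+x. f (- x) \<partial>lborel) = (\<integral>\<^sup>+x. f x \<partial>lborel)"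
  by (subst (2) distr_reflect_lborel[symmetric, of 0], subst nn_integral_distr) auto

lemma L2_space_uminus:
  assumes "f \<in> L2_space" shows "(\<lambda>x. f (- x)) \<in> L2_space"
proof -
  have [measurable]: "f \<in> borel_measurable borel" using assms by auto
  then show ?thesis
    using assms nn_integral_uminus[of "\<lambda>x. ennreal ((cmod (f x))\<^sup>2)"] by (simp add: L2_space_iff_nn)
qed

lemma inv_fourier_L2:
  assumes "integrable lborel U" "U \<in> L2_space"
  shows "inv_fourier U \<in> L2_space"
  unfolding inv_fourier_eq[abs_def] by (intro L2_space_uminus fourier_L1_L2 assms)

lemma Parseval_inv_fourier:
  assumes U: "integrable lborel U" "U \<in> L2_space" and V: "integrable lborel V" "V \<in> L2_space"
  shows "L2_inner (inv_fourier U) (inv_fourier V) = L2_inner U V"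
proof -
  have [measurable]: "U \<in> borel_measurable borel" "V \<in> borel_measurable borel" using U V by auto
  have "L2_inner (inv_fourier U) (inv_fourier V) = L2_inner (fourier_L1 U) (fourier_L1 V)"
    unfolding L2_inner_def inv_fourier_eq
    using integral_reflect[of "\<lambda>x. fourier_L1 U x * cnj (fourier_L1 V x)" 0] by simp
  then show ?thesis by (simp add: Parseval_L1_L2 U V)
qed

lemma fourier_L1_cnj_uminus:
  assumes [measurable]: "k \<in> borel_measurable borel"
  shows "fourier_L1 (\<lambda>x. cnj (k (- x))) \<xi> = cnj (fourier_L1 k \<xi>)"
proof -
  have "fourier_L1 (\<lambda>x. cnj (k (- x))) \<xi> = (LINT x|lborel. cnj (k (0 - x)) * cis (2 * pi * ((0 - x) \<bullet> \<xi>)))"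
    by (simp add: fourier_L1_cis)
  also have "\<dots> = (LINT x|lborel. cnj (k x) * cis (2 * pi * (x \<bullet> \<xi>)))"
    by (rule integral_reflect) measurable
  also have "\<dots> = (LINT x|lborel. cnj (k x * cis (- (2 * pi * (x \<bullet> \<xi>)))))"
    by (simp add: cis_cnj)
  also have "\<dots> = cnj (fourier_L1 k \<xi>)"
    unfolding fourier_L1_cis by (rule Bochner_Integration.integral_cnj)
  finally show ?thesis .
qed

lemma integrable_cnj_uminus:
  fixes k :: "'a::euclidean_space \<Rightarrow> complex"
  shows "integrable lborel k \<Longrightarrow> integrable lborel (\<lambda>x. cnj (k (- x)))"
  using integrable_reflect[of k 0] by simp

text \<open>For integrable \<open>k\<close> this is the transposition rule, applied to the conjugate reflection of \<open>k\<close>. It is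
  the form of Parseval's identity in which only one factor needs an integrable transform.\<close>

lemma inv_fourier_inner:
  assumes U: "integrable lborel U" "U \<in> L2_space" and k: "k \<in> L2_space" "has_fourier_L2 k K"
  shows "L2_inner (inv_fourier U) k = L2_inner U K"
proof -
  have [measurable]: "U \<in> borel_measurable borel" using U by auto
  obtain w where K: "K \<in> L2_space" and w: "\<And>m::nat. w m \<in> L2_space" "\<And>m. integrable lborel (w m)"
      "L2_lim w k" "L2_lim (\<lambda>m. fourier_L1 (w m)) K"
    using k(2) by (auto simp: has_fourier_L2_def)
  have 1: "L2_inner U (fourier_L1 (w m)) = L2_inner (inv_fourier U) (w m)" for m
  proof -
    have [measurable]: "w m \<in> borel_measurable borel" using w(1)[of m] by auto
    have "L2_inner U (fourier_L1 (w m)) = (LINT x|lborel. U x * fourier_L1 (\<lambda>x. cnj (w m (- x))) x)"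
      unfolding L2_inner_def by (simp add: fourier_L1_cnj_uminus)
    also have "\<dots> = (LINT x|lborel. fourier_L1 U x * cnj (w m (- x)))"
      by (rule fourier_mult_formula[symmetric, OF U(1) integrable_cnj_uminus[OF w(2)]])
    also have "\<dots> = (LINT x|lborel. fourier_L1 U (- (0 - x)) * cnj (w m (0 - x)))" by simp
    also have "\<dots> = (LINT x|lborel. fourier_L1 U (- x) * cnj (w m x))"
      by (rule integral_reflect) measurable
    finally show ?thesis by (simp add: L2_inner_def inv_fourier_eq)
  qed
  show ?thesis
  proof (rule LIMSEQ_unique)
    show "(\<lambda>m. L2_inner (inv_fourier U) (w m)) \<longlonglongrightarrow> L2_inner (inv_fourier U) k"
      by (intro L2_inner_tendsto_right inv_fourier_L2 U k w)
    show "(\<lambda>m. L2_inner (inv_fourier U) (w m)) \<longlonglongrightarrow> L2_inner U K"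
      unfolding 1[symmetric]
      by (intro L2_inner_tendsto_right fourier_L1_L2 U K w)
  qed
qed

text \<open>The difference of both sides is orthogonal to itself: its inner product with each of the two
  functions is the inner product of \<open>F\<close> with its own transform.\<close>

lemma fourier_inversion_L2:
  assumes f: "f \<in> L2_space" "has_fourier_L2 f F" and F: "integrable lborel F"
  shows "AE x in lborel. f x = inv_fourier F x"
proof -
  have F2: "F \<in> L2_space" by (rule has_fourier_L2_space[OF f(2)])
  have [measurable]: "f \<in> borel_measurable borel" "F \<in> borel_measurable borel" using f F by auto
  define D where "D x = f x - inv_fourier F x" for x
  have D: "D \<in> L2_space" unfolding D_def[abs_def] by (intro L2_space_diff inv_fourier_L2 f F F2)
  have "L2_inner D D = L2_inner f D - L2_inner (inv_fourier F) D"
    unfolding L2_inner_def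
    by (subst Bochner_Integration.integral_diff[symmetric])
       (simp_all add: D L2_inner_integrable[OF _ D] inv_fourier_L2[OF F F2] f D_def[symmetric] flip: left_diff_distrib)
  also have "L2_inner (inv_fourier F) D = L2_inner F (fourier_L2 D)"
    by (intro inv_fourier_inner F F2 D has_fourier_fourier_L2)
  also have "\<dots> = L2_inner f D"
    by (intro Parseval_L2 f D has_fourier_fourier_L2)
  finally have "(LINT x|lborel. (cmod (D x))\<^sup>2) = 0"
    unfolding L2_inner_self by simp
  then have "AE x in lborel. (cmod (D x))\<^sup>2 = 0"
    by (subst (asm) integral_nonneg_eq_0_iff_AE) (auto simp: L2_space_integrable[OF D])
  then show ?thesis by eventually_elim (simp add: D_def)
qed

section \<open>The representation on the Fourier side\<close>

text \<open>The action of a dilation and a rotation on frequencies, \<open>\<xi> \<rightarrow> a r\<^sup>-\<^sup>1\<xi>\<close>. It is a right action: the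
  order of factors is reversed in \<open>dual_act_mult\<close>.\<close>

definition dual_act :: "real \<times> (real ^ 'n ^ 'n) \<Rightarrow> real ^ 'n \<Rightarrow> real ^ 'n" where
  "dual_act q \<xi> = fst q *\<^sub>R (matrix_inv (snd q) *v \<xi>)"

fun sim_rep_hat :: "'n::finite similitude \<Rightarrow> (real ^ 'n \<Rightarrow> complex) \<Rightarrow> real ^ 'n \<Rightarrow> complex" where
  "sim_rep_hat (a, r, t) F \<xi> =
     of_real (a powr (real CARD('n) / 2)) * cis (- (2 * pi * (t \<bullet> \<xi>))) * F (dual_act (a, r) \<xi>)"

lemma dual_act_measurable1[measurable]: "dual_act q \<in> borel_measurable borel"
  unfolding dual_act_def[abs_def]
  by (intro borel_measurable_continuous_onI continuous_intros bounded_linear.continuous_on[OF matrix_vector_mul_bounded_linear])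

lemma dual_act_similitude: "0 < a \<Longrightarrow> dual_act (a, r) \<xi> = matrix_inv r *v ((\<xi> - 0) /\<^sub>R (1 / a))"
  by (simp add: dual_act_def matrix_vector_mult_scaleR)

lemma nn_integral_dual_act:
  fixes r :: "real ^ 'n ^ 'n"
  assumes "0 < a" "r \<in> SO_group" "f \<in> borel_measurable borel"
  shows "ennreal (a ^ CARD('n)) * (\<integral>\<^sup>+\<xi>. f (dual_act (a, r) \<xi>) \<partial>lborel) = (\<integral>\<^sup>+\<xi>. f \<xi> \<partial>lborel)"
proof -
  have "(\<integral>\<^sup>+\<xi>. f (dual_act (a, r) \<xi>) \<partial>lborel) = ennreal ((1 / a) ^ CARD('n)) * (\<integral>\<^sup>+\<xi>. f \<xi> \<partial>lborel)"
    unfolding dual_act_similitude[OF assms(1)]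
    by (rule nn_integral_similitude) (use assms in auto)
  moreover have "ennreal (a ^ CARD('n)) * ennreal ((1 / a) ^ CARD('n)) = 1"
    using assms(1) by (simp add: ennreal_mult'[symmetric] power_mult_distrib[symmetric])
  ultimately show ?thesis by (simp add: mult.assoc[symmetric])
qed

lemma powr_half_sq: "0 < a \<Longrightarrow> (a powr (real n / 2))\<^sup>2 = a ^ n"
  by (simp add: power2_eq_square powr_add[symmetric] powr_realpow)

lemma powr_half_inv: "0 < a \<Longrightarrow> a powr (- (real n / 2)) * a ^ n = a powr (real n / 2)"
proof -
  assume "0 < a"
  then have "a powr (- (real n / 2)) * a ^ n = a powr (- (real n / 2)) * a powr (real n)"
    by (simp add: powr_realpow)
  also have "\<dots> = a powr (real n / 2)" by (simp add: powr_add[symmetric])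
  finally show ?thesis .
qed

lemma powr_half_inv_sq: "0 < a \<Longrightarrow> a ^ n * (a powr (- (real n / 2)))\<^sup>2 = 1"
  by (simp add: powr_minus power_inverse powr_half_sq)

lemma sim_rep_measurable1[measurable]:
  assumes [measurable]: "f \<in> borel_measurable borel"
  shows "sim_rep g f \<in> borel_measurable borel"
  by (cases g) (simp add: fun_eq_iff[symmetric] sim_rep.simps[abs_def])

lemma sim_rep_hat_measurable1[measurable]:
  assumes [measurable]: "F \<in> borel_measurable borel"
  shows "sim_rep_hat g F \<in> borel_measurable borel"
  by (cases g) (simp add: sim_rep_hat.simps[abs_def])

lemma sim_rep_hat_sim_rep:
  assumes "(a, r, t) \<in> similitude_group"
  shows "sim_rep_hat (a, r, t) F \<xi> = cis (- (2 * pi * (t \<bullet> \<xi>))) * sim_rep (1 / a, r, 0) F \<xi>"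
  using assms by (simp add: similitude_group_def dual_act_similitude powr_divide powr_minus_divide)

lemma nn_integral_sim_rep:
  assumes g: "g \<in> similitude_group" and [measurable]: "f \<in> borel_measurable borel"
  shows "(\<integral>\<^sup>+x. ennreal ((cmod (sim_rep g f x))\<^sup>2) \<partial>lborel) = (\<integral>\<^sup>+x. ennreal ((cmod (f x))\<^sup>2) \<partial>lborel)"
proof -
  obtain a r t where gt: "g = (a, r, t)" by (cases g)
  with g have a: "0 < a" "r \<in> SO_group" by (auto simp: similitude_group_def)
  let ?c = "a powr (- (real CARD('a) / 2))"
  have "(\<integral>\<^sup>+x. ennreal ((cmod (sim_rep g f x))\<^sup>2) \<partial>lborel) =
     (\<integral>\<^sup>+x. ennreal (?c\<^sup>2 * (cmod (f (sim_inv a r t x)))\<^sup>2) \<partial>lborel)"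
    unfolding gt by (simp add: norm_mult power_mult_distrib)
  also have "\<dots> = ennreal (a ^ CARD('a)) * (\<integral>\<^sup>+x. ennreal (?c\<^sup>2 * (cmod (f x))\<^sup>2) \<partial>lborel)"
    by (rule nn_integral_similitude[where f="\<lambda>x. ennreal (?c\<^sup>2 * (cmod (f x))\<^sup>2)", OF a]) measurable
  also have "\<dots> = ennreal (a ^ CARD('a) * ?c\<^sup>2) * (\<integral>\<^sup>+x. ennreal ((cmod (f x))\<^sup>2) \<partial>lborel)"
    using a by (simp add: ennreal_mult nn_integral_cmult mult.assoc)
  finally show ?thesis using a by (simp add: powr_half_inv_sq)
qed

lemma nn_integral_sim_rep_hat:
  assumes g: "g \<in> similitude_group" and F: "F \<in> borel_measurable borel"
  shows "(\<integral>\<^sup>+x. ennreal ((cmod (sim_rep_hat g F x))\<^sup>2) \<partial>lborel) = (\<integral>\<^sup>+x. ennreal ((cmod (F x))\<^sup>2) \<partial>lborel)"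
proof -
  obtain a r t where gt: "g = (a, r, t)" by (cases g)
  with g have "(1 / a, r, 0) \<in> similitude_group" by (auto simp: similitude_group_def)
  from nn_integral_sim_rep[OF this F] show ?thesis
    by (simp only: gt sim_rep_hat_sim_rep[OF g[unfolded gt]] norm_mult norm_cis mult_1_left)
qed

lemma sim_rep_diff: "sim_rep g (\<lambda>x. f x - h x) y = sim_rep g f y - sim_rep g h y"
  by (cases g) (simp add: algebra_simps)

lemma sim_rep_hat_diff: "sim_rep_hat g (\<lambda>x. f x - h x) y = sim_rep_hat g f y - sim_rep_hat g h y"
  by (cases g) (simp add: algebra_simps)

lemma L2_dist_sim_rep:
  assumes "g \<in> similitude_group" and [measurable]: "f \<in> borel_measurable borel" "h \<in> borel_measurable borel"
  shows "L2_dist_sq (sim_rep g f) (sim_rep g h) = L2_dist_sq f h"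
  unfolding L2_dist_sq_def sim_rep_diff[symmetric] by (rule nn_integral_sim_rep[OF assms(1)]) measurable

lemma L2_dist_sim_rep_hat:
  assumes "g \<in> similitude_group" and [measurable]: "f \<in> borel_measurable borel" "h \<in> borel_measurable borel"
  shows "L2_dist_sq (sim_rep_hat g f) (sim_rep_hat g h) = L2_dist_sq f h"
  unfolding L2_dist_sq_def sim_rep_hat_diff[symmetric] by (rule nn_integral_sim_rep_hat[OF assms(1)]) measurable

lemma sim_rep_L2: "g \<in> similitude_group \<Longrightarrow> f \<in> L2_space \<Longrightarrow> sim_rep g f \<in> L2_space"
  by (auto simp: L2_space_iff_nn nn_integral_sim_rep)

lemma sim_rep_hat_L2: "g \<in> similitude_group \<Longrightarrow> f \<in> L2_space \<Longrightarrow> sim_rep_hat g f \<in> L2_space"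
  by (auto simp: L2_space_iff_nn nn_integral_sim_rep_hat)

lemma fourier_L1_sim_rep:
  assumes g: "g \<in> similitude_group" and [measurable]: "f \<in> borel_measurable borel"
  shows "fourier_L1 (sim_rep g f) \<xi> = sim_rep_hat g (fourier_L1 f) \<xi>"
proof -
  obtain a r t where gt: "g = (a, r, t)" by (cases g)
  with g have a: "0 < a" "r \<in> SO_group" by (auto simp: similitude_group_def)
  let ?c = "a powr (- (real CARD('a) / 2))"
  define \<phi> where "\<phi> y = of_real ?c * f y * cis (- (2 * pi * ((t + a *\<^sub>R (r *v y)) \<bullet> \<xi>)))" for y
  have [measurable]: "\<phi> \<in> borel_measurable borel"
  proof -
    have [measurable]: "(\<lambda>y. r *v y) \<in> borel_measurable borel"
      by (intro borel_measurable_continuous_onI bounded_linear.continuous_on[OF matrix_vector_mul_bounded_linear] continuous_intros)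
    show ?thesis unfolding \<phi>_def[abs_def] by measurable
  qed
  have "fourier_L1 (sim_rep g f) \<xi> = (LINT x|lborel. \<phi> (sim_inv a r t x))"
    unfolding fourier_L1_cis gt \<phi>_def SO_group_cancel(4)[OF a(2)]
    using a by simp
  also have "\<dots> = a ^ CARD('a) *\<^sub>R (LINT y|lborel. \<phi> y)"
    by (rule integral_similitude[OF a]) measurable
  also have "(LINT y|lborel. \<phi> y) = (LINT y|lborel. (of_real ?c * cis (- (2 * pi * (t \<bullet> \<xi>)))) *
      (f y * cis (- (2 * pi * (y \<bullet> dual_act (a, r) \<xi>)))))"
  proof (rule Bochner_Integration.integral_cong[OF refl])
    fix y
    have "(t + a *\<^sub>R (r *v y)) \<bullet> \<xi> = t \<bullet> \<xi> + y \<bullet> dual_act (a, r) \<xi>"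
      using SO_group_inner[OF a(2), of \<xi> y]
      by (simp add: inner_add_left inner_add_right dual_act_def inner_commute)
    then have "cis (- (2 * pi * ((t + a *\<^sub>R (r *v y)) \<bullet> \<xi>))) =
       cis (- (2 * pi * (t \<bullet> \<xi>))) * cis (- (2 * pi * (y \<bullet> dual_act (a, r) \<xi>)))"
      by (simp add: cis_mult algebra_simps)
    then show "\<phi> y = (of_real ?c * cis (- (2 * pi * (t \<bullet> \<xi>)))) * (f y * cis (- (2 * pi * (y \<bullet> dual_act (a, r) \<xi>))))"
      by (simp add: \<phi>_def)
  qed
  also have "\<dots> = (of_real ?c * cis (- (2 * pi * (t \<bullet> \<xi>)))) * fourier_L1 f (dual_act (a, r) \<xi>)"
    unfolding fourier_L1_cis by (rule integral_mult_right_zero)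
  also have "a ^ CARD('a) *\<^sub>R \<dots> = of_real (?c * a ^ CARD('a)) * cis (- (2 * pi * (t \<bullet> \<xi>))) * fourier_L1 f (dual_act (a, r) \<xi>)"
    by (simp add: scaleR_conv_of_real)
  also have "?c * a ^ CARD('a) = a powr (real CARD('a) / 2)"
    by (rule powr_half_inv[OF a(1)])
  finally show ?thesis by (simp only: gt sim_rep_hat.simps)
qed

lemma sim_rep_integrable: "g \<in> similitude_group \<Longrightarrow> integrable lborel f \<Longrightarrow> integrable lborel (sim_rep g f)"
  by (cases g) (auto simp: sim_rep.simps[abs_def] similitude_group_def intro!: integrable_mult_right integrable_similitude)

lemma sim_rep_hat_integrable:
  assumes g: "(a, r, t) \<in> similitude_group" and F: "integrable lborel F"
  shows "integrable lborel (sim_rep_hat (a, r, t) F)"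
proof -
  have "(1 / a, r, 0) \<in> similitude_group" using g by (auto simp: similitude_group_def)
  from integrable_cis_mult[OF sim_rep_integrable[OF this F], of "\<lambda>\<xi>. - (2 * pi * (t \<bullet> \<xi>))"]
  show ?thesis
    unfolding sim_rep_hat_sim_rep[OF g, abs_def] by (simp only: mult.commute) simp
qed

lemma has_fourier_sim_rep:
  assumes g: "g \<in> similitude_group" and f: "f \<in> L2_space" "has_fourier_L2 f F"
  shows "has_fourier_L2 (sim_rep g f) (sim_rep_hat g F)"
proof -
  from f(2) obtain w where F: "F \<in> L2_space" and w: "\<And>k::nat. w k \<in> L2_space" "\<And>k. integrable lborel (w k)"
      "L2_lim w f" "L2_lim (\<lambda>k. fourier_L1 (w k)) F"
    by (auto simp: has_fourier_L2_def)
  have m: "w k \<in> borel_measurable borel" "f \<in> borel_measurable borel" "F \<in> borel_measurable borel" for k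
    using w(1)[of k] f F by auto
  have e: "fourier_L1 (sim_rep g (w k)) = sim_rep_hat g (fourier_L1 (w k))" for k
    using fourier_L1_sim_rep[OF g m(1)] by blast
  show ?thesis
    unfolding has_fourier_L2_def
  proof (intro conjI exI[of _ "\<lambda>k. sim_rep g (w k)"] allI)
    show "L2_lim (\<lambda>k. sim_rep g (w k)) (sim_rep g f)"
      using w(3) by (simp add: L2_dist_sim_rep g m)
    show "L2_lim (\<lambda>k. fourier_L1 (sim_rep g (w k))) (sim_rep_hat g F)"
      unfolding e using w(4) by (simp add: L2_dist_sim_rep_hat g m fourier_L1_measurable)
  qed (intro sim_rep_L2 sim_rep_hat_L2 sim_rep_integrable g w F)+
qed

text \<open>This lets a synthesis \<open>\<integral> c(t) (\<pi>(a, r, t) \<psi>)(x) dt\<close> be read as the inner product of \<open>c\<close> with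
  \<open>\<pi>(a, r, x)\<close> applied to the conjugate reflection of \<open>\<psi>\<close>.\<close>

lemma has_fourier_cnj_uminus:
  assumes f: "f \<in> L2_space" "has_fourier_L2 f F"
  shows "has_fourier_L2 (\<lambda>x. cnj (f (- x))) (\<lambda>\<xi>. cnj (F \<xi>))"
proof -
  from f(2) obtain w where F: "F \<in> L2_space" and w: "\<And>k::nat. w k \<in> L2_space" "\<And>k. integrable lborel (w k)"
      "L2_lim w f" "L2_lim (\<lambda>k. fourier_L1 (w k)) F"
    by (auto simp: has_fourier_L2_def)
  have m[measurable]: "w k \<in> borel_measurable borel" "f \<in> borel_measurable borel" "F \<in> borel_measurable borel" for k
    using w(1)[of k] f F by auto
  have nc: "cmod (cnj u - cnj v) = cmod (u - v)" for u v
    by (metis complex_cnj_diff complex_mod_cnj)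
  have d1: "L2_dist_sq (\<lambda>x. cnj (w k (- x))) (\<lambda>x. cnj (f (- x))) = L2_dist_sq (w k) f" for k
    unfolding L2_dist_sq_def nc by (rule nn_integral_uminus) measurable
  have d2: "L2_dist_sq (fourier_L1 (\<lambda>x. cnj (w k (- x)))) (\<lambda>\<xi>. cnj (F \<xi>)) = L2_dist_sq (fourier_L1 (w k)) F" for k
    by (simp add: L2_dist_sq_def fourier_L1_cnj_uminus nc)
  show ?thesis
    unfolding has_fourier_L2_def
  proof (intro conjI exI[of _ "\<lambda>k x. cnj (w k (- x))"] allI)
    show "integrable lborel (\<lambda>x. cnj (w k (- x)))" for k
      by (rule integrable_cnj_uminus[OF w(2)])
  qed (use w in \<open>simp_all add: d1 d2 L2_space_cnj F L2_space_uminus\<close>)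
qed

text \<open>The transform, in the translation parameter, of the wavelet coefficients at the scale and rotation
  \<open>q\<close>. As a product of two square integrable functions it is integrable; that it is square integrable
  for almost every \<open>q\<close> is a consequence of admissibility (\<open>voice_L2\<close>).\<close>

definition voice :: "(real ^ 'n \<Rightarrow> complex) \<Rightarrow> (real ^ 'n \<Rightarrow> complex) \<Rightarrow> real \<times> (real ^ 'n ^ 'n) \<Rightarrow> real ^ 'n \<Rightarrow> complex" where
  "voice H \<Psi> q \<xi> = of_real (fst q powr (real CARD('n) / 2)) * (H \<xi> * cnj (\<Psi> (dual_act q \<xi>)))"

lemma dual_act_L2:
  assumes q: "0 < fst q" "snd q \<in> SO_group" and F: "F \<in> L2_space"
  shows "(\<lambda>\<xi>. F (dual_act q \<xi>)) \<in> L2_space"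
proof -
  have [measurable]: "F \<in> borel_measurable borel" using F by auto
  have "(\<integral>\<^sup>+\<xi>. ennreal ((cmod (F (dual_act q \<xi>)))\<^sup>2) \<partial>lborel) < \<infinity>"
    using nn_integral_dual_act[OF q, of "\<lambda>x. ennreal ((cmod (F x))\<^sup>2)"] F q
    by (auto simp: L2_space_iff_nn less_top[symmetric] ennreal_mult_eq_top_iff)
  then show ?thesis by (simp add: L2_space_iff_nn)
qed

lemma voice_integrable:
  assumes q: "0 < fst q" "snd q \<in> SO_group" and H: "H \<in> L2_space" and P: "\<Psi> \<in> L2_space"
  shows "integrable lborel (voice H \<Psi> q)"
  unfolding voice_def[abs_def] by (intro integrable_mult_right L2_inner_integrable H dual_act_L2 q P)

lemma wavelet_transform_eq:
  assumes q: "0 < fst q" "snd q \<in> SO_group"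
    and h: "h \<in> L2_space" "has_fourier_L2 h H" and p: "\<psi> \<in> L2_space" "has_fourier_L2 \<psi> \<Psi>"
  shows "L2_inner h (sim_rep (fst q, snd q, t) \<psi>) = inv_fourier (voice H \<Psi> q) t"
proof -
  have g: "(fst q, snd q, t) \<in> similitude_group" using q by (simp add: similitude_group_def)
  have "L2_inner h (sim_rep (fst q, snd q, t) \<psi>) = L2_inner H (sim_rep_hat (fst q, snd q, t) \<Psi>)"
    by (rule Parseval_L2[symmetric, OF h sim_rep_L2[OF g p(1)] has_fourier_sim_rep[OF g p]])
  also have "\<dots> = inv_fourier (voice H \<Psi> q) t"
    unfolding L2_inner_def inv_fourier_def voice_def
    by (intro Bochner_Integration.integral_cong refl) (simp add: cis_cnj mult_ac)
  finally show ?thesis .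
qed

section \<open>Dilations and rotations\<close>

lemma similitude_matrix_measurable:
  fixes m :: "'a \<Rightarrow> real ^ 'n ^ 'n"
  assumes "m \<in> borel_measurable M" "v \<in> borel_measurable M"
  shows "(\<lambda>x. m x *v v x) \<in> borel_measurable M"
proof (rule borel_measurable_continuous_Pair[OF assms])
  show "continuous_on UNIV (\<lambda>x. fst x *v (snd x :: real ^ 'n))"
    unfolding matrix_vector_mult_def by (intro continuous_intros)
qed

locale haar_SO =
  fixes \<mu> :: "(real ^ 'n ^ 'n) measure"
  assumes haar: "normalized_haar_SO \<mu>"
begin

sublocale prob_space \<mu>
  using haar by (simp add: normalized_haar_SO_def)

lemma sets_mu: "sets \<mu> = sets (restrict_space borel SO_group)"
  using haar by (simp add: normalized_haar_SO_def)

lemma space_mu[simp]: "space \<mu> = SO_group"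
  using sets_eq_imp_space_eq[OF sets_mu] by (simp add: space_restrict_space)

lemma measurable_mu_id: "(\<lambda>r. r) \<in> \<mu> \<rightarrow>\<^sub>M borel"
  unfolding measurable_cong_sets[OF sets_mu refl] by (rule measurable_restrict_space1) simp

lemma measurable_mu_inv[measurable]: "matrix_inv \<in> \<mu> \<rightarrow>\<^sub>M borel"
proof -
  have "continuous_on UNIV (transpose :: real ^ 'n ^ 'n \<Rightarrow> real ^ 'n ^ 'n)"
    unfolding transpose_def by (intro continuous_intros)
  then have [measurable]: "(transpose :: real ^ 'n ^ 'n \<Rightarrow> real ^ 'n ^ 'n) \<in> borel_measurable borel"
    by (rule borel_measurable_continuous_onI)
  have "(\<lambda>r. transpose r) \<in> \<mu> \<rightarrow>\<^sub>M borel"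
    by (rule measurable_compose[OF measurable_mu_id]) measurable
  then show ?thesis
    by (subst measurable_cong[of _ _ transpose]) (auto simp: matrix_inv_SO)
qed

lemma measurable_mu_mult:
  assumes s: "s \<in> SO_group" shows "(**) s \<in> \<mu> \<rightarrow>\<^sub>M \<mu>"
proof -
  have "continuous_on UNIV (\<lambda>r. s ** r)"
    unfolding matrix_matrix_mult_def by (intro continuous_intros)
  then have m: "(**) s \<in> borel_measurable borel"
    by (rule borel_measurable_continuous_onI)
  have "(\<lambda>r. s ** r) \<in> \<mu> \<rightarrow>\<^sub>M restrict_space borel SO_group"
    by (rule measurable_restrict_space2)
       (use s measurable_compose[OF measurable_mu_id m] in \<open>auto intro: SO_group_mult\<close>)
  then show ?thesis by (simp add: measurable_cong_sets[OF refl sets_mu])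
qed

text \<open>Invariance is assumed for images of sets; the preimage under \<open>s\<close> is the image under its inverse.\<close>

lemma distr_mu:
  assumes s: "s \<in> SO_group" shows "distr \<mu> \<mu> ((**) s) = \<mu>"
proof (rule measure_eqI)
  fix B assume "B \<in> sets (distr \<mu> \<mu> ((**) s))"
  then have B: "B \<in> sets \<mu>" by simp
  have BS: "B \<subseteq> SO_group" using sets.sets_into_space[OF B] by simp
  have "(**) s -` B \<inter> space \<mu> = (\<lambda>r. matrix_inv s ** r) ` B"
  proof (intro set_eqI iffI)
    fix r assume r: "r \<in> (**) s -` B \<inter> space \<mu>"
    then have "r = matrix_inv s ** (s ** r)" by (simp add: matrix_mul_assoc SO_group_cancel s)
    with r show "r \<in> (\<lambda>r. matrix_inv s ** r) ` B" by auto
  next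
    fix r assume "r \<in> (\<lambda>r. matrix_inv s ** r) ` B"
    then obtain b where b: "b \<in> B" "r = matrix_inv s ** b" by auto
    then show "r \<in> (**) s -` B \<inter> space \<mu>"
      using BS s by (auto simp: matrix_mul_assoc SO_group_cancel intro!: SO_group_mult SO_group_inv)
  qed
  then show "emeasure (distr \<mu> \<mu> ((**) s)) B = emeasure \<mu> B"
    using haar SO_group_inv[OF s] B by (simp add: emeasure_distr measurable_mu_mult s normalized_haar_SO_def)
qed simp

text \<open>The Haar measure \<open>da d\<theta> / a\<close> of the group of dilations and rotations, against which all
  admissibility integrals are taken. The scale ranges over the whole line with density 0 on the
  nonpositive part, so that products with Lebesgue measure need no restricted spaces.\<close>

definition dilrot :: "(real \<times> (real ^ 'n ^ 'n)) measure" where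
  "dilrot = density (lborel \<Otimes>\<^sub>M \<mu>) (\<lambda>q. indicator {0<..} (fst q) * ennreal (1 / fst q))"

lemma sets_dilrot[simp, measurable_cong]: "sets dilrot = sets (borel \<Otimes>\<^sub>M \<mu>)"
  unfolding dilrot_def sets_density by (rule sets_pair_measure_cong) auto

lemma measurable_fst_dilrot[measurable]: "fst \<in> dilrot \<rightarrow>\<^sub>M borel"
  by (simp add: measurable_cong_sets[OF sets_dilrot refl])

lemma space_dilrot: "space dilrot = UNIV \<times> SO_group"
  by (simp add: dilrot_def space_pair_measure)

sublocale lm: pair_sigma_finite "lborel :: real measure" \<mu> ..

lemma dilrot_pos: "AE q in dilrot. 0 < fst q \<and> snd q \<in> SO_group"
proof -
  have 1: "AE q in dilrot. 0 < fst q"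
    unfolding dilrot_def by (subst AE_density) (auto simp: indicator_def split: if_splits)
  have 2: "AE q in dilrot. q \<in> space dilrot" by (rule AE_space)
  from 1 2 show ?thesis by eventually_elim (auto simp: space_dilrot)
qed

sublocale dilrot: sigma_finite_measure dilrot
  unfolding dilrot_def
  by (subst lm.sigma_finite_iff_density_finite) (auto simp: ennreal_mult_eq_top_iff indicator_def)

sublocale dl: pair_sigma_finite dilrot "lborel :: (real ^ 'n) measure" ..

lemma dilrot_pair_pos: "AE z in dilrot \<Otimes>\<^sub>M (lborel :: (real ^ 'n) measure). 0 < fst (fst z)"
proof (rule dl.AE_pair_measure)
  show "{z \<in> space (dilrot \<Otimes>\<^sub>M (lborel :: (real ^ 'n) measure)). 0 < fst (fst z)} \<in> sets (dilrot \<Otimes>\<^sub>M lborel)"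
    by measurable
  show "AE q in dilrot. AE \<xi> in lborel. 0 < fst (fst (q, \<xi> :: real ^ 'n))"
    using dilrot_pos by eventually_elim simp
qed

lemma nn_integral_dilrot:
  assumes [measurable]: "f \<in> borel_measurable (borel \<Otimes>\<^sub>M \<mu>)"
  shows "(\<integral>\<^sup>+q. f q \<partial>dilrot) = (\<integral>\<^sup>+a. (\<integral>\<^sup>+r. indicator {0<..} a * ennreal (1 / a) * f (a, r) \<partial>\<mu>) \<partial>lborel)"
  unfolding dilrot_def
  by (subst nn_integral_density) (auto simp: nn_integral_fst[symmetric])

lemma measurable_dual_act[measurable]:
  assumes [measurable]: "f \<in> M \<rightarrow>\<^sub>M dilrot" "v \<in> borel_measurable M"
  shows "(\<lambda>x. dual_act (f x) (v x)) \<in> borel_measurable M"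
proof -
  have [measurable]: "f \<in> M \<rightarrow>\<^sub>M borel \<Otimes>\<^sub>M \<mu>"
    using assms(1) by (simp add: measurable_cong_sets[OF refl sets_dilrot])
  have 1: "(\<lambda>x. matrix_inv (snd (f x)) *v v x) \<in> borel_measurable M"
    by (rule similitude_matrix_measurable) measurable
  show ?thesis unfolding dual_act_def using 1 by measurable
qed

definition dilrot_mult :: "real \<times> (real ^ 'n ^ 'n) \<Rightarrow> real \<times> (real ^ 'n ^ 'n) \<Rightarrow> real \<times> (real ^ 'n ^ 'n)" where
  "dilrot_mult p q = (fst p * fst q, snd p ** snd q)"

lemma measurable_dilrot_mult:
  assumes "snd p \<in> SO_group" shows "dilrot_mult p \<in> dilrot \<rightarrow>\<^sub>M dilrot"
proof -
  have [measurable]: "(**) (snd p) \<in> \<mu> \<rightarrow>\<^sub>M \<mu>" by (rule measurable_mu_mult[OF assms])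
  show ?thesis unfolding dilrot_mult_def[abs_def] by measurable
qed

text \<open>The substitution \<open>a \<rightarrow> b a\<close> leaves \<open>da / a\<close> unchanged, and \<open>r \<rightarrow> s r\<close> leaves the Haar measure of the
  rotations unchanged.\<close>

lemma dilrot_left_invariant:
  assumes p: "0 < fst p" "snd p \<in> SO_group"
  shows "distr dilrot dilrot (dilrot_mult p) = dilrot"
proof (rule measure_eqI)
  fix B assume "B \<in> sets (distr dilrot dilrot (dilrot_mult p))"
  then have B[measurable]: "B \<in> sets (borel \<Otimes>\<^sub>M \<mu>)" by simp
  have [measurable]: "(**) (snd p) \<in> \<mu> \<rightarrow>\<^sub>M \<mu>" by (rule measurable_mu_mult[OF p(2)])
  have [measurable]: "dilrot_mult p \<in> dilrot \<rightarrow>\<^sub>M dilrot" by (rule measurable_dilrot_mult[OF p(2)])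
  let ?b = "fst p"
  let ?w = "\<lambda>a. indicator {0<..} a * ennreal (1 / a)"
  let ?N = "\<lambda>a. \<integral>\<^sup>+r. indicator B (a, r) \<partial>\<mu>"
  have "emeasure (distr dilrot dilrot (dilrot_mult p)) B = (\<integral>\<^sup>+q. indicator B q \<partial>distr dilrot dilrot (dilrot_mult p))"
    by (subst nn_integral_indicator) auto
  also have "\<dots> = (\<integral>\<^sup>+q. indicator B (dilrot_mult p q) \<partial>dilrot)"
    by (rule nn_integral_distr) auto
  also have "\<dots> = (\<integral>\<^sup>+a. (\<integral>\<^sup>+r. ?w a * indicator B (?b * a, snd p ** r) \<partial>\<mu>) \<partial>lborel)"
    by (subst nn_integral_dilrot) (auto simp: dilrot_mult_def)
  also have "\<dots> = (\<integral>\<^sup>+a. ?w a * ?N (?b * a) \<partial>lborel)"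
  proof (rule nn_integral_cong)
    fix a :: real
    have "(\<integral>\<^sup>+r. indicator B (?b * a, snd p ** r) \<partial>\<mu>) = (\<integral>\<^sup>+r. indicator B (?b * a, r) \<partial>distr \<mu> \<mu> ((**) (snd p)))"
      by (subst nn_integral_distr) auto
    also have "\<dots> = ?N (?b * a)" by (simp only: distr_mu[OF p(2)])
    finally show "(\<integral>\<^sup>+r. ?w a * indicator B (?b * a, snd p ** r) \<partial>\<mu>) =
      ?w a * ?N (?b * a)"
      by (subst nn_integral_cmult) auto
  qed
  also have "\<dots> = (\<integral>\<^sup>+a. ennreal ?b * (?w (0 + ?b * a) * ?N (0 + ?b * a)) \<partial>lborel)"
  proof (rule nn_integral_cong)
    fix a :: real
    show "?w a * ?N (?b * a) =
      ennreal ?b * (?w (0 + ?b * a) * ?N (0 + ?b * a))"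
    proof (cases "0 < a")
      case True
      then have "ennreal (1 / a) = ennreal ?b * ennreal (1 / (?b * a))"
        using p by (simp add: ennreal_mult'[symmetric])
      with True p show ?thesis by (simp add: mult_ac)
    next
      case False
      then show ?thesis using p by (simp add: zero_less_mult_iff)
    qed
  qed
  also have "\<dots> = (\<integral>\<^sup>+a. ?w a * ?N a \<partial>lborel)"
    using p by (subst (2) nn_integral_real_affine[where c="?b" and t=0]) (auto simp: nn_integral_cmult)
  also have "\<dots> = (\<integral>\<^sup>+a. (\<integral>\<^sup>+r. ?w a * indicator B (a, r) \<partial>\<mu>) \<partial>lborel)"
    by (intro nn_integral_cong nn_integral_cmult[symmetric]) measurable
  also have "\<dots> = (\<integral>\<^sup>+q. indicator B q \<partial>dilrot)"
    by (subst nn_integral_dilrot) auto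
  also have "\<dots> = emeasure dilrot B" by simp
  finally show "emeasure (distr dilrot dilrot (dilrot_mult p)) B = emeasure dilrot B" .
qed simp

lemma nn_integral_dilrot_mult:
  assumes p: "0 < fst p" "snd p \<in> SO_group" and [measurable]: "f \<in> borel_measurable dilrot"
  shows "(\<integral>\<^sup>+q. f (dilrot_mult p q) \<partial>dilrot) = (\<integral>\<^sup>+q. f q \<partial>dilrot)"
proof -
  have "(\<integral>\<^sup>+q. f (dilrot_mult p q) \<partial>dilrot) = (\<integral>\<^sup>+q. f q \<partial>distr dilrot dilrot (dilrot_mult p))"
    by (rule nn_integral_distr[symmetric]) (auto intro: measurable_dilrot_mult p)
  then show ?thesis by (simp only: dilrot_left_invariant[OF p])
qed

lemma integral_dilrot_mult:
  fixes f :: "_ \<Rightarrow> 'b :: {banach, second_countable_topology}"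
  assumes p: "0 < fst p" "snd p \<in> SO_group" and [measurable]: "f \<in> borel_measurable dilrot"
  shows "(LINT q|dilrot. f (dilrot_mult p q)) = (LINT q|dilrot. f q)"
proof -
  have "(LINT q|dilrot. f (dilrot_mult p q)) = (LINT q|distr dilrot dilrot (dilrot_mult p). f q)"
    by (rule integral_distr[symmetric]) (auto intro: measurable_dilrot_mult p)
  then show ?thesis by (simp only: dilrot_left_invariant[OF p])
qed

lemma dual_act_mult:
  assumes "snd p \<in> SO_group" "snd q \<in> SO_group"
  shows "dual_act (dilrot_mult p q) \<xi> = dual_act q (dual_act p \<xi>)"
proof -
  have "matrix_inv (snd p ** snd q) = matrix_inv (snd q) ** matrix_inv (snd p)"
    using assms by (simp add: matrix_inv_SO SO_group_mult matrix_transpose_mul)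
  then show ?thesis
    by (simp add: dual_act_def dilrot_mult_def matrix_vector_mult_scaleR matrix_vector_mul_assoc mult.commute)
qed

lemma integral_dual_act_invariant:
  fixes \<phi> :: "real ^ 'n \<Rightarrow> 'b :: {banach, second_countable_topology}"
  assumes p: "0 < fst p" "snd p \<in> SO_group" and [measurable]: "\<phi> \<in> borel_measurable borel"
  shows "(LINT q|dilrot. \<phi> (dual_act q (dual_act p \<xi>))) = (LINT q|dilrot. \<phi> (dual_act q \<xi>))"
proof -
  have "(LINT q|dilrot. \<phi> (dual_act q (dual_act p \<xi>))) = (LINT q|dilrot. \<phi> (dual_act (dilrot_mult p q) \<xi>))"
    by (intro Bochner_Integration.integral_cong refl) (auto simp: space_dilrot dual_act_mult p)
  also have "\<dots> = (LINT q|dilrot. \<phi> (dual_act q \<xi>))"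
    by (rule integral_dilrot_mult[OF p, where f="\<lambda>q. \<phi> (dual_act q \<xi>)"]) measurable
  finally show ?thesis .
qed

end

text \<open>A dilation matches the lengths and a rotation the directions. In dimension 1 the rotation group is
  trivial and cannot exchange the two half lines; this is where the bound on the dimension enters.\<close>

lemma dual_act_transitive:
  fixes \<xi> \<zeta> :: "real ^ 'n"
  assumes "CARD('n) \<ge> 2" "\<xi> \<noteq> 0" "\<zeta> \<noteq> 0"
  obtains p where "0 < fst p" "snd p \<in> SO_group" "dual_act p \<xi> = \<zeta>"
proof -
  define b where "b = norm \<zeta> / norm \<xi>"
  have b: "0 < b" using assms by (simp add: b_def)
  obtain f where f: "orthogonal_transformation f" "det (matrix f) = 1" "f (b *\<^sub>R \<xi>) = \<zeta>"
    using rotation_exists[OF assms(1), of "b *\<^sub>R \<xi>" \<zeta>] assms b by (auto simp: b_def)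
  let ?r = "matrix f"
  have r: "?r \<in> SO_group"
    using f by (simp add: SO_group_def rotation_matrix_def orthogonal_transformation_matrix)
  have i: "matrix_inv (matrix_inv ?r) = ?r"
    using r SO_group_inv[OF r] by (simp add: matrix_inv_SO)
  have "dual_act (b, matrix_inv ?r) \<xi> = ?r *v (b *\<^sub>R \<xi>)"
    by (simp add: dual_act_def i matrix_vector_mult_scaleR)
  also have "\<dots> = \<zeta>"
    using f matrix_works[of f] by (simp add: orthogonal_transformation_linear linear_linear)
  finally show thesis
    using that[of "(b, matrix_inv ?r)"] b SO_group_inv[OF r] by simp
qed

section \<open>Admissibility integrals\<close>

text \<open>The integrand, on the Fourier side, of the admissibility constant of a pair.\<close>

definition cross :: "(real ^ 'n \<Rightarrow> complex) \<Rightarrow> (real ^ 'n \<Rightarrow> complex) \<Rightarrow> real \<times> (real ^ 'n ^ 'n) \<Rightarrow> real ^ 'n \<Rightarrow> complex" where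
  "cross \<Psi>1 \<Psi>2 q \<xi> = cnj (\<Psi>1 (dual_act q \<xi>)) * \<Psi>2 (dual_act q \<xi>)"

lemma prod_norm_le_sum: "cmod (a * b) \<le> (cmod a)\<^sup>2 + (cmod b)\<^sup>2"
proof -
  have "((cmod a)\<^sup>2 + (cmod b)\<^sup>2) / 2 \<le> (cmod a)\<^sup>2 + (cmod b)\<^sup>2" by simp
  with prod_norm_le show ?thesis by (rule order_trans)
qed

context haar_SO
begin

abbreviation adm_integral :: "(real ^ 'n \<Rightarrow> complex) \<Rightarrow> real ^ 'n \<Rightarrow> ennreal" where
  "adm_integral \<Psi> \<xi> \<equiv> \<integral>\<^sup>+q. ennreal ((cmod (\<Psi> (dual_act q \<xi>)))\<^sup>2) \<partial>dilrot"

abbreviation voice_mass :: "(real ^ 'n \<Rightarrow> complex) \<Rightarrow> (real ^ 'n \<Rightarrow> complex) \<Rightarrow> real \<times> (real ^ 'n ^ 'n) \<Rightarrow> ennreal" where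
  "voice_mass H \<Psi> q \<equiv> \<integral>\<^sup>+\<xi>. ennreal ((cmod (H \<xi>))\<^sup>2) * ennreal ((cmod (\<Psi> (dual_act q \<xi>)))\<^sup>2) \<partial>lborel"

lemma C_adm_dilrot:
  assumes [measurable]: "fourier_L2 \<psi> \<in> borel_measurable borel"
  shows "C_adm \<mu> \<psi> \<xi> = adm_integral (fourier_L2 \<psi>) \<xi>"
proof -
  have m: "(\<lambda>q. ennreal ((cmod (fourier_L2 \<psi> (dual_act q \<xi>)))\<^sup>2)) \<in> borel_measurable dilrot"
    by measurable
  then have "(\<lambda>q. ennreal ((cmod (fourier_L2 \<psi> (dual_act q \<xi>)))\<^sup>2)) \<in> borel_measurable (borel \<Otimes>\<^sub>M \<mu>)"
    by (simp add: measurable_cong_sets[OF sets_dilrot refl])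
  from nn_integral_dilrot[OF this] show ?thesis
    unfolding C_adm_def
    by (auto simp: dual_act_def indicator_def ennreal_mult'[symmetric] intro!: nn_integral_cong)
qed

text \<open>An essentially bounded admissibility integral: this is what makes the integrals over the group
  converge.\<close>

definition finite_adm :: "(real ^ 'n \<Rightarrow> complex) \<Rightarrow> bool" where
  "finite_adm \<Psi> \<longleftrightarrow> \<Psi> \<in> L2_space \<and>
     (\<exists>C<\<infinity>. AE \<xi> in lborel. adm_integral \<Psi> \<xi> \<le> C)"

lemma admissible_finite_adm:
  assumes "admissible \<mu> \<psi>"
  shows "finite_adm (fourier_L2 \<psi>)"
proof -
  have l: "fourier_L2 \<psi> \<in> L2_space"
    using assms by (auto simp: admissible_def intro: has_fourier_L2_space has_fourier_fourier_L2)
  then have [measurable]: "fourier_L2 \<psi> \<in> borel_measurable borel" by auto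
  from assms obtain C where C: "C < \<infinity>" "AE \<xi> in lborel. C_adm \<mu> \<psi> \<xi> = C"
    by (auto simp: admissible_def)
  have "AE \<xi> in lborel. adm_integral (fourier_L2 \<psi>) \<xi> \<le> C"
    using C(2) by eventually_elim (simp add: C_adm_dilrot)
  with C(1) l show ?thesis by (auto simp: finite_adm_def)
qed

text \<open>Integrating over \<open>q\<close> first replaces the factor with \<open>\<Psi>\<close> by a bounded admissibility integral. Read in the
  other order, this is the square integrability of the wavelet coefficients on the group.\<close>

lemma finite_adm_energy:
  assumes P: "finite_adm \<Psi>" and H: "H \<in> L2_space"
  shows "(\<integral>\<^sup>+q. voice_mass H \<Psi> q \<partial>dilrot) < \<infinity>"
proof -
  from P obtain C where C: "C < \<infinity>"
    "AE \<xi> in lborel. adm_integral \<Psi> \<xi> \<le> C"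
    by (auto simp: finite_adm_def)
  have [measurable]: "\<Psi> \<in> borel_measurable borel" "H \<in> borel_measurable borel"
    using P H by (auto simp: finite_adm_def)
  have "(\<integral>\<^sup>+q. voice_mass H \<Psi> q \<partial>dilrot) =
     (\<integral>\<^sup>+\<xi>. (\<integral>\<^sup>+q. ennreal ((cmod (H \<xi>))\<^sup>2) * ennreal ((cmod (\<Psi> (dual_act q \<xi>)))\<^sup>2) \<partial>dilrot) \<partial>lborel)"
    by (rule dl.Fubini'[symmetric]) measurable
  also have "\<dots> = (\<integral>\<^sup>+\<xi>. ennreal ((cmod (H \<xi>))\<^sup>2) * adm_integral \<Psi> \<xi> \<partial>lborel)"
    by (intro nn_integral_cong nn_integral_cmult) measurable
  also have "\<dots> \<le> (\<integral>\<^sup>+\<xi>. ennreal ((cmod (H \<xi>))\<^sup>2) * C \<partial>lborel)"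
    by (rule nn_integral_mono_AE) (use C(2) in eventually_elim, intro mult_left_mono, auto)
  also have "\<dots> = (\<integral>\<^sup>+\<xi>. ennreal ((cmod (H \<xi>))\<^sup>2) \<partial>lborel) * C"
    by (rule nn_integral_multc) measurable
  also have "\<dots> < \<infinity>"
    using C(1) H by (simp add: L2_space_iff_nn ennreal_mult_less_top)
  finally show ?thesis .
qed

lemma voice_energy:
  fixes H \<Psi> :: "real ^ 'n \<Rightarrow> complex"
  assumes q: "0 < fst q" "snd q \<in> SO_group" and [measurable]: "\<Psi> \<in> borel_measurable borel" "H \<in> borel_measurable borel"
  shows "(\<integral>\<^sup>+\<xi>. ennreal ((cmod (voice H \<Psi> q \<xi>))\<^sup>2) \<partial>lborel) = ennreal (fst q ^ CARD('n)) *
     voice_mass H \<Psi> q"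
  using q by (simp add: voice_def norm_mult power_mult_distrib powr_half_sq ennreal_mult nn_integral_cmult)

lemma voice_measurable[measurable]:
  assumes [measurable]: "\<Psi> \<in> borel_measurable borel" "H \<in> borel_measurable borel"
  shows "voice H \<Psi> q \<in> borel_measurable borel"
  unfolding voice_def[abs_def] by measurable

lemma voice_L2:
  assumes P: "finite_adm \<Psi>" and H: "H \<in> L2_space"
  shows "AE q in dilrot. voice H \<Psi> q \<in> L2_space"
proof -
  have [measurable]: "\<Psi> \<in> borel_measurable borel" "H \<in> borel_measurable borel"
    using P H by (auto simp: finite_adm_def)
  have "AE q in dilrot. voice_mass H \<Psi> q \<noteq> \<infinity>"
    by (rule nn_integral_PInf_AE) (use finite_adm_energy[OF P H] in auto)
  with dilrot_pos show ?thesis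
    by eventually_elim
       (auto simp: L2_space_iff_nn voice_energy ennreal_mult_less_top ennreal_mult_eq_top_iff less_top[symmetric])
qed

lemma cross_measurable[measurable]:
  assumes [measurable]: "\<Psi>1 \<in> borel_measurable borel" "\<Psi>2 \<in> borel_measurable borel"
    "f \<in> M \<rightarrow>\<^sub>M dilrot" "v \<in> borel_measurable M"
  shows "(\<lambda>x. cross \<Psi>1 \<Psi>2 (f x) (v x)) \<in> borel_measurable M"
  unfolding cross_def by measurable

end

locale wavelet_pair = haar_SO \<mu> for \<mu> :: "(real ^ 'n ^ 'n) measure" +
  fixes \<Psi>1 \<Psi>2 :: "real ^ 'n \<Rightarrow> complex"
  assumes dim: "CARD('n) \<ge> 2" and adm1: "finite_adm \<Psi>1" and adm2: "finite_adm \<Psi>2"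
begin

abbreviation "cross12 \<equiv> cross \<Psi>1 \<Psi>2"

abbreviation pairing :: "(real ^ 'n \<Rightarrow> complex) \<Rightarrow> real \<times> (real ^ 'n ^ 'n) \<Rightarrow> complex" where
  "pairing V q \<equiv> LINT \<xi>|lborel. V \<xi> * cross12 q \<xi>"

lemma L2_P: "\<Psi>1 \<in> L2_space" "\<Psi>2 \<in> L2_space"
  using adm1 adm2 by (auto simp: finite_adm_def)

lemma measurable_P[measurable]: "\<Psi>1 \<in> borel_measurable borel" "\<Psi>2 \<in> borel_measurable borel"
  using L2_P by auto

lemma cross_bound:
  obtains C where "C < \<infinity>" "AE \<xi> in lborel. (\<integral>\<^sup>+q. ennreal (cmod (cross12 q \<xi>)) \<partial>dilrot) \<le> C"
proof -
  from adm1 obtain C1 where C1: "C1 < \<infinity>"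
    "AE \<xi> in lborel. adm_integral \<Psi>1 \<xi> \<le> C1"
    by (auto simp: finite_adm_def)
  from adm2 obtain C2 where C2: "C2 < \<infinity>"
    "AE \<xi> in lborel. adm_integral \<Psi>2 \<xi> \<le> C2"
    by (auto simp: finite_adm_def)
  show thesis
  proof
    show "C1 + C2 < \<infinity>" using C1 C2 by simp
    show "AE \<xi> in lborel. (\<integral>\<^sup>+q. ennreal (cmod (cross12 q \<xi>)) \<partial>dilrot) \<le> C1 + C2"
      using C1(2) C2(2)
    proof eventually_elim
      case (elim \<xi>)
      have "(\<integral>\<^sup>+q. ennreal (cmod (cross12 q \<xi>)) \<partial>dilrot) \<le>
        (\<integral>\<^sup>+q. ennreal ((cmod (\<Psi>1 (dual_act q \<xi>)))\<^sup>2) + ennreal ((cmod (\<Psi>2 (dual_act q \<xi>)))\<^sup>2) \<partial>dilrot)"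
      proof (rule nn_integral_mono)
        fix q
        have "cmod (cross12 q \<xi>) \<le> (cmod (\<Psi>1 (dual_act q \<xi>)))\<^sup>2 + (cmod (\<Psi>2 (dual_act q \<xi>)))\<^sup>2"
          using prod_norm_le_sum[of "cnj (\<Psi>1 (dual_act q \<xi>))" "\<Psi>2 (dual_act q \<xi>)"] by (simp add: cross_def)
        from ennreal_leI[OF this] show "ennreal (cmod (cross12 q \<xi>)) \<le> ennreal ((cmod (\<Psi>1 (dual_act q \<xi>)))\<^sup>2) + ennreal ((cmod (\<Psi>2 (dual_act q \<xi>)))\<^sup>2)"
          by simp
      qed
      also have "\<dots> = adm_integral \<Psi>1 \<xi> + adm_integral \<Psi>2 \<xi>"
        by (rule nn_integral_add) measurable
      also have "\<dots> \<le> C1 + C2" by (intro add_mono elim)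
      finally show ?case .
    qed
  qed
qed

lemma cross_total_finite:
  assumes V: "integrable lborel (V :: real ^ 'n \<Rightarrow> complex)"
  shows "(\<integral>\<^sup>+z. ennreal (cmod (V (snd z)) * cmod (cross12 (fst z) (snd z))) \<partial>(dilrot \<Otimes>\<^sub>M lborel)) < \<infinity>"
proof -
  have [measurable]: "V \<in> borel_measurable borel" using V by auto
  obtain C where C: "C < \<infinity>" "AE \<xi> in lborel. (\<integral>\<^sup>+q. ennreal (cmod (cross12 q \<xi>)) \<partial>dilrot) \<le> C"
    by (rule cross_bound)
  have "(\<integral>\<^sup>+z. ennreal (cmod (V (snd z)) * cmod (cross12 (fst z) (snd z))) \<partial>(dilrot \<Otimes>\<^sub>M lborel)) =
     (\<integral>\<^sup>+\<xi>. (\<integral>\<^sup>+q. ennreal (cmod (V \<xi>)) * ennreal (cmod (cross12 q \<xi>)) \<partial>dilrot) \<partial>lborel)"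
    by (subst dl.nn_integral_snd[symmetric]) (auto simp: ennreal_mult)
  also have "\<dots> = (\<integral>\<^sup>+\<xi>. ennreal (cmod (V \<xi>)) * (\<integral>\<^sup>+q. ennreal (cmod (cross12 q \<xi>)) \<partial>dilrot) \<partial>lborel)"
    by (intro nn_integral_cong nn_integral_cmult) measurable
  also have "\<dots> \<le> (\<integral>\<^sup>+\<xi>. ennreal (cmod (V \<xi>)) * C \<partial>lborel)"
    by (rule nn_integral_mono_AE) (use C(2) in eventually_elim, intro mult_left_mono, auto)
  also have "\<dots> = (\<integral>\<^sup>+\<xi>. ennreal (cmod (V \<xi>)) \<partial>lborel) * C"
    by (rule nn_integral_multc) measurable
  also have "\<dots> < \<infinity>"
    using C(1) V by (simp add: integrable_iff_bounded ennreal_mult_less_top)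
  finally show ?thesis .
qed

lemma cross_prod_integrable:
  assumes V: "integrable lborel (V :: real ^ 'n \<Rightarrow> complex)"
  shows "integrable (dilrot \<Otimes>\<^sub>M lborel) (\<lambda>(q, \<xi>). V \<xi> * cross12 q \<xi>)"
proof (rule integrableI_bounded)
  have [measurable]: "V \<in> borel_measurable borel" using V by auto
  show "(\<lambda>(q, \<xi>). V \<xi> * cross12 q \<xi>) \<in> borel_measurable (dilrot \<Otimes>\<^sub>M lborel)" by measurable
  show "(\<integral>\<^sup>+z. ennreal (norm (case z of (q, \<xi>) \<Rightarrow> V \<xi> * cross12 q \<xi>)) \<partial>(dilrot \<Otimes>\<^sub>M lborel)) < \<infinity>"
    using cross_total_finite[OF V] by (simp add: case_prod_unfold norm_mult)
qed

lemma cross_integrable: "AE \<xi> in lborel. integrable dilrot (\<lambda>q. cross12 q \<xi>)"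
proof -
  obtain C where C: "C < \<infinity>" "AE \<xi> in lborel. (\<integral>\<^sup>+q. ennreal (cmod (cross12 q \<xi>)) \<partial>dilrot) \<le> C"
    by (rule cross_bound)
  from C(2) show ?thesis
  proof eventually_elim
    case (elim \<xi>)
    show ?case by (rule integrableI_bounded) (use elim C(1) in \<open>auto intro: le_less_trans\<close>)
  qed
qed

text \<open>The admissibility integral of the pair at one nonzero frequency, the vector with all entries 1;
  \<open>cross_integral_const\<close> shows that any other would do.\<close>

definition C_cross :: complex where
  "C_cross = (LINT q|dilrot. cross12 q 1)"

text \<open>The substitution \<open>q \<rightarrow> p q\<close>, which preserves the measure, moves the frequency by \<open>p\<close>, and every
  nonzero frequency is reached in this way.\<close>

lemma cross_integral_const:
  assumes "\<xi> \<noteq> 0" shows "(LINT q|dilrot. cross12 q \<xi>) = C_cross"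
proof -
  have "(1 :: real ^ 'n) \<noteq> 0" by (simp add: vec_eq_iff)
  from dual_act_transitive[OF dim this assms]
  obtain p where p: "0 < fst p" "snd p \<in> SO_group" "dual_act p 1 = \<xi>" .
  show ?thesis
    unfolding C_cross_def cross_def
    using integral_dual_act_invariant[OF p(1,2), of "\<lambda>v. cnj (\<Psi>1 v) * \<Psi>2 v" 1] by (simp add: p(3))
qed

lemma AE_nonzero: "AE \<xi> in (lborel :: (real ^ 'n) measure). \<xi> \<noteq> 0"
  by (rule AE_lborel_singleton)

definition C_part :: "real set \<Rightarrow> real ^ 'n \<Rightarrow> complex" where
  "C_part S \<xi> = (LINT q|dilrot. indicator S (fst q) *\<^sub>R cross12 q \<xi>)"

definition C_tail :: "real set \<Rightarrow> real ^ 'n \<Rightarrow> ennreal" where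
  "C_tail S \<xi> = (\<integral>\<^sup>+q. indicator (- S) (fst q) * ennreal (cmod (cross12 q \<xi>)) \<partial>dilrot)"

lemma C_tail_bound:
  assumes [measurable]: "S \<in> sets borel"
  shows "AE \<xi> in lborel. ennreal (cmod (C_cross - C_part S \<xi>)) \<le> C_tail S \<xi>"
  using cross_integrable AE_nonzero
proof eventually_elim
  case (elim \<xi>)
  have iS: "integrable dilrot (\<lambda>q. indicator T (fst q) *\<^sub>R cross12 q \<xi>)" if [measurable]: "T \<in> sets borel" for T :: "real set"
    by (rule Bochner_Integration.integrable_bound[OF elim(1)]) (auto simp: indicator_def)
  have "C_cross - C_part S \<xi> = (LINT q|dilrot. cross12 q \<xi> - indicator S (fst q) *\<^sub>R cross12 q \<xi>)"
    unfolding C_part_def cross_integral_const[OF elim(2), symmetric]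
    by (rule Bochner_Integration.integral_diff[symmetric, OF elim(1) iS[OF assms]])
  also have "\<dots> = (LINT q|dilrot. indicator (- S) (fst q) *\<^sub>R cross12 q \<xi>)"
    by (intro Bochner_Integration.integral_cong refl) (auto simp: indicator_def)
  finally have "ennreal (cmod (C_cross - C_part S \<xi>)) \<le> (\<integral>\<^sup>+q. ennreal (cmod (indicator (- S) (fst q) *\<^sub>R cross12 q \<xi>)) \<partial>dilrot)"
    using integral_norm_bound_ennreal[OF iS[of "- S"]] by simp
  also have "\<dots> = C_tail S \<xi>"
    unfolding C_tail_def by (intro nn_integral_cong) (auto simp: indicator_def)
  finally show ?case .
qed

lemma C_tail_mono: "S \<subseteq> T \<Longrightarrow> C_tail T \<xi> \<le> C_tail S \<xi>"
  unfolding C_tail_def by (intro nn_integral_mono mult_right_mono) (auto simp: indicator_def)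

text \<open>Acting on the frequency is the same as multiplying the window by the dilation factor. This is why
  the windows of the theorem scale with \<open>a\<close>.\<close>

lemma C_tail_dual_act:
  assumes p: "0 < fst p" "snd p \<in> SO_group"
  shows "C_tail {u..v} (dual_act p \<xi>) = C_tail {u * fst p..v * fst p} \<xi>"
proof -
  have "C_tail {u..v} (dual_act p \<xi>) =
    (\<integral>\<^sup>+q. indicator (- {u * fst p..v * fst p}) (fst (dilrot_mult p q)) * ennreal (cmod (cross12 (dilrot_mult p q) \<xi>)) \<partial>dilrot)"
    unfolding C_tail_def
  proof (rule nn_integral_cong)
    fix q assume "q \<in> space dilrot"
    then have q: "snd q \<in> SO_group" by (auto simp: space_dilrot)
    have "cross12 q (dual_act p \<xi>) = cross12 (dilrot_mult p q) \<xi>"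
      by (simp add: cross_def dual_act_mult[OF p(2) q])
    moreover have "indicator (- {u..v}) (fst q) = (indicator (- {u * fst p..v * fst p}) (fst (dilrot_mult p q)) :: ennreal)"
      using p(1) by (auto simp: indicator_def dilrot_mult_def mult.commute)
    ultimately show "indicator (- {u..v}) (fst q) * ennreal (cmod (cross12 q (dual_act p \<xi>))) =
       indicator (- {u * fst p..v * fst p}) (fst (dilrot_mult p q)) * ennreal (cmod (cross12 (dilrot_mult p q) \<xi>))"
      by simp
  qed
  also have "\<dots> = C_tail {u * fst p..v * fst p} \<xi>"
    unfolding C_tail_def
    by (rule nn_integral_dilrot_mult[OF p, where f="\<lambda>q. indicator (- {u * fst p..v * fst p}) (fst q) * ennreal (cmod (cross12 q \<xi>))"]) measurable
  finally show ?thesis .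
qed

lemma C_tail_measurable[measurable]:
  assumes [measurable]: "S \<in> sets borel" shows "C_tail S \<in> borel_measurable borel"
  unfolding C_tail_def[abs_def] by measurable

text \<open>The windows exhaust the positive scales, and the integrand over \<open>q\<close> and \<open>\<xi>\<close> is dominated by
  \<open>|F| |cross|\<close>, whose integral is finite because the inner integral over \<open>q\<close> is essentially bounded.\<close>

lemma C_tail_limit:
  assumes F: "integrable lborel F"
  shows "(\<lambda>k. \<integral>\<^sup>+\<xi>. ennreal (cmod (F \<xi>)) * C_tail {1 / real (k + 2)..real (k + 2)} \<xi> \<partial>lborel) \<longlonglongrightarrow> 0"
proof -
  have [measurable]: "F \<in> borel_measurable borel" using F by auto
  define S where "S k = {1 / real (k + 2)..real (k + 2)}" for k
  have [measurable]: "S k \<in> sets borel" for k by (simp add: S_def)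
  let ?D = "dilrot \<Otimes>\<^sub>M (lborel :: (real ^ 'n) measure)"
  let ?w = "\<lambda>z. ennreal (cmod (F (snd z)) * cmod (cross12 (fst z) (snd z)))"
  have eq: "(\<integral>\<^sup>+\<xi>. ennreal (cmod (F \<xi>)) * C_tail (S k) \<xi> \<partial>lborel) =
     (\<integral>\<^sup>+z. indicator (- S k) (fst (fst z)) * ?w z \<partial>?D)" for k
  proof -
    have "(\<integral>\<^sup>+\<xi>. ennreal (cmod (F \<xi>)) * C_tail (S k) \<xi> \<partial>lborel) =
       (\<integral>\<^sup>+\<xi>. (\<integral>\<^sup>+q. indicator (- S k) (fst q) * ennreal (cmod (F \<xi>) * cmod (cross12 q \<xi>)) \<partial>dilrot) \<partial>lborel)"
      unfolding C_tail_def
      by (intro nn_integral_cong, subst nn_integral_cmult[symmetric]) (auto simp: ennreal_mult mult_ac)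
    also have "\<dots> = (\<integral>\<^sup>+z. indicator (- S k) (fst (fst z)) * ?w z \<partial>?D)"
      by (subst dl.nn_integral_snd[symmetric]) auto
    finally show ?thesis .
  qed
  have "(\<lambda>k. \<integral>\<^sup>+z. indicator (- S k) (fst (fst z)) * ?w z \<partial>?D) \<longlonglongrightarrow> (\<integral>\<^sup>+z. 0 \<partial>?D)"
  proof (rule nn_integral_dominated_convergence[where w="?w"])
    show "(\<integral>\<^sup>+z. ?w z \<partial>?D) < \<infinity>" by (rule cross_total_finite[OF F])
    show "AE z in ?D. indicator (- S k) (fst (fst z)) * ?w z \<le> ?w z" for k
      by (auto simp: indicator_def)
    show "AE z in ?D. (\<lambda>k. indicator (- S k) (fst (fst z)) * ?w z) \<longlonglongrightarrow> 0"
      using dilrot_pair_pos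
    proof eventually_elim
      case (elim z)
      obtain N where N: "max (fst (fst z)) (1 / fst (fst z)) \<le> real N" using real_arch_simple by blast
      have "\<forall>\<^sub>F k in sequentially. indicator (- S k) (fst (fst z)) * ?w z = 0"
        unfolding eventually_sequentially
      proof (intro exI[of _ N] allI impI)
        fix k assume "N \<le> k"
        then have k: "fst (fst z) \<le> real (k + 2)" "1 / fst (fst z) \<le> real (k + 2)" using N by auto
        then have "1 / real (k + 2) \<le> fst (fst z)" using elim by (simp add: field_simps)
        with k show "indicator (- S k) (fst (fst z)) * ?w z = 0" by (simp add: S_def)
      qed
      then show ?case by (rule tendsto_eventually)
    qed
  qed measurable
  then show ?thesis unfolding eq[symmetric] by (simp add: S_def)
qed

lemma C_part_Fubini:
  assumes V: "integrable lborel V" and [measurable]: "S \<in> sets borel"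
  shows "integrable dilrot (\<lambda>q. indicator S (fst q) *\<^sub>R pairing V q)"
    and "integrable lborel (\<lambda>\<xi>. V \<xi> * C_part S \<xi>)"
    and "(LINT q|dilrot. indicator S (fst q) *\<^sub>R pairing V q) = (LINT \<xi>|lborel. V \<xi> * C_part S \<xi>)"
proof -
  have [measurable]: "V \<in> borel_measurable borel" using V by auto
  let ?h = "\<lambda>q \<xi>. indicator S (fst q) *\<^sub>R (V \<xi> * cross12 q \<xi>)"
  have i: "integrable (dilrot \<Otimes>\<^sub>M lborel) (case_prod ?h)"
    by (rule Bochner_Integration.integrable_bound[OF cross_prod_integrable[OF V]])
       (auto simp: indicator_def)
  have e1: "(LINT \<xi>|lborel. ?h q \<xi>) = indicator S (fst q) *\<^sub>R pairing V q" for q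
    by simp
  have e2: "(LINT q|dilrot. ?h q \<xi>) = V \<xi> * C_part S \<xi>" for \<xi>
    unfolding C_part_def integral_mult_right_zero[symmetric] by (simp add: mult_ac)
  show "integrable dilrot (\<lambda>q. indicator S (fst q) *\<^sub>R pairing V q)"
    using dl.integrable_fst[OF i] unfolding e1 .
  show "integrable lborel (\<lambda>\<xi>. V \<xi> * C_part S \<xi>)"
    using dl.integrable_snd[OF i] unfolding e2 .
  show "(LINT q|dilrot. indicator S (fst q) *\<^sub>R pairing V q) = (LINT \<xi>|lborel. V \<xi> * C_part S \<xi>)"
    using dl.Fubini_integral[OF i] unfolding e1 e2 by (rule sym)
qed

end

section \<open>The constant of the pair\<close>

lemma nn_integral_inv_fourier:
  assumes "integrable lborel U" "U \<in> L2_space"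
  shows "(\<integral>\<^sup>+x. ennreal ((cmod (inv_fourier U x))\<^sup>2) \<partial>lborel) = (\<integral>\<^sup>+x. ennreal ((cmod (U x))\<^sup>2) \<partial>lborel)"
  using Parseval_inv_fourier[OF assms assms] L2_nn[OF inv_fourier_L2[OF assms]] L2_nn[OF assms(2)]
  unfolding L2_inner_self by (simp only: of_real_eq_iff)

context haar_SO
begin

lemma measurable_assoc_haar:
  "(\<lambda>(a, r, t). ((a, r), t)) \<in> similitude_haar \<mu> \<rightarrow>\<^sub>M dilrot \<Otimes>\<^sub>M (lborel :: (real ^ 'n) measure)"
proof -
  let ?M = "restrict_space (lborel :: real measure) {0<..} \<Otimes>\<^sub>M (\<mu> \<Otimes>\<^sub>M (lborel :: (real ^ 'n) measure))"
  have id: "(\<lambda>a. a) \<in> restrict_space lborel {0<..} \<rightarrow>\<^sub>M (borel :: real measure)"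
    by (rule measurable_restrict_space1) simp
  have "fst \<in> ?M \<rightarrow>\<^sub>M restrict_space lborel {0<..}" by (rule measurable_fst)
  from measurable_compose[OF this id] have [measurable]: "fst \<in> ?M \<rightarrow>\<^sub>M borel" .
  have m: "(\<lambda>(a, r, t). ((a, r), t)) \<in> ?M \<rightarrow>\<^sub>M (borel \<Otimes>\<^sub>M \<mu>) \<Otimes>\<^sub>M borel"
    unfolding case_prod_unfold by measurable
  have sN: "sets (dilrot \<Otimes>\<^sub>M (lborel :: (real ^ 'n) measure)) = sets ((borel \<Otimes>\<^sub>M \<mu>) \<Otimes>\<^sub>M borel)"
    by (intro sets_pair_measure_cong) auto
  show ?thesis
    unfolding similitude_haar_def measurable_cong_sets[OF sets_density sN] by (rule m)
qed

text \<open>Splitting \<open>1 / a\<^bsup>n+1\<^esup>\<close> as \<open>1 / a\<close> times \<open>1 / a\<^sup>n\<close>: the first factor belongs to the measure on dilations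
  and rotations, the second cancels the factor \<open>a\<^sup>n\<close> that Parseval's identity in the translation variable produces.\<close>

lemma similitude_haar_dilrot:
  "distr (similitude_haar \<mu>) (dilrot \<Otimes>\<^sub>M lborel) (\<lambda>(a, r, t). ((a, r), t)) =
    density (dilrot \<Otimes>\<^sub>M lborel) (\<lambda>z. ennreal (1 / fst (fst z) ^ CARD('n)))"
proof (rule measure_eqI)
  let ?N = "dilrot \<Otimes>\<^sub>M (lborel :: (real ^ 'n) measure)"
  let ?M = "restrict_space (lborel :: real measure) {0<..} \<Otimes>\<^sub>M (\<mu> \<Otimes>\<^sub>M (lborel :: (real ^ 'n) measure))"
  let ?\<iota> = "\<lambda>(a :: real, r, t). ((a, r), t)"
  fix B :: "((real \<times> (real ^ 'n ^ 'n)) \<times> (real ^ 'n)) set"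
  let ?P = "\<lambda>a r. \<integral>\<^sup>+t. ennreal (1 / a ^ (CARD('n) + 1)) * indicator B ((a, r), t) \<partial>lborel"
  let ?Q = "\<lambda>a r. \<integral>\<^sup>+t. ennreal (1 / a ^ CARD('n)) * indicator B ((a, r), t) \<partial>lborel"
  let ?O = "\<lambda>a. \<integral>\<^sup>+y. ennreal (1 / a ^ (CARD('n) + 1)) * indicator B ((a, fst y), snd y) \<partial>(\<mu> \<Otimes>\<^sub>M lborel)"
  let ?D = "density ?N (\<lambda>z. ennreal (1 / fst (fst z) ^ CARD('n)))"
  assume "B \<in> sets (distr (similitude_haar \<mu>) ?N ?\<iota>)"
  then have B[measurable]: "B \<in> sets ?N" by simp
  interpret ml: pair_sigma_finite \<mu> "lborel :: (real ^ 'n) measure" ..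
  have id[measurable]: "(\<lambda>a. a) \<in> restrict_space lborel {0<..} \<rightarrow>\<^sub>M (borel :: real measure)"
    by (rule measurable_restrict_space1) simp
  have sN: "sets ?N = sets ((borel \<Otimes>\<^sub>M \<mu>) \<Otimes>\<^sub>M borel)"
    by (intro sets_pair_measure_cong) auto
  have \<iota>H: "?\<iota> \<in> similitude_haar \<mu> \<rightarrow>\<^sub>M ?N" by (rule measurable_assoc_haar)
  then have \<iota>N[measurable]: "?\<iota> \<in> ?M \<rightarrow>\<^sub>M ?N" by (simp add: similitude_haar_def)
  have w[measurable]: "(\<lambda>(a, r, t). ennreal (1 / a ^ (CARD('n) + 1))) \<in> borel_measurable ?M"
  proof -
    have "fst \<in> ?M \<rightarrow>\<^sub>M restrict_space lborel {0<..}" by (rule measurable_fst)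
    from measurable_compose[OF this id] have [measurable]: "fst \<in> ?M \<rightarrow>\<^sub>M borel" .
    show ?thesis unfolding case_prod_unfold by measurable
  qed
  have B2[measurable]: "B \<in> sets ((borel \<Otimes>\<^sub>M \<mu>) \<Otimes>\<^sub>M borel)" using B by (simp add: sN)
  have "emeasure (distr (similitude_haar \<mu>) ?N ?\<iota>) B = (\<integral>\<^sup>+z. indicator B z \<partial>distr (similitude_haar \<mu>) ?N ?\<iota>)"
    by simp
  also have "\<dots> = (\<integral>\<^sup>+g. indicator B (?\<iota> g) \<partial>similitude_haar \<mu>)"
    by (rule nn_integral_distr[OF \<iota>H]) measurable
  also have "\<dots> = (\<integral>\<^sup>+g. (case g of (a, r, t) \<Rightarrow> ennreal (1 / a ^ (CARD('n) + 1))) * indicator B (?\<iota> g) \<partial>?M)"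
    unfolding similitude_haar_def by (rule nn_integral_density[OF w]) measurable
  also have "\<dots> = (\<integral>\<^sup>+a. ?O a \<partial>restrict_space lborel {0<..})"
    by (subst ml.P.nn_integral_fst[symmetric]) (auto simp: case_prod_unfold)
  also have "\<dots> = (\<integral>\<^sup>+a. ?O a * indicator {0<..} a \<partial>lborel)"
    by (rule nn_integral_restrict_space) simp
  also have "\<dots> = (\<integral>\<^sup>+a. (\<integral>\<^sup>+r. ?P a r \<partial>\<mu>) * indicator {0<..} a \<partial>lborel)"
    by (subst lborel.nn_integral_fst[symmetric]) auto
  also have "\<dots> = (\<integral>\<^sup>+a. (\<integral>\<^sup>+r. indicator {0<..} a * ennreal (1 / a) * ?Q a r \<partial>\<mu>) \<partial>lborel)"
  proof (rule nn_integral_cong)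
    fix a :: real
    show "(\<integral>\<^sup>+r. ?P a r \<partial>\<mu>) * indicator {0<..} a =
      (\<integral>\<^sup>+r. indicator {0<..} a * ennreal (1 / a) * ?Q a r \<partial>\<mu>)"
    proof (cases "0 < a")
      case True
      then have "ennreal (1 / a ^ (CARD('n) + 1)) = ennreal (1 / a) * ennreal (1 / a ^ CARD('n))"
        by (simp add: ennreal_mult'[symmetric])
      then have "?P a r =
         ennreal (1 / a) * ?Q a r" if "r \<in> SO_group" for r
        using that by (subst nn_integral_cmult[symmetric]) (auto simp: mult.assoc)
      then show ?thesis using True by (auto intro!: nn_integral_cong)
    qed simp
  qed
  also have "\<dots> = (\<integral>\<^sup>+q. (\<integral>\<^sup>+t. ennreal (1 / fst q ^ CARD('n)) * indicator B (q, t) \<partial>lborel) \<partial>dilrot)"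
    by (subst nn_integral_dilrot) auto
  also have "\<dots> = (\<integral>\<^sup>+z. ennreal (1 / fst (fst z) ^ CARD('n)) * indicator B z \<partial>?N)"
    by (subst lborel.nn_integral_fst[symmetric]) auto
  also have "\<dots> = emeasure ?D B"
    by (subst emeasure_density) auto
  finally show "emeasure (distr (similitude_haar \<mu>) ?N ?\<iota>) B =
    emeasure ?D B" .
qed simp

end

context haar_SO
begin

lemma sim_rep_measurable[measurable]:
  fixes \<psi> :: "real ^ 'n \<Rightarrow> complex"
  assumes [measurable]: "\<psi> \<in> borel_measurable borel" "f \<in> M \<rightarrow>\<^sub>M dilrot" "t \<in> borel_measurable M" "y \<in> borel_measurable M"
  shows "(\<lambda>x. sim_rep (fst (f x), snd (f x), t x) \<psi> (y x)) \<in> borel_measurable M"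
proof -
  have [measurable]: "f \<in> M \<rightarrow>\<^sub>M borel \<Otimes>\<^sub>M \<mu>"
    using assms(2) by (simp add: measurable_cong_sets[OF refl sets_dilrot])
  have 1: "(\<lambda>x. matrix_inv (snd (f x)) *v ((y x - t x) /\<^sub>R fst (f x))) \<in> borel_measurable M"
    by (rule similitude_matrix_measurable) measurable
  from measurable_compose[OF 1 assms(1)] show ?thesis
    unfolding sim_rep.simps by measurable
qed

lemma wavelet_measurable[measurable]:
  fixes \<psi> :: "real ^ 'n \<Rightarrow> complex"
  assumes [measurable]: "\<psi> \<in> borel_measurable borel" "h \<in> borel_measurable borel"
    "f \<in> M \<rightarrow>\<^sub>M dilrot" "t \<in> borel_measurable M"
  shows "(\<lambda>x. L2_inner h (sim_rep (fst (f x), snd (f x), t x) \<psi>)) \<in> borel_measurable M"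
  unfolding L2_inner_def by measurable

end

locale wavelet_transform_pair = wavelet_pair \<mu> \<Psi>1 \<Psi>2
  for \<mu> :: "(real ^ 'n ^ 'n) measure" and \<Psi>1 \<Psi>2 :: "real ^ 'n \<Rightarrow> complex" +
  fixes \<psi>1 \<psi>2 :: "real ^ 'n \<Rightarrow> complex"
  assumes psi1: "\<psi>1 \<in> L2_space" "has_fourier_L2 \<psi>1 \<Psi>1"
    and psi2: "\<psi>2 \<in> L2_space" "has_fourier_L2 \<psi>2 \<Psi>2"
begin

lemma measurable_psi[measurable]: "\<psi>1 \<in> borel_measurable borel" "\<psi>2 \<in> borel_measurable borel"
  using psi1 psi2 by auto

definition coeff :: "real \<times> (real ^ 'n ^ 'n) \<Rightarrow> real ^ 'n \<Rightarrow> complex" where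
  "coeff q t = L2_inner \<psi>1 (sim_rep (fst q, snd q, t) \<psi>1) * cnj (L2_inner \<psi>2 (sim_rep (fst q, snd q, t) \<psi>2))"

lemma coeff_measurable[measurable]:
  assumes [measurable]: "f \<in> M \<rightarrow>\<^sub>M dilrot" "t \<in> borel_measurable M"
  shows "(\<lambda>x. coeff (f x) (t x)) \<in> borel_measurable M"
  unfolding coeff_def by measurable

lemma wavelet_energy:
  fixes \<psi> \<Psi> :: "real ^ 'n \<Rightarrow> complex"
  assumes q: "0 < fst q" "snd q \<in> SO_group" and p: "\<psi> \<in> L2_space" "has_fourier_L2 \<psi> \<Psi>"
    and v: "voice \<Psi> \<Psi> q \<in> L2_space"
  shows "ennreal (1 / fst q ^ CARD('n)) * (\<integral>\<^sup>+t. ennreal ((cmod (L2_inner \<psi> (sim_rep (fst q, snd q, t) \<psi>)))\<^sup>2) \<partial>lborel) =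
    voice_mass \<Psi> \<Psi> q"
proof -
  have P: "\<Psi> \<in> L2_space" by (rule has_fourier_L2_space[OF p(2)])
  then have m: "\<Psi> \<in> borel_measurable borel" by auto
  have "ennreal (1 / fst q ^ CARD('n)) * ennreal (fst q ^ CARD('n)) = 1"
    using q by (simp add: ennreal_mult'[symmetric])
  then show ?thesis
    unfolding wavelet_transform_eq[OF q p p] nn_integral_inv_fourier[OF voice_integrable[OF q P P] v]
      voice_energy[OF q m m] mult.assoc[symmetric] by simp
qed

text \<open>Each of the two coefficient functions is square integrable on the group, by Plancherel's theorem in
  the translation variable.\<close>

lemma coeff_integrable:
  "integrable (dilrot \<Otimes>\<^sub>M lborel) (\<lambda>z. (1 / fst (fst z) ^ CARD('n)) *\<^sub>R coeff (fst z) (snd z))"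
proof (rule integrableI_bounded)
  show "(\<lambda>z. (1 / fst (fst z) ^ CARD('n)) *\<^sub>R coeff (fst z) (snd z)) \<in> borel_measurable (dilrot \<Otimes>\<^sub>M lborel)"
    by measurable
  let ?c = "\<lambda>q t. norm ((1 / fst q ^ CARD('n)) *\<^sub>R coeff q t)"
  let ?E = "\<lambda>\<Psi>. voice_mass \<Psi> \<Psi>"
  have "(\<integral>\<^sup>+z. ennreal (norm ((1 / fst (fst z) ^ CARD('n)) *\<^sub>R coeff (fst z) (snd z))) \<partial>(dilrot \<Otimes>\<^sub>M lborel)) =
     (\<integral>\<^sup>+q. (\<integral>\<^sup>+t. ennreal (?c q t) \<partial>lborel) \<partial>dilrot)"
    by (subst lborel.nn_integral_fst[symmetric]) auto
  also have "\<dots> \<le> (\<integral>\<^sup>+q. ?E \<Psi>1 q + ?E \<Psi>2 q \<partial>dilrot)"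
  proof (rule nn_integral_mono_AE)
    show "AE q in dilrot. (\<integral>\<^sup>+t. ennreal (?c q t) \<partial>lborel) \<le> ?E \<Psi>1 q + ?E \<Psi>2 q"
      using dilrot_pos voice_L2[OF adm1 L2_P(1)] voice_L2[OF adm2 L2_P(2)] AE_space
    proof eventually_elim
      case (elim q)
      then have q: "0 < fst q" "snd q \<in> SO_group" and sq: "q \<in> space dilrot" by auto
      let ?w = "ennreal (1 / fst q ^ CARD('n))"
      let ?W = "\<lambda>\<psi> t. L2_inner \<psi> (sim_rep (fst q, snd q, t) \<psi>)"
      let ?s = "\<lambda>\<psi> t. ennreal ((cmod (?W \<psi> t))\<^sup>2)"
      have [measurable]: "?W \<psi>1 \<in> borel_measurable borel" "?W \<psi>2 \<in> borel_measurable borel"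
        using sq by (auto intro!: wavelet_measurable[where f="\<lambda>_. q"])
      have "(\<integral>\<^sup>+t. ennreal (?c q t) \<partial>lborel) \<le>
        (\<integral>\<^sup>+t. ?w * ?s \<psi>1 t + ?w * ?s \<psi>2 t \<partial>lborel)"
      proof (rule nn_integral_mono)
        fix t
        have "?c q t = (1 / fst q ^ CARD('n)) * cmod (?W \<psi>1 t * cnj (?W \<psi>2 t))"
          using q by (simp add: coeff_def)
        also have "\<dots> \<le> (1 / fst q ^ CARD('n)) * ((cmod (?W \<psi>1 t))\<^sup>2 + (cmod (cnj (?W \<psi>2 t)))\<^sup>2)"
          using q by (intro mult_left_mono prod_norm_le_sum) auto
        also have "\<dots> = (1 / fst q ^ CARD('n)) * (cmod (?W \<psi>1 t))\<^sup>2 + (1 / fst q ^ CARD('n)) * (cmod (?W \<psi>2 t))\<^sup>2"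
          by (simp add: distrib_left add_divide_distrib)
        finally have le: "?c q t \<le> \<dots>" .
        have nn: "0 \<le> 1 / fst q ^ CARD('n)" using q by simp
        from ennreal_leI[OF le]
        show "ennreal (?c q t) \<le>
          ?w * ?s \<psi>1 t + ?w * ?s \<psi>2 t"
          unfolding ennreal_mult[OF nn zero_le_power2, symmetric]
          by (subst ennreal_plus[symmetric]) (use nn in auto)
      qed
      also have "\<dots> = ?w * (\<integral>\<^sup>+t. ?s \<psi>1 t \<partial>lborel) + ?w * (\<integral>\<^sup>+t. ?s \<psi>2 t \<partial>lborel)"
        by (simp add: nn_integral_add nn_integral_cmult)
      also have "\<dots> = ?E \<Psi>1 q + ?E \<Psi>2 q"
        using elim by (simp only: wavelet_energy[OF q psi1] wavelet_energy[OF q psi2])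
      finally show ?case .
    qed
  qed
  also have "\<dots> = (\<integral>\<^sup>+q. ?E \<Psi>1 q \<partial>dilrot) + (\<integral>\<^sup>+q. ?E \<Psi>2 q \<partial>dilrot)"
    by (rule nn_integral_add) measurable
  also have "\<dots> < \<infinity>"
    using finite_adm_energy[OF adm1 L2_P(1)] finite_adm_energy[OF adm2 L2_P(2)] by simp
  finally show "(\<integral>\<^sup>+z. ennreal (norm ((1 / fst (fst z) ^ CARD('n)) *\<^sub>R coeff (fst z) (snd z))) \<partial>(dilrot \<Otimes>\<^sub>M lborel)) < \<infinity>" .
qed

lemma C_part_UNIV: "AE \<xi> in lborel. C_part UNIV \<xi> = C_cross"
  using AE_nonzero by eventually_elim (simp add: C_part_def cross_integral_const)

text \<open>Over the translations, Parseval's identity turns the two coefficient functions into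
  \<open>\<Psi>1(\<xi>) cnj \<Psi>2(\<xi>)\<close> times \<open>cross\<close>; over \<open>q\<close>, the latter integrates to the constant, and
  \<open>\<langle>\<Psi>1, \<Psi>2\<rangle> = \<langle>\<psi>1, \<psi>2\<rangle>\<close> cancels the normalization.\<close>

lemma C_pair_eq:
  assumes "L2_inner \<psi>1 \<psi>2 \<noteq> 0"
  shows "C_pair \<mu> \<psi>1 \<psi>2 = C_cross"
proof -
  let ?N = "dilrot \<Otimes>\<^sub>M (lborel :: (real ^ 'n) measure)"
  let ?\<iota> = "\<lambda>(a, r, t). ((a, r), t)"
  let ?w = "\<lambda>z. 1 / fst (fst z) ^ CARD('n)"
  define V where "V \<xi> = \<Psi>1 \<xi> * cnj (\<Psi>2 \<xi>)" for \<xi>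
  have V: "integrable lborel V" unfolding V_def[abs_def] by (rule L2_inner_integrable[OF L2_P])
  have [measurable]: "V \<in> borel_measurable borel" using V by auto
  have "(LINT g|similitude_haar \<mu>. L2_inner \<psi>1 (sim_rep g \<psi>1) * cnj (L2_inner \<psi>2 (sim_rep g \<psi>2))) =
     (LINT g|similitude_haar \<mu>. coeff (fst (?\<iota> g)) (snd (?\<iota> g)))"
    by (intro Bochner_Integration.integral_cong refl) (auto simp: coeff_def)
  also have "\<dots> = (LINT z|distr (similitude_haar \<mu>) ?N ?\<iota>. coeff (fst z) (snd z))"
    by (rule integral_distr[symmetric, OF measurable_assoc_haar]) measurable
  also have "\<dots> = (LINT z|density ?N (\<lambda>z. ennreal (?w z)). coeff (fst z) (snd z))"
    by (simp only: similitude_haar_dilrot)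
  also have "\<dots> = (LINT z|?N. ?w z *\<^sub>R coeff (fst z) (snd z))"
  proof (rule integral_density)
    show "AE z in ?N. 0 \<le> ?w z" using dilrot_pair_pos by eventually_elim simp
  qed measurable
  also have "\<dots> = (LINT q|dilrot. LINT t|lborel. (1 / fst q ^ CARD('n)) *\<^sub>R coeff q t)"
    using dl.integral_fst'[OF coeff_integrable] by simp
  also have "\<dots> = (LINT q|dilrot. indicator UNIV (fst q) *\<^sub>R pairing V q)"
  proof (rule integral_cong_AE)
    show "(\<lambda>q. LINT t|lborel. (1 / fst q ^ CARD('n)) *\<^sub>R coeff q t) \<in> borel_measurable dilrot" by measurable
    show "(\<lambda>q. indicator UNIV (fst q) *\<^sub>R pairing V q) \<in> borel_measurable dilrot" by measurable
    show "AE q in dilrot. (LINT t|lborel. (1 / fst q ^ CARD('n)) *\<^sub>R coeff q t) =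
       indicator UNIV (fst q) *\<^sub>R pairing V q"
      using dilrot_pos voice_L2[OF adm1 L2_P(1)] voice_L2[OF adm2 L2_P(2)]
    proof eventually_elim
      case (elim q)
      then have q: "0 < fst q" "snd q \<in> SO_group" by auto
      have "(LINT t|lborel. (1 / fst q ^ CARD('n)) *\<^sub>R coeff q t) =
         (1 / fst q ^ CARD('n)) *\<^sub>R L2_inner (inv_fourier (voice \<Psi>1 \<Psi>1 q)) (inv_fourier (voice \<Psi>2 \<Psi>2 q))"
        unfolding coeff_def wavelet_transform_eq[OF q psi1 psi1] wavelet_transform_eq[OF q psi2 psi2]
          L2_inner_def[of "inv_fourier (voice \<Psi>1 \<Psi>1 q)"]
        by (rule integral_scaleR_right)
      also have "L2_inner (inv_fourier (voice \<Psi>1 \<Psi>1 q)) (inv_fourier (voice \<Psi>2 \<Psi>2 q)) = L2_inner (voice \<Psi>1 \<Psi>1 q) (voice \<Psi>2 \<Psi>2 q)"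
        by (intro Parseval_inv_fourier voice_integrable q L2_P elim)
      also have "\<dots> = (LINT \<xi>|lborel. of_real (fst q ^ CARD('n)) * (V \<xi> * cross12 q \<xi>))"
        unfolding L2_inner_def powr_half_sq[OF q(1), symmetric]
        by (intro Bochner_Integration.integral_cong refl)
           (simp add: voice_def V_def cross_def power2_eq_square mult_ac)
      also have "\<dots> = of_real (fst q ^ CARD('n)) * pairing V q"
        by (rule integral_mult_right_zero)
      finally show ?case using q by (simp add: scaleR_conv_of_real)
    qed
  qed
  also have "\<dots> = (LINT \<xi>|lborel. V \<xi> * C_part UNIV \<xi>)"
    by (rule C_part_Fubini(3)[OF V]) simp
  also have "\<dots> = (LINT \<xi>|lborel. V \<xi> * C_cross)"
    by (rule integral_cong_AE)
      (use C_part_Fubini(2)[OF V, of UNIV] C_part_UNIV in \<open>auto elim: eventually_mono\<close>)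
  also have "\<dots> = L2_inner \<Psi>1 \<Psi>2 * C_cross"
    unfolding V_def L2_inner_def by (rule integral_mult_left_zero)
  also have "L2_inner \<Psi>1 \<Psi>2 = L2_inner \<psi>1 \<psi>2"
    by (rule Parseval_L2[OF psi1 psi2])
  finally show ?thesis unfolding C_pair_def using assms by simp
qed

section \<open>Truncated reconstruction\<close>

text \<open>The integral over the translations at one scale and rotation, for every \<open>x\<close>. The exceptional set of
  \<open>q\<close> is that of \<open>voice_L2\<close> and does not depend on \<open>x\<close>.\<close>

lemma voice_reconstruction:
  assumes q: "0 < fst q" "snd q \<in> SO_group"
    and h: "h \<in> L2_space" "has_fourier_L2 h H" and v: "voice H \<Psi>1 q \<in> L2_space"
  shows "(LINT t|lborel. L2_inner h (sim_rep (fst q, snd q, t) \<psi>1) * sim_rep (fst q, snd q, t) \<psi>2 x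
           / of_real (fst q ^ (CARD('n) + 1))) =
     (1 / fst q) *\<^sub>R (LINT \<xi>|lborel. H \<xi> * cis (2 * pi * (x \<bullet> \<xi>)) * cross12 q \<xi>)"
proof -
  have H: "H \<in> L2_space" by (rule has_fourier_L2_space[OF h(2)])
  \<comment> \<open>\<open>\<psi>'\<close> is the conjugate reflection, whose transform is the conjugate of \<open>\<Psi>2\<close>.\<close>
  define \<psi>' where "\<psi>' y = cnj (\<psi>2 (- y))" for y
  have p': "\<psi>' \<in> L2_space" "has_fourier_L2 \<psi>' (\<lambda>\<xi>. cnj (\<Psi>2 \<xi>))"
    unfolding \<psi>'_def[abs_def] by (intro L2_space_cnj L2_space_uminus psi2 has_fourier_cnj_uminus)+
  let ?g = "(fst q, snd q, x)"
  have g: "?g \<in> similitude_group" using q by (simp add: similitude_group_def)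
  have conj_refl: "sim_rep (fst q, snd q, t) \<psi>2 x = cnj (sim_rep ?g \<psi>' t)" for t
  proof -
    have "matrix_inv (snd q) *v ((x - t) /\<^sub>R fst q) = - (matrix_inv (snd q) *v ((t - x) /\<^sub>R fst q))"
      by (simp add: matrix_vector_mult_diff_distrib matrix_vector_mult_scaleR algebra_simps)
    then show ?thesis by (simp add: \<psi>'_def)
  qed
  have "(LINT t|lborel. L2_inner h (sim_rep (fst q, snd q, t) \<psi>1) * sim_rep (fst q, snd q, t) \<psi>2 x
           / of_real (fst q ^ (CARD('n) + 1))) =
     L2_inner (inv_fourier (voice H \<Psi>1 q)) (sim_rep ?g \<psi>') / of_real (fst q ^ (CARD('n) + 1))"
    unfolding wavelet_transform_eq[OF q h psi1] conj_refl L2_inner_def[of "inv_fourier (voice H \<Psi>1 q)"]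
    by (rule integral_divide_zero)
  also have "L2_inner (inv_fourier (voice H \<Psi>1 q)) (sim_rep ?g \<psi>') =
     L2_inner (voice H \<Psi>1 q) (sim_rep_hat ?g (\<lambda>\<xi>. cnj (\<Psi>2 \<xi>)))"
    by (intro inv_fourier_inner voice_integrable q H L2_P v sim_rep_L2 g p' has_fourier_sim_rep)
  also have "\<dots> = (LINT \<xi>|lborel. of_real (fst q ^ CARD('n)) * (H \<xi> * cis (2 * pi * (x \<bullet> \<xi>)) * cross12 q \<xi>))"
    unfolding L2_inner_def powr_half_sq[OF q(1), symmetric]
    by (intro Bochner_Integration.integral_cong refl)
       (simp add: voice_def cross_def power2_eq_square cis_cnj mult_ac)
  also have "\<dots> = of_real (fst q ^ CARD('n)) * (LINT \<xi>|lborel. H \<xi> * cis (2 * pi * (x \<bullet> \<xi>)) * cross12 q \<xi>)"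
    by (rule integral_mult_right_zero)
  also have "of_real (fst q ^ CARD('n)) * y / of_real (fst q ^ (CARD('n) + 1)) = (1 / fst q) *\<^sub>R y" for y :: complex
    using q by (simp add: scaleR_conv_of_real)
  finally show ?thesis .
qed

text \<open>Almost everywhere in \<open>q\<close> the innermost integral is known; Fubini's theorem then moves the integral
  over \<open>q\<close> inside the inverse transform.\<close>

lemma truncated_reconstruction:
  fixes h H :: "real ^ 'n \<Rightarrow> complex"
  assumes h: "h \<in> L2_space" "has_fourier_L2 h H" "integrable lborel H" and u: "0 < u"
  shows "(LINT a1:{u..v}|lborel. LINT r1|\<mu>. LINT t1|lborel.
            L2_inner h (sim_rep (a1, r1, t1) \<psi>1) * sim_rep (a1, r1, t1) \<psi>2 x / of_real (a1 ^ (CARD('n) + 1)))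
      = inv_fourier (\<lambda>\<xi>. H \<xi> * C_part {u..v} \<xi>) x"
proof -
  have H: "H \<in> L2_space" by (rule has_fourier_L2_space[OF h(2)])
  have [measurable]: "h \<in> borel_measurable borel" "H \<in> borel_measurable borel" using h by auto
  define V where "V \<xi> = H \<xi> * cis (2 * pi * (x \<bullet> \<xi>))" for \<xi>
  have V: "integrable lborel V" unfolding V_def[abs_def] by (rule integrable_cis_mult[OF h(3)]) measurable
  define Z where "Z q = (LINT t|lborel. L2_inner h (sim_rep (fst q, snd q, t) \<psi>1) * sim_rep (fst q, snd q, t) \<psi>2 x
           / of_real (fst q ^ (CARD('n) + 1)))" for q
  define Y where "Y q = indicator {u..v} (fst q) *\<^sub>R pairing V q" for q
  have Y: "integrable dilrot Y" unfolding Y_def[abs_def] by (rule C_part_Fubini(1)[OF V]) simp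
  have [measurable]: "Z \<in> borel_measurable dilrot" unfolding Z_def by measurable
  have Zm[measurable]: "Z \<in> borel_measurable (lborel \<Otimes>\<^sub>M \<mu>)"
    using \<open>Z \<in> borel_measurable dilrot\<close> by (simp add: dilrot_def)
  have Ym[measurable]: "Y \<in> borel_measurable (lborel \<Otimes>\<^sub>M \<mu>)"
    using borel_measurable_integrable[OF Y] by (simp add: dilrot_def)
  let ?d = "\<lambda>q :: real \<times> (real ^ 'n ^ 'n). indicator {0<..} (fst q) / fst q"
  have dd: "dilrot = density (lborel \<Otimes>\<^sub>M \<mu>) (\<lambda>q. ennreal (?d q))"
    unfolding dilrot_def by (intro arg_cong2[where f=density] refl ext) (auto simp: indicator_def)
  have dm[measurable]: "?d \<in> borel_measurable (lborel \<Otimes>\<^sub>M \<mu>)" by measurable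
  have AEZ: "AE q in dilrot. Z q = (1 / fst q) *\<^sub>R pairing V q"
    using dilrot_pos voice_L2[OF adm1 H]
  proof eventually_elim
    case (elim q)
    then show ?case
      using voice_reconstruction[of q h H x] h unfolding Z_def V_def by simp
  qed
  have AEq: "AE q in lborel \<Otimes>\<^sub>M \<mu>. indicator {u..v} (fst q) *\<^sub>R Z q = ?d q *\<^sub>R Y q"
  proof -
    \<comment> \<open>An almost sure statement for \<open>dilrot\<close> says nothing about scales \<open>a \<le> 0\<close>; the window lies in the positive scales.\<close>
    have "AE q in lborel \<Otimes>\<^sub>M \<mu>. 0 < ennreal (?d q) \<longrightarrow> Z q = (1 / fst q) *\<^sub>R pairing V q"
      using AEZ unfolding dd by (subst (asm) AE_density) auto
    then show ?thesis
    proof eventually_elim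
      case (elim q)
      show ?case
      proof (cases "fst q \<in> {u..v}")
        case True
        then have "0 < fst q" using u by auto
        then show ?thesis using elim True by (simp add: Y_def)
      qed (simp add: Y_def)
    qed
  qed
  have iY: "integrable (lborel \<Otimes>\<^sub>M \<mu>) (\<lambda>q. ?d q *\<^sub>R Y q)"
    using Y unfolding dd by (subst (asm) integrable_density) (auto simp: indicator_def)
  have iZ: "integrable (lborel \<Otimes>\<^sub>M \<mu>) (\<lambda>q. indicator {u..v} (fst q) *\<^sub>R Z q)"
    by (rule integrable_cong_AE_imp[OF iY]) (use AEq in \<open>auto elim: eventually_mono\<close>)
  have "(LINT a1:{u..v}|lborel. LINT r1|\<mu>. LINT t1|lborel.
            L2_inner h (sim_rep (a1, r1, t1) \<psi>1) * sim_rep (a1, r1, t1) \<psi>2 x / of_real (a1 ^ (CARD('n) + 1)))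
     = (LINT a|lborel. LINT r|\<mu>. indicator {u..v} (fst (a, r)) *\<^sub>R Z (a, r))"
    unfolding set_lebesgue_integral_def Z_def by (simp only: fst_conv snd_conv integral_scaleR_right)
  also have "\<dots> = (LINT q|(lborel \<Otimes>\<^sub>M \<mu>). indicator {u..v} (fst q) *\<^sub>R Z q)"
    by (rule lm.integral_fst'[OF iZ])
  also have "\<dots> = (LINT q|(lborel \<Otimes>\<^sub>M \<mu>). ?d q *\<^sub>R Y q)"
    by (rule integral_cong_AE) (use AEq in auto)
  also have "\<dots> = (LINT q|dilrot. Y q)"
    unfolding dd by (subst integral_density) (auto simp: indicator_def)
  also have "\<dots> = (LINT \<xi>|lborel. V \<xi> * C_part {u..v} \<xi>)"
    unfolding Y_def by (rule C_part_Fubini(3)[OF V]) simp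
  also have "\<dots> = inv_fourier (\<lambda>\<xi>. H \<xi> * C_part {u..v} \<xi>) x"
    unfolding inv_fourier_def V_def by (intro Bochner_Integration.integral_cong refl) (simp add: mult_ac)
  finally show ?thesis .
qed

lemma inv_fourier_measurable:
  fixes U :: "real ^ 'k \<Rightarrow> complex"
  assumes "integrable lborel U" shows "inv_fourier U \<in> borel_measurable borel"
proof -
  have "(\<lambda>x :: real ^ 'k. - x) \<in> borel \<rightarrow>\<^sub>M borel"
    by (intro borel_measurable_continuous_onI continuous_intros)
  moreover have "fourier_L1 U \<in> borel_measurable borel"
    by (rule fourier_L1_measurable) (use assms in auto)
  ultimately show ?thesis
    unfolding inv_fourier_eq[abs_def] by (rule measurable_compose)
qed

lemma borel_measurable_residual:
  fixes u v :: "real ^ 'k \<Rightarrow> complex"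
  assumes [measurable]: "u \<in> borel_measurable borel" "v \<in> borel_measurable borel"
  shows "(\<lambda>x. ereal (cmod (u x - c * v x))) \<in> borel_measurable lborel"
  by measurable

text \<open>The residual is the inverse transform of \<open>H (C - C_part) / C\<close>. The substitution in the frequency
  turns \<open>a\<^bsup>n/2\<^esup>\<close> from the transform into \<open>a\<^bsup>-n/2\<^esup>\<close> and frees the tail from \<open>a\<close> and \<open>r\<close>.\<close>

lemma truncation_error:
  fixes f F :: "real ^ 'n \<Rightarrow> complex" and u v :: real
  assumes f: "f \<in> L2_space" "has_fourier_L2 f F" "integrable lborel F"
    and g: "(a, r, t) \<in> similitude_group" and u: "0 < u" and C: "C_cross \<noteq> 0"
  defines "R \<equiv> inv_fourier (\<lambda>\<xi>. sim_rep_hat (a, r, t) F \<xi> * C_part {u * a..v * a} \<xi>)"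
  shows "AE x in lborel. ennreal (cmod (sim_rep (a, r, t) f x - inverse C_cross * R x)) \<le>
     ennreal (a powr (- (real CARD('n) / 2)) / cmod C_cross) *
       (\<integral>\<^sup>+\<xi>. ennreal (cmod (F \<xi>)) * C_tail {u..v} \<xi> \<partial>lborel)"
proof -
  have a: "0 < a" "r \<in> SO_group" using g by (auto simp: similitude_group_def)
  let ?S = "{u * a..v * a}"
  let ?n = "real CARD('n) / 2"
  let ?f = "\<lambda>\<xi>. ennreal (cmod (F \<xi>)) * C_tail {u..v} \<xi>"
  let ?T = "\<integral>\<^sup>+\<xi>. ?f \<xi> \<partial>lborel"
  define H where "H = sim_rep_hat (a, r, t) F"
  have H1: "integrable lborel H" unfolding H_def by (rule sim_rep_hat_integrable[OF g f(3)])
  have [measurable]: "F \<in> borel_measurable borel" "H \<in> borel_measurable borel" using f(3) H1 by auto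
  have hf: "has_fourier_L2 (sim_rep (a, r, t) f) H"
    unfolding H_def by (rule has_fourier_sim_rep[OF g f(1,2)])
  have HP: "integrable lborel (\<lambda>\<xi>. H \<xi> * C_part ?S \<xi>)"
    by (rule C_part_Fubini(2)[OF H1]) simp
  have bound: "ennreal (cmod (inv_fourier H x - inverse C_cross * R x)) \<le>
      ennreal (a powr (- ?n) / cmod C_cross) * ?T" for x
  proof -
    let ?e = "\<lambda>\<xi>. cis (2 * pi * (x \<bullet> \<xi>))"
    let ?D = "\<lambda>\<xi>. H \<xi> * ?e \<xi> - inverse C_cross * (H \<xi> * C_part ?S \<xi> * ?e \<xi>)"
    have i1: "integrable lborel (\<lambda>\<xi>. H \<xi> * ?e \<xi>)" by (rule integrable_cis_mult[OF H1]) simp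
    have i2: "integrable lborel (\<lambda>\<xi>. inverse C_cross * (H \<xi> * C_part ?S \<xi> * ?e \<xi>))"
      by (intro integrable_mult_right integrable_cis_mult HP) simp
    have "inv_fourier H x - inverse C_cross * R x =
       (LINT \<xi>|lborel. ?D \<xi>)"
      unfolding R_def H_def[symmetric] inv_fourier_def integral_mult_right_zero[symmetric]
      by (rule Bochner_Integration.integral_diff[symmetric, OF i1 i2])
    then have "ennreal (cmod (inv_fourier H x - inverse C_cross * R x)) \<le>
       (\<integral>\<^sup>+\<xi>. ennreal (cmod (?D \<xi>)) \<partial>lborel)"
      using integral_norm_bound_ennreal[OF Bochner_Integration.integrable_diff[OF i1 i2]] by simp
    also have "\<dots> \<le> (\<integral>\<^sup>+\<xi>. ennreal (1 / cmod C_cross) * (ennreal (cmod (H \<xi>)) * C_tail ?S \<xi>) \<partial>lborel)"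
    proof (rule nn_integral_mono_AE)
      have [measurable]: "?S \<in> sets borel" by simp
      show "AE \<xi> in lborel. ennreal (cmod (?D \<xi>)) \<le>
        ennreal (1 / cmod C_cross) * (ennreal (cmod (H \<xi>)) * C_tail ?S \<xi>)"
        using C_tail_bound[of ?S, simplified]
      proof eventually_elim
        case (elim \<xi>)
        have "?D \<xi> =
           inverse C_cross * (H \<xi> * (C_cross - C_part ?S \<xi>)) * ?e \<xi>"
          using C by (simp add: field_simps)
        then have "cmod (?D \<xi>) =
          (1 / cmod C_cross) * (cmod (H \<xi>) * cmod (C_cross - C_part ?S \<xi>))"
          by (simp only: norm_mult norm_divide norm_one norm_cis mult_1_right inverse_eq_divide)
        then have "ennreal (cmod (?D \<xi>)) =
          ennreal (1 / cmod C_cross) * (ennreal (cmod (H \<xi>)) * ennreal (cmod (C_cross - C_part ?S \<xi>)))"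
          by (simp only: ennreal_mult norm_ge_zero mult_nonneg_nonneg zero_le_divide_1_iff)
        also have "\<dots> \<le> ennreal (1 / cmod C_cross) * (ennreal (cmod (H \<xi>)) * C_tail ?S \<xi>)"
          by (intro mult_left_mono elim) auto
        finally show ?case .
      qed
    qed
    also have "\<dots> = ennreal (1 / cmod C_cross) * (\<integral>\<^sup>+\<xi>. ennreal (cmod (H \<xi>)) * C_tail ?S \<xi> \<partial>lborel)"
      by (rule nn_integral_cmult) measurable
    also have "(\<integral>\<^sup>+\<xi>. ennreal (cmod (H \<xi>)) * C_tail ?S \<xi> \<partial>lborel) =
       (\<integral>\<^sup>+\<xi>. ennreal (a powr ?n) * (?f (dual_act (a, r) \<xi>)) \<partial>lborel)"
    proof (rule nn_integral_cong)
      fix \<xi>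
      have "C_tail ?S \<xi> = C_tail {u..v} (dual_act (a, r) \<xi>)"
        using C_tail_dual_act[of "(a, r)" u v \<xi>] a by simp
      then show "ennreal (cmod (H \<xi>)) * C_tail ?S \<xi> =
        ennreal (a powr ?n) * (?f (dual_act (a, r) \<xi>))"
        by (simp add: H_def norm_mult ennreal_mult mult.assoc)
    qed
    also have "\<dots> = ennreal (a powr ?n) * (\<integral>\<^sup>+\<xi>. ?f (dual_act (a, r) \<xi>) \<partial>lborel)"
      by (rule nn_integral_cmult) measurable
    also have "ennreal (a powr ?n) = ennreal (a powr (- ?n)) * ennreal (a ^ CARD('n))"
      using a by (simp add: ennreal_mult'[symmetric] powr_half_inv)
    also have "ennreal (a powr (- ?n)) * ennreal (a ^ CARD('n)) *
        (\<integral>\<^sup>+\<xi>. ?f (dual_act (a, r) \<xi>) \<partial>lborel) =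
      ennreal (a powr (- ?n)) * ?T"
      unfolding mult.assoc
      by (subst nn_integral_dual_act[OF a, where f="?f"]) auto
    also have "ennreal (1 / cmod C_cross) * (ennreal (a powr (- ?n)) * ?T) =
       ennreal (a powr (- ?n) / cmod C_cross) * ?T"
      by (simp add: mult.assoc[symmetric] ennreal_mult'[symmetric])
    finally show ?thesis .
  qed
  from fourier_inversion_L2[OF sim_rep_L2[OF g f(1)] hf H1]
  show ?thesis by eventually_elim (simp only: bound)
qed

end

theorem theorem3p4:
  fixes \<mu> :: "(real ^ 'n ^ 'n) measure"
    and \<psi>1 \<psi>2 f :: "real ^ 'n \<Rightarrow> complex"
    and \<epsilon> p :: real
  assumes "CARD('n) \<ge> 2"
    and "normalized_haar_SO \<mu>"
    and "admissible_pair \<mu> \<psi>1 \<psi>2"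
    and "f \<in> L2_space"
    and "integrable lborel (fourier_L2 f)"
    and "\<epsilon> > 0" and "p > 0"
  shows "\<exists>A1 A2 :: real. 0 < A1 \<and> A1 < A2 \<and>
    (\<forall>a r t A1' A2'. (a, r, t) \<in> similitude_group \<longrightarrow> p \<le> a \<longrightarrow>
       0 < A1' \<longrightarrow> A1' \<le> A1 \<longrightarrow> A2 \<le> A2' \<longrightarrow>
       Linf_norm (\<lambda>x. sim_rep (a, r, t) f x -
         inverse (C_pair \<mu> \<psi>1 \<psi>2) *
         (LINT a1:{A1' * a..A2' * a}|lborel. LINT r1|\<mu>. LINT t1|lborel.
            L2_inner (sim_rep (a, r, t) f) (sim_rep (a1, r1, t1) \<psi>1) *
            sim_rep (a1, r1, t1) \<psi>2 x / of_real (a1 ^ (CARD('n) + 1))))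
       \<le> ereal \<epsilon>)"
proof -
  have adm: "admissible \<mu> \<psi>1" "admissible \<mu> \<psi>2" and ne: "L2_inner \<psi>1 \<psi>2 \<noteq> 0" and C0: "C_pair \<mu> \<psi>1 \<psi>2 \<noteq> 0"
    using assms(3) by (auto simp: admissible_pair_def)
  have L2: "\<psi>1 \<in> L2_space" "\<psi>2 \<in> L2_space" using adm by (auto simp: admissible_def)
  interpret haar_SO \<mu> by standard (fact assms(2))
  interpret wavelet_transform_pair \<mu> "fourier_L2 \<psi>1" "fourier_L2 \<psi>2" \<psi>1 \<psi>2
    by standard (use assms(1) adm L2 in \<open>auto intro: admissible_finite_adm has_fourier_fourier_L2\<close>)
  define F where "F = fourier_L2 f"
  have F: "has_fourier_L2 f F" "integrable lborel F"
    using has_fourier_fourier_L2[OF assms(4)] assms(5) by (simp_all add: F_def)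
  have "f \<in> borel_measurable borel" using assms(4) by auto
  let ?C = "C_pair \<mu> \<psi>1 \<psi>2"
  let ?n = "real CARD('n) / 2"
  have CC: "?C = C_cross" by (rule C_pair_eq[OF ne])
  have Cx: "C_cross \<noteq> 0" using C0 CC by simp
  \<comment> \<open>Chosen so that the bound of \<open>truncation_error\<close> with \<open>p\<close> in place of \<open>a\<close> is exactly \<open>\<epsilon>\<close>.\<close>
  define \<delta> where "\<delta> = \<epsilon> * cmod C_cross * p powr ?n"
  have \<delta>: "0 < \<delta>" using assms(6,7) Cx by (simp add: \<delta>_def)
  define T where "T S = (\<integral>\<^sup>+\<xi>. ennreal (cmod (F \<xi>)) * C_tail S \<xi> \<partial>lborel)" for S
  \<comment> \<open>The shift by 2 makes \<open>1 / (k + 2) < k + 2\<close>.\<close>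
  have "\<forall>\<^sub>F k in sequentially. T {1 / real (k + 2)..real (k + 2)} < ennreal \<delta>"
    unfolding T_def by (rule order_tendstoD(2)[OF C_tail_limit[OF F(2)]]) (simp only: ennreal_less_zero_iff \<delta>)
  then obtain k where k: "T {1 / real (k + 2)..real (k + 2)} < ennreal \<delta>"
    by (rule eventually_happens'[OF sequentially_bot, THEN exE])
  define A1 A2 where "A1 = 1 / real (k + 2)" and "A2 = real (k + 2)"
  have "1 / real (k + 2) < 1" "1 \<le> real (k + 2)" by simp_all
  then have A: "0 < A1" "A1 < A2" unfolding A1_def A2_def by (simp, linarith)
  show ?thesis
  proof (rule exI[of _ A1], rule exI[of _ A2], intro conjI allI impI, goal_cases)
    case (3 a r t A1' A2')
    then have g: "(a, r, t) \<in> similitude_group" and pa: "p \<le> a"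
      and A': "0 < A1'" "A1' \<le> A1" "A2 \<le> A2'" by simp_all
    have a: "0 < a" "r \<in> SO_group" using g by (auto simp: similitude_group_def)
    let ?H = "sim_rep_hat (a, r, t) F"
    let ?R = "inv_fourier (\<lambda>\<xi>. ?H \<xi> * C_part {A1' * a..A2' * a} \<xi>)"
    have rec: "(LINT a1:{A1' * a..A2' * a}|lborel. LINT r1|\<mu>. LINT t1|lborel.
            L2_inner (sim_rep (a, r, t) f) (sim_rep (a1, r1, t1) \<psi>1) *
            sim_rep (a1, r1, t1) \<psi>2 x / of_real (a1 ^ (CARD('n) + 1))) = ?R x" for x
      by (rule truncated_reconstruction[OF sim_rep_L2[OF g assms(4)] has_fourier_sim_rep[OF g assms(4) F(1)]
            sim_rep_hat_integrable[OF g F(2)]]) (use a A' in simp)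
    have "integrable lborel (\<lambda>\<xi>. ?H \<xi> * C_part {A1' * a..A2' * a} \<xi>)"
      by (rule C_part_Fubini(2)[OF sim_rep_hat_integrable[OF g F(2)] atLeastAtMost_borel])
    then have Rm: "?R \<in> borel_measurable borel" by (rule inv_fourier_measurable)
    have Dm: "(\<lambda>x. ereal (cmod (sim_rep (a, r, t) f x - inverse ?C * ?R x))) \<in> borel_measurable lborel"
      by (rule borel_measurable_residual[OF sim_rep_measurable1[OF \<open>f \<in> borel_measurable borel\<close>] Rm])
    have "T {A1'..A2'} \<le> T {A1..A2}"
      unfolding T_def by (intro nn_integral_mono mult_left_mono C_tail_mono) (use A' in auto)
    then have Tle: "T {A1'..A2'} \<le> ennreal \<delta>" using k unfolding A1_def A2_def by (rule order_trans[OF _ less_imp_le])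
    have "ennreal (a powr (- ?n) / cmod C_cross) * T {A1'..A2'} \<le> ennreal (p powr (- ?n) / cmod C_cross) * ennreal \<delta>"
    proof (intro mult_mono Tle ennreal_leI divide_right_mono)
      show "a powr (- ?n) \<le> p powr (- ?n)" by (rule powr_mono2') (use pa assms(7) in auto)
    qed auto
    also have "\<dots> = ennreal (p powr (- ?n) / cmod C_cross * \<delta>)"
      using \<delta> by (intro ennreal_mult[symmetric]) auto
    also have "p powr (- ?n) / cmod C_cross * \<delta> = \<epsilon>"
    proof -
      have pp: "p powr (- ?n) * p powr ?n = 1"
        unfolding powr_add[symmetric] using assms(7) by simp
      have "u / c * (\<epsilon> * c * w) = (u * w) * \<epsilon>" if "c \<noteq> 0" for u c w :: real
        using that by simp
      from this[of "cmod C_cross" "p powr (- ?n)" "p powr ?n"] Cx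
      show ?thesis unfolding \<delta>_def pp by (simp only: norm_eq_zero mult_1_left not_False_eq_True)
    qed
    finally have le: "ennreal (a powr (- ?n) / cmod C_cross) * T {A1'..A2'} \<le> ennreal \<epsilon>" .
    have "AE x in lborel. ereal (cmod (sim_rep (a, r, t) f x - inverse ?C * ?R x)) \<le> ereal \<epsilon>"
      using truncation_error[OF assms(4) F g A'(1) Cx, of A2'] unfolding CC
    proof eventually_elim
      case (elim x)
      from order_trans[OF elim le[unfolded T_def]] assms(6) show ?case by (simp add: ennreal_le_iff)
    qed
    then show ?case
      unfolding Linf_norm_def rec by (rule esssup_I[OF Dm])
  qed (fact A)+
qed

end
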